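(* Let $n\ge1$ and $M\ge 1$. There exists a constant $C=C(n,M)>0$ such that the following holds. Let $f\,d\gamma$ be a probability measure on $\mathbb{R}^n$ with $\sqrt f\in W^{1,2}(\mathbb{R}^n,d\gamma)$ such that, for every $i\in\{1,\dots,n\}$ and all values of the remaining variables $(x_j)_{j\neq i}$, $$\int_{\mathbb{R}} |x_i|^2 f(x_1,\ldots,x_{i-1},x_i,x_{i+1},\ldots,x_n)\,d\gamma(x_i)\le M$$ and the function $x_i\mapsto f(x_1,\ldots,x_{i-1},x_i,x_{i+1},\ldots,x_n)$ is centered, i.e. $\int_{\mathbb{R}} x_i f(x_1,\ldots,x_n)\,d\gamma(x_i)=0$. Then $$\int_{\mathbb{R}^n} |f-1|\,d\gamma\le C\,\delta(f)^{\frac14}.$$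
   Context: On $\mathbb{R}^n$, $d\gamma=(2\pi)^{-n/2}e^{-|x|^2/2}dx$ is the standard Gaussian measure, and $d\gamma(x_i)$ denotes the one-dimensional standard Gaussian measure in the variable $x_i$. For a probability measure $f\,d\gamma$ with $\sqrt f\in W^{1,2}(\mathbb{R}^n,d\gamma)$, the Fisher information is $\mathrm{I}(f)=\int \frac{|\nabla f|^2}{f}\,d\gamma$, the relative entropy is $\mathrm{H}(f)=\int f\log f\,d\gamma$, and the log-Sobolev deficit is $\delta(f)=\frac12 \mathrm{I}(f)-\mathrm{H}(f)\ge 0$. *)

theory Defs
  imports "HOL-Probability.Probability"
begin

definition gauss :: "'a::euclidean_space measure" where
  "gauss = density lborel
     (\<lambda>x. ennreal ((2 * pi) powr (- real DIM('a) / 2) * exp (- (norm x)\<^sup>2 / 2)))"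

(* In dimension one this is the library's standard normal distribution. *)
lemma gauss_real: "(gauss :: real measure) = density lborel std_normal_density"
proof -
  have "(2 * pi) powr (- real DIM(real) / 2) = inverse ((2 * pi) powr (1 / 2))"
    by (simp flip: powr_minus)
  also have "(2 * pi) powr (1 / 2) = sqrt (2 * pi)"
    by (rule powr_half_sqrt) simp
  finally show ?thesis
    by (simp add: gauss_def std_normal_density_def inverse_eq_divide)
qed

(* Ck k \<phi> means that \<phi> is k times continuously differentiable. *)
primrec Ck :: "nat \<Rightarrow> ('a::euclidean_space \<Rightarrow> real) \<Rightarrow> bool" where
  "Ck 0 \<phi> \<longleftrightarrow> continuous_on UNIV \<phi>"
| "Ck (Suc k) \<phi> \<longleftrightarrow>
     (\<exists>D. (\<forall>x. GDERIV \<phi> x :> D x) \<and> (\<forall>b\<in>Basis. Ck k (\<lambda>x. D x \<bullet> b)))"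

definition test_function :: "('a::euclidean_space \<Rightarrow> real) \<Rightarrow> bool" where
  "test_function \<phi> \<longleftrightarrow> (\<forall>k. Ck k \<phi>) \<and> compact (closure {x. \<phi> x \<noteq> 0})"

definition locally_integrable ::
    "('a::euclidean_space \<Rightarrow> 'b::{banach,second_countable_topology}) \<Rightarrow> bool" where
  "locally_integrable u \<longleftrightarrow>
     u \<in> borel_measurable borel \<and> (\<forall>K. compact K \<longrightarrow> set_integrable lborel K u)"

(* Distributional gradient; note that the integration by parts is with respect to
   Lebesgue measure, not the Gaussian. *)
definition is_weak_gradient :: "('a::euclidean_space \<Rightarrow> real) \<Rightarrow> ('a \<Rightarrow> 'a) \<Rightarrow> bool" where
  "is_weak_gradient u g \<longleftrightarrow>
     locally_integrable u \<and> locally_integrable g \<and>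
     (\<forall>\<phi> D. test_function \<phi> \<and> (\<forall>x. GDERIV \<phi> x :> D x) \<longrightarrow>
        (\<integral>x. u x *\<^sub>R D x \<partial>lborel) = - (\<integral>x. \<phi> x *\<^sub>R g x \<partial>lborel))"

definition sobolev_W12_gauss :: "('a::euclidean_space \<Rightarrow> real) \<Rightarrow> bool" where
  "sobolev_W12_gauss u \<longleftrightarrow>
     u \<in> borel_measurable borel \<and> integrable gauss (\<lambda>x. (u x)\<^sup>2) \<and>
     (\<exists>g. is_weak_gradient u g \<and> integrable gauss (\<lambda>x. (norm (g x))\<^sup>2))"

(* Unique up to Lebesgue-null sets whenever a weak gradient exists; the choice of
   representative does not affect the integrals below. *)
definition weak_gradient :: "('a::euclidean_space \<Rightarrow> real) \<Rightarrow> ('a \<Rightarrow> 'a)" where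
  "weak_gradient u = (SOME g. is_weak_gradient u g)"

(* For f \<ge> 0 with sqrt f in W^{1,2}(gauss), the weak gradient of f is
   2 sqrt f \<nabla>(sqrt f) and vanishes a.e. on {f = 0}, so the convention y / 0 = 0 is the
   usual one. The integrand is then integrable, and so is f log f (with 0 log 0 = 0) in
   the entropy, by the Gaussian log-Sobolev inequality. *)
definition fisher_information :: "('a::euclidean_space \<Rightarrow> real) \<Rightarrow> real" where
  "fisher_information f = (\<integral>x. (norm (weak_gradient f x))\<^sup>2 / f x \<partial>gauss)"

definition relative_entropy :: "('a::euclidean_space \<Rightarrow> real) \<Rightarrow> real" where
  "relative_entropy f = (\<integral>x. f x * ln (f x) \<partial>gauss)"

definition lsi_deficit :: "('a::euclidean_space \<Rightarrow> real) \<Rightarrow> real" where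
  "lsi_deficit f = fisher_information f / 2 - relative_entropy f"

definition subst_coord :: "real ^ 'n \<Rightarrow> 'n \<Rightarrow> real \<Rightarrow> real ^ 'n" where
  "subst_coord x i t = (\<chi> j. if j = i then t else x $ j)"

end

theory Submission
  imports Defs "HOL-Real_Asymp.Real_Asymp"
begin

text \<open>
The logarithmic Sobolev inequality tensorises: entropy is subadditive over the coordinates and
Fisher information is additive. Hence the deficit of \<open>f\<close> dominates the sum over \<open>i\<close> of the mean
deficit of the restrictions of \<open>f\<close> to lines parallel to the \<open>i\<close>-th axis. The \<open>L\<^sup>1\<close> distance of \<open>f\<close>
from 1 is in turn at most the sum over \<open>i\<close> of the distances of \<open>f\<close> from its average along such lines.
So everything reduces to a stability estimate on the line. The restrictions are not normalised:
a line carries some mass \<open>m\<close>, and the second moment bound \<open>M\<close> holds before normalisation. The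
one-dimensional estimate is therefore stated linearly in the deficit, with a free parameter:
\<open>\<integral> \<bar>h - m\<bar> \<le> const * (\<eta> (m + M) + deficit / \<eta>\<^sup>3)\<close> for every \<open>\<eta> > 0\<close>. Both sides can be integrated over
the lines, and \<open>\<eta> = deficit powr (1/4)\<close> at the end gives the exponent.

On the line let \<open>\<rho>\<close> be the Gaussian density, \<open>h \<rho>\<close> a centred probability density with
bounded second moment, \<open>T\<close> the monotone map transporting it to the Gaussian and
\<open>\<theta> x = T x - x\<close>. Write \<open>A = \<integral> \<theta>\<^sup>2 h \<rho>\<close> and \<open>J = \<integral> h' \<theta> \<rho>\<close>. The change of variables formula
\<open>h = \<rho> (T x) T' x / \<rho> x\<close> gives two expressions for the entropy \<open>H\<close>. One is Talagrand's inequality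
with its remainder, \<open>H = A / 2 + D\<close>, where \<open>D\<close> is nonnegative and controls \<open>T' - 1\<close>. The
other is \<open>H \<le> - A / 2 - J\<close>, which leads to the HWI inequality. Together they show that
\<open>R = \<integral> (h' + \<theta> h)\<^sup>2 / h \<rho>\<close> is at most twice the deficit and that \<open>D \<le> - (A + J)\<close>, which by the
Cauchy-Schwarz inequality is of the order of the square root of the deficit. As \<open>\<theta>\<close> has mean zero
(this is where centring enters), an \<open>L\<^sup>1\<close> Poincare inequality turns the bound on \<open>D\<close> into
\<open>\<integral> \<bar>\<theta>\<bar> h \<rho> \<le> const * deficit powr (1/4)\<close>. The bound on \<open>R\<close> transfers this
to \<open>\<integral> \<bar>h'\<bar> \<rho>\<close>, and a second use of the Poincare inequality gives \<open>\<integral> \<bar>h - 1\<bar> \<rho>\<close>. This is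
\<open>lsi_stability_positive\<close>; \<open>lsi_stability_line\<close> removes the positivity and the normalisation.

To restrict a Sobolev function to lines, its distributional gradient must be turned into
derivatives along almost every line. The increment formula \<open>weak_gradient_increment\<close> says
that \<open>u (x + t e) - u x\<close> is the integral of the gradient for almost all pairs \<open>(x, t)\<close>; by Fubini,
on almost every line \<open>u\<close> agrees with an absolutely continuous function (\<open>weak_gradient_ac_on_lines\<close>).
This also yields the product rule for \<open>f = u\<^sup>2\<close>, which identifies the chosen weak gradient of \<open>f\<close>
and hence the Fisher information. The two tensorisation statements are \<open>entropy_tensorization\<close>
and \<open>L1_tensorization\<close>.
\<close>

section \<open>Absolutely continuous functions on the line\<close>

lemma integrable_bound_pointwise:
  fixes f :: "'a \<Rightarrow> 'b::{banach, second_countable_topology}" and g :: "'a \<Rightarrow> 'c::{banach, second_countable_topology}"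
  assumes "integrable M f" "g \<in> borel_measurable M" "\<And>x. norm (g x) \<le> norm (f x)"
  shows "integrable M g"
  using assms by (intro Bochner_Integration.integrable_bound[of M f g]) auto

text \<open>Local absolute continuity, recorded through the integrated form of the fundamental theorem
of calculus; in this form products and integration by parts become instances of Fubini.\<close>

definition ac_deriv :: "(real \<Rightarrow> real) \<Rightarrow> (real \<Rightarrow> real) \<Rightarrow> bool" where
  "ac_deriv G g \<longleftrightarrow> g \<in> borel_measurable borel \<and>
     (\<forall>a b. a \<le> b \<longrightarrow> set_integrable lborel {a..b} g \<and> G b - G a = (LINT x:{a..b}|lborel. g x))"

lemma ac_derivD:
  assumes "ac_deriv G g" "a \<le> b"
  shows "set_integrable lborel {a..b} g" "G b - G a = (LINT x:{a..b}|lborel. g x)"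
  using assms by (auto simp: ac_deriv_def)

lemma ac_deriv_measurable: "ac_deriv G g \<Longrightarrow> g \<in> borel_measurable borel"
  by (simp add: ac_deriv_def)

lemma ac_deriv_continuous:
  assumes "ac_deriv G g"
  shows "continuous_on UNIV G"
proof -
  have "isCont G x" for x
  proof -
    have "continuous_on {x-1..x+1} (\<lambda>y. integral {x-1..y} g)"
      using set_borel_integral_eq_integral(1)[OF ac_derivD(1)[OF assms, of "x-1" "x+1"]]
      by (intro indefinite_integral_continuous_1) auto
    then have "continuous_on {x-1..x+1} (\<lambda>y. G (x-1) + integral {x-1..y} g)"
      by (intro continuous_on_add continuous_on_const)
    moreover have "G (x-1) + integral {x-1..y} g = G y" if "y \<in> {x-1..x+1}" for y
      using ac_derivD[OF assms, of "x-1" y] that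
        set_borel_integral_eq_integral(2)[of "{x-1..y}" g] by auto
    ultimately have "continuous_on {x-1..x+1} G"
      by (rule continuous_on_eq)
    then show ?thesis
      by (rule continuous_on_interior) auto
  qed
  then show ?thesis by (simp add: continuous_at_imp_continuous_on)
qed

lemma ac_deriv_of_continuous_derivative:
  assumes "\<And>x. (G has_real_derivative g x) (at x)" "continuous_on UNIV g"
  shows "ac_deriv G g"
proof -
  have "set_integrable lborel {a..b} g" "G b - G a = (LINT x:{a..b}|lborel. g x)" if "a \<le> b" for a b
  proof -
    have "has_bochner_integral lborel (\<lambda>x. g x * indicator {a .. b} x) (G b - G a)"
      using assms that by (intro has_bochner_integral_FTC_Icc_real)
        (auto simp: has_real_derivative_iff_has_vector_derivative continuous_on_eq_continuous_at)
    then show "set_integrable lborel {a..b} g" "G b - G a = (LINT x:{a..b}|lborel. g x)"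
      unfolding set_integrable_def set_lebesgue_integral_def has_bochner_integral_iff
      by (simp_all add: mult.commute)
  qed
  then show ?thesis unfolding ac_deriv_def
    using borel_measurable_continuous_onI[OF assms(2)] by auto
qed

lemma ac_deriv_add:
  assumes "ac_deriv G g" "ac_deriv H h"
  shows "ac_deriv (\<lambda>x. G x + H x) (\<lambda>x. g x + h x)"
  using assms unfolding ac_deriv_def
  by (auto simp: algebra_simps)

lemma ac_deriv_cmult:
  assumes "ac_deriv G g"
  shows "ac_deriv (\<lambda>x. c * G x) (\<lambda>x. c * g x)"
  using assms unfolding ac_deriv_def
  by (auto simp flip: right_diff_distrib)

lemma ac_deriv_const: "ac_deriv (\<lambda>x. c) (\<lambda>x. 0)"
  by (rule ac_deriv_of_continuous_derivative) auto

lemma set_integrable_mult_continuous: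
  assumes "set_integrable lborel {a..b} (g::real \<Rightarrow> real)" "continuous_on UNIV (H::real \<Rightarrow> real)"
  shows "set_integrable lborel {a..b} (\<lambda>x. g x * H x)"
proof -
  have "bounded (H ` {a..b})"
    using assms(2) by (intro compact_imp_bounded compact_continuous_image continuous_on_subset[OF assms(2)]) auto
  then obtain B where "\<forall>y\<in>H ` {a..b}. norm y \<le> B"
    unfolding bounded_iff by blast
  then have B: "\<bar>H x\<bar> \<le> B" if "x \<in> {a..b}" for x
    using that by auto
  have [measurable]: "H \<in> borel_measurable borel" by (rule borel_measurable_continuous_onI[OF assms(2)])
  have *: "integrable lborel (\<lambda>x. B *\<^sub>R (indicator {a..b} x *\<^sub>R g x))"
    using assms(1) unfolding set_integrable_def by (rule integrable_scaleR_right)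
  have [measurable]: "(\<lambda>x. indicator {a..b} x *\<^sub>R g x) \<in> borel_measurable borel"
    using assms(1) unfolding set_integrable_def by auto
  have "integrable lborel (\<lambda>x. (indicator {a..b} x *\<^sub>R g x) * H x)"
  proof (rule integrable_bound_pointwise[OF *])
    show "(\<lambda>x. (indicator {a..b} x *\<^sub>R g x) * H x) \<in> borel_measurable lborel" by measurable
    show "norm ((indicator {a..b} x *\<^sub>R g x) * H x) \<le> norm (B *\<^sub>R (indicator {a..b} x *\<^sub>R g x))" for x
    proof (cases "x \<in> {a..b}")
      case True
      have "\<bar>g x\<bar> * \<bar>H x\<bar> \<le> \<bar>g x\<bar> * \<bar>B\<bar>"
        using B[OF True] by (intro mult_left_mono) auto
      then show ?thesis using True by (simp add: abs_mult mult.commute)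
    qed simp
  qed
  then show ?thesis unfolding set_integrable_def by (simp add: mult.assoc)
qed

lemma lborel_integrable_prod:
  fixes f :: "'a::euclidean_space \<Rightarrow> real" and g :: "'b::euclidean_space \<Rightarrow> real"
  assumes f: "integrable lborel f" and g: "integrable lborel g"
  shows "integrable (lborel \<Otimes>\<^sub>M lborel) (\<lambda>(x, y). f x * g y)"
proof (rule lborel_pair.Fubini_integrable)
  have [measurable]: "f \<in> borel_measurable borel" "g \<in> borel_measurable borel"
    using f g by auto
  show "(\<lambda>(x, y). f x * g y) \<in> borel_measurable (lborel \<Otimes>\<^sub>M lborel)" by measurable
  have "(\<lambda>x. \<integral>y. norm (case (x, y) of (x, y) \<Rightarrow> f x * g y) \<partial>lborel) = (\<lambda>x. \<bar>f x\<bar> * (\<integral>y. \<bar>g y\<bar> \<partial>lborel))"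
    by (simp add: abs_mult)
  then show "integrable lborel (\<lambda>x. \<integral>y. norm (case (x, y) of (x, y) \<Rightarrow> f x * g y) \<partial>lborel)"
    using f by simp
  show "AE x in lborel. integrable lborel (\<lambda>y. case (x, y) of (x, y) \<Rightarrow> f x * g y)"
    using g by simp
qed

text \<open>Integration by parts from Fubini: the integral of \<open>g y * h x\<close> over the triangle
\<open>a \<le> y \<le> x \<le> b\<close> is computed in both orders.\<close>

lemma ac_deriv_mult:
  assumes G: "ac_deriv G g" and H: "ac_deriv H h"
  shows "ac_deriv (\<lambda>x. G x * H x) (\<lambda>x. g x * H x + h x * G x)"
proof -
  have cG: "continuous_on UNIV G" and cH: "continuous_on UNIV H"
    using assms ac_deriv_continuous by auto
  have [measurable]: "g \<in> borel_measurable borel" "h \<in> borel_measurable borel"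
    "G \<in> borel_measurable borel" "H \<in> borel_measurable borel"
    using ac_deriv_measurable[OF G] ac_deriv_measurable[OF H] cG cH
    by (auto intro: borel_measurable_continuous_onI)
  have *: "set_integrable lborel {a..b} (\<lambda>x. g x * H x + h x * G x) \<and>
     G b * H b - G a * H a = (LINT x:{a..b}|lborel. g x * H x + h x * G x)" if ab: "a \<le> b" for a b
  proof -
    let ?g = "\<lambda>x. indicator {a..b} x *\<^sub>R g x" and ?h = "\<lambda>x. indicator {a..b} x *\<^sub>R h x"
    have ig: "integrable lborel ?g" and ih: "integrable lborel ?h"
      using ac_derivD(1)[OF G ab] ac_derivD(1)[OF H ab] by (auto simp: set_integrable_def)
    have i1: "set_integrable lborel {a..b} (\<lambda>x. g x * H x)"
      using ac_derivD(1)[OF G ab] cH by (rule set_integrable_mult_continuous)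
    have i2: "set_integrable lborel {a..b} (\<lambda>x. h x * G x)"
      using ac_derivD(1)[OF H ab] cG by (rule set_integrable_mult_continuous)
    let ?k = "\<lambda>(y::real, x::real). (if y \<le> x then 1 else 0::real) * (?g y * ?h x)"
    have i3: "integrable (lborel \<Otimes>\<^sub>M lborel) ?k"
    proof (rule Bochner_Integration.integrable_bound)
      show "integrable (lborel \<Otimes>\<^sub>M lborel) (\<lambda>(y, x). ?g y * ?h x)"
        using ig ih by (rule lborel_integrable_prod)
      show "?k \<in> borel_measurable (lborel \<Otimes>\<^sub>M lborel)" by measurable
      show "AE z in lborel \<Otimes>\<^sub>M lborel. norm (?k z) \<le> norm (case z of (y, x) \<Rightarrow> ?g y * ?h x)"
        by (rule AE_I2) (auto split: prod.split)
    qed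
    have "(\<integral>x. (\<integral>y. ?k (y, x) \<partial>lborel) \<partial>lborel) = (\<integral>y. (\<integral>x. ?k (y, x) \<partial>lborel) \<partial>lborel)"
      using lborel_pair.Fubini_integral[of "\<lambda>y x. ?k (y, x)"] i3 by simp
    moreover have "(\<integral>y. ?k (y, x) \<partial>lborel) = indicator {a..b} x *\<^sub>R (h x * (G x - G a))" for x
    proof (cases "x \<in> {a..b}")
      case True
      have "(\<integral>y. ?k (y, x) \<partial>lborel) = (\<integral>y. h x * (indicator {a..x} y *\<^sub>R g y) \<partial>lborel)"
        using True by (intro Bochner_Integration.integral_cong) (auto split: split_indicator)
      also have "\<dots> = h x * (G x - G a)"
        using ac_derivD(2)[OF G, of a x] True by (simp add: set_lebesgue_integral_def)
      finally show ?thesis using True by simp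
    qed simp
    moreover have "(\<integral>x. ?k (y, x) \<partial>lborel) = indicator {a..b} y *\<^sub>R (g y * (H b - H y))" for y
    proof (cases "y \<in> {a..b}")
      case True
      have "(\<integral>x. ?k (y, x) \<partial>lborel) = (\<integral>x. g y * (indicator {y..b} x *\<^sub>R h x) \<partial>lborel)"
        using True by (intro Bochner_Integration.integral_cong) (auto split: split_indicator)
      also have "\<dots> = g y * (H b - H y)"
        using ac_derivD(2)[OF H, of y b] True by (simp add: set_lebesgue_integral_def)
      finally show ?thesis using True by simp
    qed simp
    ultimately have eq: "(LINT x:{a..b}|lborel. h x * (G x - G a)) = (LINT y:{a..b}|lborel. g y * (H b - H y))"
      by (simp add: set_lebesgue_integral_def)
    have "(LINT x:{a..b}|lborel. h x * (G x - G a)) = (LINT x:{a..b}|lborel. h x * G x) - G a * (H b - H a)"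
      using i2 ac_derivD[OF H ab] by (simp add: right_diff_distrib mult.commute)
    moreover have "(LINT x:{a..b}|lborel. g x * (H b - H x)) = (G b - G a) * H b - (LINT x:{a..b}|lborel. g x * H x)"
      using i1 ac_derivD[OF G ab] by (simp add: right_diff_distrib mult.commute)
    ultimately have "(LINT x:{a..b}|lborel. g x * H x + h x * G x) = G b * H b - G a * H a"
      using i1 i2 eq by (simp add: set_integral_add algebra_simps)
    then show ?thesis using i1 i2 by simp
  qed
  then show ?thesis unfolding ac_deriv_def by auto
qed

text \<open>The signed indicator of the segment from 0 to \<open>t\<close>: integrating against it gives the
oriented integral from 0 to \<open>t\<close>, for either sign of \<open>t\<close>, in a form to which Fubini applies.\<close>

definition oriented_seg :: "real \<Rightarrow> real \<Rightarrow> real" where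
  "oriented_seg t s = (if 0 \<le> s \<and> s < t then 1 else 0) - (if t \<le> s \<and> s < 0 then 1 else 0)"

lemma oriented_seg_measurable [measurable]:
  "(\<lambda>(t, s). oriented_seg t s) \<in> borel_measurable (borel \<Otimes>\<^sub>M borel)"
  unfolding oriented_seg_def by measurable

lemma oriented_seg_measurable' [measurable]: "oriented_seg t \<in> borel_measurable borel"
  unfolding oriented_seg_def by measurable

lemma oriented_seg_shift: "oriented_seg (t - c) (s - c) = oriented_seg t s - oriented_seg c s"
  by (auto simp: oriented_seg_def)

lemma oriented_seg_diff: "a \<le> b \<Longrightarrow> oriented_seg b s - oriented_seg a s = indicator {a..<b} s"
  by (auto simp: oriented_seg_def split: split_indicator)

lemma abs_oriented_seg_le: "\<bar>oriented_seg t s\<bar> \<le> indicator {- \<bar>t\<bar>..\<bar>t\<bar>} s"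
  by (auto simp: oriented_seg_def split: split_indicator)

lemma oriented_seg_eq: "oriented_seg t s = (if 0 \<le> t then indicator {0..<t} s else - indicator {t..<0} s)"
  by (auto simp: oriented_seg_def split: split_indicator)

lemma integrable_oriented_seg_mult:
  fixes V :: "real \<Rightarrow> real"
  assumes [measurable]: "V \<in> borel_measurable borel" and V: "\<And>a b. set_integrable lborel {a..b} V"
  shows "integrable lborel (\<lambda>s. oriented_seg t s * V s)"
proof (rule Bochner_Integration.integrable_bound)
  show "integrable lborel (\<lambda>s. indicator {- \<bar>t\<bar>..\<bar>t\<bar>} s *\<^sub>R V s)"
    using V by (simp add: set_integrable_def)
  show "AE s in lborel. norm (oriented_seg t s * V s) \<le> norm (indicator {- \<bar>t\<bar>..\<bar>t\<bar>} s *\<^sub>R V s)"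
    using abs_oriented_seg_le by (auto simp: abs_mult intro!: mult_right_mono)
qed simp

lemma ac_deriv_oriented_integral:
  assumes [measurable]: "V \<in> borel_measurable borel" and V: "\<And>a b. set_integrable lborel {a..b} V"
  shows "ac_deriv (\<lambda>t. c + (\<integral>s. oriented_seg t s * V s \<partial>lborel)) V"
proof -
  have "(\<integral>s. oriented_seg b s * V s \<partial>lborel) - (\<integral>s. oriented_seg a s * V s \<partial>lborel) = (LINT x:{a..b}|lborel. V x)"
    if ab: "a \<le> b" for a b
  proof -
    have "(\<integral>s. oriented_seg b s * V s \<partial>lborel) - (\<integral>s. oriented_seg a s * V s \<partial>lborel)
      = (\<integral>s. (oriented_seg b s - oriented_seg a s) * V s \<partial>lborel)"
      using integrable_oriented_seg_mult[OF assms] by (simp add: left_diff_distrib)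
    also have "\<dots> = (\<integral>s. indicator {a..<b} s * V s \<partial>lborel)" using ab by (simp add: oriented_seg_diff)
    also have "\<dots> = (\<integral>s. indicator {a..b} s * V s \<partial>lborel)"
    proof (rule integral_cong_AE)
      show "AE s in lborel. indicator {a..<b} s * V s = indicator {a..b} s * V s"
        using AE_lborel_singleton[of b] by (rule AE_mp) (auto intro!: AE_I2 split: split_indicator)
    qed simp_all
    finally show ?thesis by (simp add: set_lebesgue_integral_def)
  qed
  then show ?thesis using assms unfolding ac_deriv_def by simp
qed

lemma oriented_FTC:
  assumes G: "ac_deriv G g"
  shows "(\<integral>s. oriented_seg t s * g s \<partial>lborel) = G t - G 0"
proof -
  have gm: "g \<in> borel_measurable borel" by (rule ac_deriv_measurable[OF G])
  have i: "set_integrable lborel {a..b} g" for a b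
    using ac_derivD(1)[OF G, of a b] by (cases "a \<le> b") (auto simp: set_integrable_def)
  have z: "(\<integral>s. oriented_seg 0 s * g s \<partial>lborel) = 0" by (simp add: oriented_seg_eq)
  have W: "ac_deriv (\<lambda>t. 0 + (\<integral>s. oriented_seg t s * g s \<partial>lborel)) g"
    by (rule ac_deriv_oriented_integral[OF gm i])
  show ?thesis
  proof (cases "0 \<le> t")
    case True
    then show ?thesis using ac_derivD(2)[OF G True] ac_derivD(2)[OF W True] z by simp
  next
    case False
    then have "t \<le> 0" by simp
    then show ?thesis using ac_derivD(2)[OF G, of t 0] ac_derivD(2)[OF W, of t 0] z by simp
  qed
qed

section \<open>An L1 Poincare inequality on the line\<close>

text \<open>The products of indicators say that \<open>x\<close> lies between \<open>r\<close> and \<open>s\<close>. Keeping both orders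
makes the integral over independent \<open>r\<close> and \<open>s\<close> factorise.\<close>

lemma abs_increment_le_nn_integral:
  assumes G: "ac_deriv G g"
  shows "ennreal \<bar>G s - G r\<bar> \<le>
    (\<integral>\<^sup>+x. ennreal \<bar>g x\<bar> * (indicator {..x} r * indicator {x..} s + indicator {x..} r * indicator {..x} s) \<partial>lborel)"
proof -
  have *: "ennreal \<bar>G b - G a\<bar> \<le> (\<integral>\<^sup>+x. ennreal \<bar>g x\<bar> * (indicator {..x} a * indicator {x..} b) \<partial>lborel)"
    if "a \<le> b" for a b
  proof -
    have i: "integrable lborel (\<lambda>x. indicator {a..b} x *\<^sub>R g x)"
      using ac_derivD(1)[OF G that] by (simp add: set_integrable_def)
    have "ennreal \<bar>G b - G a\<bar> = ennreal (norm (\<integral>x. indicator {a..b} x *\<^sub>R g x \<partial>lborel))"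
      using ac_derivD(2)[OF G that] by (simp add: set_lebesgue_integral_def)
    also have "\<dots> \<le> (\<integral>\<^sup>+x. norm (indicator {a..b} x *\<^sub>R g x) \<partial>lborel)"
      by (rule integral_norm_bound_ennreal[OF i])
    also have "\<dots> = (\<integral>\<^sup>+x. ennreal \<bar>g x\<bar> * (indicator {..x} a * indicator {x..} b) \<partial>lborel)"
      by (intro nn_integral_cong) (auto split: split_indicator)
    finally show ?thesis .
  qed
  show ?thesis
  proof (cases "r \<le> s")
    case True
    then show ?thesis
      by (intro order_trans[OF *[OF True]] nn_integral_mono mult_left_mono) auto
  next
    case False
    then have "s \<le> r" by simp
    have "ennreal \<bar>G s - G r\<bar> \<le> (\<integral>\<^sup>+x. ennreal \<bar>g x\<bar> * (indicator {..x} s * indicator {x..} r) \<partial>lborel)"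
      using *[OF \<open>s \<le> r\<close>] by (simp add: abs_minus_commute)
    also have "\<dots> \<le> (\<integral>\<^sup>+x. ennreal \<bar>g x\<bar> * (indicator {..x} r * indicator {x..} s + indicator {x..} r * indicator {..x} s) \<partial>lborel)"
      by (intro nn_integral_mono mult_left_mono) (auto simp: mult.commute)
    finally show ?thesis .
  qed
qed

text \<open>Write \<open>G s - G r\<close> as an integral of \<open>g\<close> over the points between \<open>r\<close> and \<open>s\<close> and exchange
the integrals: a point \<open>x\<close> receives as weight the probability that two independent samples lie on
different sides of it. For the Gaussian this probability is at most a multiple of the density.\<close>

lemma L1_poincare:
  fixes G g :: "real \<Rightarrow> real"
  assumes N: "prob_space N" "sets N = sets borel" and G: "ac_deriv G g" and iG: "integrable N G"
    and [measurable]: "q \<in> borel_measurable borel"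
    and q: "\<And>x. emeasure N {..x} * emeasure N {x..} \<le> ennreal (q x)"
  shows "(\<integral>\<^sup>+s. ennreal \<bar>G s - (\<integral>r. G r \<partial>N)\<bar> \<partial>N) \<le> 2 * (\<integral>\<^sup>+x. ennreal \<bar>g x\<bar> * ennreal (q x) \<partial>lborel)"
proof -
  interpret prob_space N by fact
  interpret P: pair_sigma_finite N lborel by standard
  have sN[measurable_cong]: "sets N = sets borel" by fact
  have [measurable]: "g \<in> borel_measurable borel" by (rule ac_deriv_measurable[OF G])
  have [measurable]: "G \<in> borel_measurable borel"
    by (intro borel_measurable_continuous_onI ac_deriv_continuous[OF G])
  have 1: "(\<integral>\<^sup>+s. indicator {z. fst z \<le> snd z} (s, x) \<partial>N) = emeasure N {..x}" for x
    using nn_integral_indicator[of "{..x}" N] by (simp add: indicator_def sN)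
  have 2: "(\<integral>\<^sup>+s. indicator {z. snd z \<le> fst z} (s, x) \<partial>N) = emeasure N {x..}" for x
    using nn_integral_indicator[of "{x..}" N] by (simp add: indicator_def sN)
  have [measurable]: "(\<lambda>x. emeasure N {..x}) \<in> borel_measurable borel"
    "(\<lambda>x. emeasure N {x..}) \<in> borel_measurable borel"
    unfolding 1[symmetric] 2[symmetric] by measurable
  have "(\<integral>\<^sup>+s. ennreal \<bar>G s - (\<integral>r. G r \<partial>N)\<bar> \<partial>N) \<le> (\<integral>\<^sup>+s. (\<integral>\<^sup>+r. ennreal \<bar>G s - G r\<bar> \<partial>N) \<partial>N)"
  proof (rule nn_integral_mono)
    fix s
    have "ennreal \<bar>G s - (\<integral>r. G r \<partial>N)\<bar> = ennreal (norm (\<integral>r. G s - G r \<partial>N))"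
      using iG by (simp add: prob_space)
    also have "\<dots> \<le> (\<integral>\<^sup>+r. norm (G s - G r) \<partial>N)"
      using iG by (intro integral_norm_bound_ennreal) auto
    finally show "ennreal \<bar>G s - (\<integral>r. G r \<partial>N)\<bar> \<le> (\<integral>\<^sup>+r. ennreal \<bar>G s - G r\<bar> \<partial>N)"
      by simp
  qed
  also have "\<dots> \<le> (\<integral>\<^sup>+s. (\<integral>\<^sup>+r. (\<integral>\<^sup>+x. ennreal \<bar>g x\<bar> * (indicator {..x} r * indicator {x..} s + indicator {x..} r * indicator {..x} s) \<partial>lborel) \<partial>N) \<partial>N)"
    by (intro nn_integral_mono abs_increment_le_nn_integral[OF G])
  also have "\<dots> = (\<integral>\<^sup>+s. (\<integral>\<^sup>+x. (\<integral>\<^sup>+r. ennreal \<bar>g x\<bar> * (indicator {..x} r * indicator {x..} s + indicator {x..} r * indicator {..x} s) \<partial>N) \<partial>lborel) \<partial>N)"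
    by (intro nn_integral_cong P.Fubini'[symmetric]) (simp add: indicator_def)
  also have "\<dots> = (\<integral>\<^sup>+s. (\<integral>\<^sup>+x. ennreal \<bar>g x\<bar> * (emeasure N {..x} * indicator {x..} s + emeasure N {x..} * indicator {..x} s) \<partial>lborel) \<partial>N)"
    by (intro nn_integral_cong) (simp add: nn_integral_cmult nn_integral_add nn_integral_multc)
  also have "\<dots> = (\<integral>\<^sup>+x. (\<integral>\<^sup>+s. ennreal \<bar>g x\<bar> * (emeasure N {..x} * indicator {x..} s + emeasure N {x..} * indicator {..x} s) \<partial>N) \<partial>lborel)"
    by (rule P.Fubini'[symmetric]) (simp add: indicator_def)
  also have "\<dots> = (\<integral>\<^sup>+x. ennreal \<bar>g x\<bar> * (emeasure N {..x} * emeasure N {x..} + emeasure N {x..} * emeasure N {..x}) \<partial>lborel)"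
    by (intro nn_integral_cong) (simp add: nn_integral_cmult nn_integral_add)
  also have "\<dots> \<le> (\<integral>\<^sup>+x. ennreal \<bar>g x\<bar> * (2 * ennreal (q x)) \<partial>lborel)"
  proof (intro nn_integral_mono mult_left_mono)
    fix x
    show "emeasure N {..x} * emeasure N {x..} + emeasure N {x..} * emeasure N {..x} \<le> 2 * ennreal (q x)"
      using add_mono[OF q[of x] q[of x]] by (simp add: mult.commute mult_2_right)
  qed simp
  also have "\<dots> = (\<integral>\<^sup>+x. 2 * (ennreal \<bar>g x\<bar> * ennreal (q x)) \<partial>lborel)"
    by (simp add: ac_simps)
  also have "\<dots> \<le> 2 * (\<integral>\<^sup>+x. ennreal \<bar>g x\<bar> * ennreal (q x) \<partial>lborel)"
    by (subst nn_integral_cmult) auto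
  finally show ?thesis .
qed

abbreviation std_gauss_measure :: "real measure" where
  "std_gauss_measure \<equiv> density lborel (\<lambda>x. ennreal (std_normal_density x))"

lemma std_normal_density_alt: "std_normal_density x = exp (- (x\<^sup>2 / 2)) / sqrt (2 * pi)"
  by (simp add: std_normal_density_def)

lemma nn_integral_std_normal: "(\<integral>\<^sup>+x. ennreal (std_normal_density x) \<partial>lborel) = 1"
proof -
  interpret prob_space std_gauss_measure by (rule prob_space_normal_density) simp
  show ?thesis using emeasure_space_1 by (simp add: emeasure_density)
qed

text \<open>If \<open>c x\<close> and \<open>r\<close> are nonnegative then \<open>(x + c r)\<^sup>2 \<ge> x\<^sup>2 + r\<^sup>2\<close>, so the shifted density splits
off the factor \<open>exp (- x\<^sup>2 / 2)\<close>. The sign \<open>c\<close> covers both tails.\<close>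

lemma gauss_tail:
  assumes "c = 1 \<or> c = -1" "c * x \<ge> 0"
  shows "emeasure std_gauss_measure {t. c * t \<ge> c * x} \<le> ennreal (sqrt (2 * pi) * std_normal_density x)"
proof -
  have c2: "c * c = 1" using assms(1) by auto
  have "emeasure std_gauss_measure {t. c * t \<ge> c * x} = (\<integral>\<^sup>+t. ennreal (std_normal_density t) * indicator {t. c * t \<ge> c * x} t \<partial>lborel)"
    by (subst emeasure_density) auto
  also have "\<dots> = (\<integral>\<^sup>+t. ennreal (std_normal_density (x + c * t)) * indicator {t. c * t \<ge> c * x} (x + c * t) \<partial>lborel)"
    using assms(1) by (subst nn_integral_real_affine[where c=c and t=x]) auto
  also have "\<dots> \<le> (\<integral>\<^sup>+t. ennreal (exp (-(x\<^sup>2/2))) * ennreal (std_normal_density t) \<partial>lborel)"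
  proof (intro nn_integral_mono)
    fix t
    show "ennreal (std_normal_density (x + c * t)) * indicator {t. c * t \<ge> c * x} (x + c * t)
      \<le> ennreal (exp (-(x\<^sup>2/2))) * ennreal (std_normal_density t)"
    proof (cases "t \<ge> 0")
      case True
      then have "c * x * t \<ge> 0" using assms by simp
      moreover have "(x + c * t)\<^sup>2 = x\<^sup>2 + 2 * (c * x * t) + (c * c) * t\<^sup>2"
        by (simp add: power2_eq_square algebra_simps)
      ultimately have "- ((x + c * t)\<^sup>2 / 2) \<le> -(x\<^sup>2/2) + -(t\<^sup>2/2)"
        using c2 by (simp add: field_simps)
      then have "std_normal_density (x + c * t) \<le> exp (-(x\<^sup>2/2)) * std_normal_density t"
        unfolding std_normal_density_alt by (simp add: divide_right_mono flip: exp_add)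
      then show ?thesis
        by (simp add: ennreal_mult[symmetric] ennreal_leI split: split_indicator)
    next
      case False
      then have "\<not> (c * x + c * c * t \<ge> c * x)" using c2 by simp
      then show ?thesis by (simp add: algebra_simps)
    qed
  qed
  also have "\<dots> = ennreal (exp (-(x\<^sup>2/2)))"
    by (simp add: nn_integral_cmult nn_integral_std_normal)
  also have "exp (-(x\<^sup>2/2)) = sqrt (2 * pi) * std_normal_density x"
    unfolding std_normal_density_alt by simp
  finally show ?thesis .
qed

lemma gauss_isoperimetric:
  "emeasure std_gauss_measure {..x} * emeasure std_gauss_measure {x..} \<le> ennreal (sqrt (2 * pi) * std_normal_density x)"
proof -
  interpret prob_space std_gauss_measure by (rule prob_space_normal_density) simp
  show ?thesis
  proof (cases "x \<ge> 0")
    case True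
    have "emeasure std_gauss_measure {..x} * emeasure std_gauss_measure {x..} \<le> 1 * emeasure std_gauss_measure {x..}"
      by (intro mult_right_mono) (auto intro: emeasure_le_1)
    also have "\<dots> \<le> ennreal (sqrt (2 * pi) * std_normal_density x)"
      using gauss_tail[of 1 x] True by (simp add: atLeast_def)
    finally show ?thesis .
  next
    case False
    have "emeasure std_gauss_measure {..x} * emeasure std_gauss_measure {x..} \<le> emeasure std_gauss_measure {..x} * 1"
      by (intro mult_left_mono) (auto intro: emeasure_le_1)
    also have "\<dots> \<le> ennreal (sqrt (2 * pi) * std_normal_density x)"
      using gauss_tail[of "-1" x] False by (simp add: atMost_def)
    finally show ?thesis .
  qed
qed

section \<open>Monotone transport to the Gaussian\<close>

lemma ac_deriv_imp_has_real_derivative: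
  assumes G: "ac_deriv G g" and c: "continuous_on UNIV g"
  shows "(G has_real_derivative g x) (at x)"
proof -
  have "((\<lambda>y. integral {x-1..y} g) has_real_derivative g x) (at x within {x-1..x+1})"
    using c by (intro integral_has_real_derivative) (auto intro: continuous_on_subset)
  then have "((\<lambda>y. G (x-1) + integral {x-1..y} g) has_real_derivative g x) (at x within {x-1..x+1})"
    by (auto intro!: derivative_eq_intros)
  moreover have "at x within {x-1..x+1} = at x"
    by (intro at_within_interior) auto
  ultimately have "((\<lambda>y. G (x-1) + integral {x-1..y} g) has_real_derivative g x) (at x)"
    by simp
  moreover have "\<forall>\<^sub>F y in nhds x. G (x-1) + integral {x-1..y} g = G y"
  proof -
    have "\<forall>\<^sub>F y in nhds x. y \<in> {x-1<..}" by (intro eventually_nhds_in_open) auto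
    then show ?thesis
    proof eventually_elim
      case (elim y)
      then show ?case using ac_derivD[OF G, of "x-1" y]
        set_borel_integral_eq_integral(2)[of "{x-1..y}" g] by auto
    qed
  qed
  ultimately show ?thesis by (subst (asm) DERIV_cong_ev) auto
qed

text \<open>Positivity and continuity make the distribution function a continuously differentiable
bijection onto the open unit interval, so that the transport map is smooth enough on the whole line.
Other densities are reached by mixing with the Gaussian.\<close>

locale pos_density =
  fixes p :: "real \<Rightarrow> real"
  assumes p_cont: "continuous_on UNIV p" and p_pos: "\<And>x. p x > 0"
    and p_prob: "prob_space (density lborel (\<lambda>x. ennreal (p x)))"
begin

abbreviation "N \<equiv> density lborel (\<lambda>x. ennreal (p x))"

lemma p_meas[measurable]: "p \<in> borel_measurable borel"
  by (rule borel_measurable_continuous_onI[OF p_cont])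

sublocale real_distribution N
  using p_prob by (simp add: real_distribution_def real_distribution_axioms_def)

lemma p_integrable: "integrable lborel p"
proof (rule integrableI_nonneg)
  have "(\<integral>\<^sup>+ x. ennreal (p x) \<partial>lborel) = emeasure N UNIV"
    by (simp add: emeasure_density)
  then show "(\<integral>\<^sup>+ x. ennreal (p x) \<partial>lborel) < \<infinity>"
    using emeasure_finite[of UNIV] by (simp only: infinity_ennreal_def top.not_eq_extremum)
qed (use p_pos less_imp_le in auto)

lemma cdf_ac: "ac_deriv (cdf N) p"
proof -
  have "cdf N b - cdf N a = (LINT x:{a..b}|lborel. p x)" if "a \<le> b" for a b
  proof -
    have "emeasure N {a<..b} = (\<integral>\<^sup>+x. ennreal (indicator {a..b} x *\<^sub>R p x) \<partial>lborel)"
      by (subst emeasure_density, simp, simp, rule nn_integral_cong_AE)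
         (use AE_lborel_singleton[of a] in eventually_elim, auto split: split_indicator)
    also have "\<dots> = ennreal (LINT x:{a..b}|lborel. p x)"
      unfolding set_lebesgue_integral_def
      using p_pos by (intro nn_integral_eq_integral integrable_mult_indicator[of "{a..b}" lborel p] p_integrable)
        (auto intro!: AE_I2 mult_nonneg_nonneg intro: less_imp_le)
    finally have "measure N {a<..b} = (LINT x:{a..b}|lborel. p x)"
      using p_pos by (auto simp: measure_def set_lebesgue_integral_def less_imp_le intro!: Bochner_Integration.integral_nonneg)
    moreover have "cdf N b - cdf N a = measure N {a<..b}"
      using cdf_diff_eq[of a b] that by (cases "a = b") auto
    ultimately show ?thesis by simp
  qed
  moreover have "set_integrable lborel {a..b} p" for a b
    unfolding set_integrable_def by (intro integrable_mult_indicator p_integrable) simp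
  ultimately show ?thesis unfolding ac_deriv_def by auto
qed

lemma cdf_deriv: "(cdf N has_real_derivative p x) (at x)"
  by (rule ac_deriv_imp_has_real_derivative[OF cdf_ac p_cont])

lemma cdf_strict: "x < y \<Longrightarrow> cdf N x < cdf N y"
  by (rule DERIV_pos_imp_increasing[of x y "cdf N"]) (use cdf_deriv p_pos in auto)

lemma cdf_less_iff: "cdf N x < cdf N y \<longleftrightarrow> x < y"
  using cdf_strict by (metis linorder_neqE_linordered_idom not_less_iff_gr_or_eq)

lemma cdf_inj: "cdf N x = cdf N y \<Longrightarrow> x = y"
  using cdf_less_iff[of x y] cdf_less_iff[of y x] by auto

lemma cdf_le_iff: "cdf N x \<le> cdf N y \<longleftrightarrow> x \<le> y"
  using cdf_less_iff by (meson not_le)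

lemma cdf_in: "0 < cdf N x" "cdf N x < 1"
proof -
  have "0 \<le> cdf N (x - 1)" by (rule cdf_nonneg)
  then show "0 < cdf N x" using cdf_strict[of "x-1" x] by linarith
  have "cdf N (x + 1) \<le> 1" by (rule cdf_bounded_prob)
  then show "cdf N x < 1" using cdf_strict[of x "x+1"] by linarith
qed

lemma cdf_surj:
  assumes "0 < u" "u < 1"
  shows "\<exists>x. cdf N x = u"
proof -
  have "\<forall>\<^sub>F x in at_bot. cdf N x < u"
    using cdf_lim_at_bot assms(1) by (rule order_tendstoD)
  then obtain a where a: "\<And>x. x \<le> a \<Longrightarrow> cdf N x < u" by (auto simp: eventually_at_bot_linorder)
  have "\<forall>\<^sub>F x in at_top. cdf N x > u"
    using cdf_lim_at_top_prob assms(2) by (rule order_tendstoD)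
  then obtain b where b: "\<And>x. x \<ge> b \<Longrightarrow> cdf N x > u" by (auto simp: eventually_at_top_linorder)
  have "\<exists>x\<ge>a. x \<le> max a b \<and> cdf N x = u"
    using a[of a] b[of "max a b"]
    by (intro IVT') (auto intro!: continuous_at_imp_continuous_on DERIV_isCont[OF cdf_deriv] simp: less_imp_le)
  then show ?thesis by auto
qed

end

lemma continuous_std_normal_density: "continuous_on UNIV std_normal_density"
  unfolding std_normal_density_def by (intro continuous_intros) auto

lemma std_normal_pos_density: "pos_density std_normal_density"
  unfolding pos_density_def
  using continuous_std_normal_density normal_density_pos[of 1 0] prob_space_normal_density[of 1 0] by simp

context pos_density
begin

text \<open>The monotone rearrangement of the measure \<open>N\<close> onto the Gaussian.\<close>

definition transport :: "real \<Rightarrow> real" where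
  "transport x = (THE y. cdf std_gauss_measure y = cdf N x)"

interpretation gau: pos_density std_normal_density by (rule std_normal_pos_density)

lemma cdf_transport: "cdf std_gauss_measure (transport x) = cdf N x"
proof -
  have "\<exists>!y. cdf std_gauss_measure y = cdf N x"
    using gau.cdf_surj[OF cdf_in] gau.cdf_inj by metis
  then show ?thesis unfolding transport_def by (rule theI')
qed

lemma transport_le_iff: "transport x \<le> transport y \<longleftrightarrow> x \<le> y"
  by (metis cdf_transport gau.cdf_le_iff cdf_le_iff)

lemma transport_deriv: "(transport has_real_derivative p x / std_normal_density (transport x)) (at x)"
proof -
  define Q where "Q u = (THE y. cdf std_gauss_measure y = u)" for u
  have Q: "Q (cdf std_gauss_measure y) = y" for y
    unfolding Q_def by (intro the_equality) (auto dest: gau.cdf_inj)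
  have c: "isCont (cdf std_gauss_measure) z" for z
    by (rule DERIV_isCont[OF gau.cdf_deriv])
  have "(Q has_real_derivative inverse (std_normal_density (transport x))) (at (cdf N x))"
  proof (rule DERIV_inverse_function)
    show "(cdf std_gauss_measure has_real_derivative std_normal_density (transport x)) (at (Q (cdf N x)))"
      using gau.cdf_deriv[of "transport x"] by (simp add: Q flip: cdf_transport)
    show "0 < cdf N x" "cdf N x < 1" by (rule cdf_in)+
    show "cdf std_gauss_measure (Q y) = y" if "0 < y" "y < 1" for y
      using gau.cdf_surj[OF that] Q by auto
    have "isCont Q (cdf std_gauss_measure (transport x))"
      by (rule isCont_inverse_function[where d=1]) (auto simp: Q c)
    then show "isCont Q (cdf N x)" by (simp only: cdf_transport)
    show "std_normal_density (transport x) \<noteq> 0" using normal_density_pos[of 1 0 "transport x"] by simp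
  qed
  from DERIV_chain[OF this cdf_deriv]
  have "((Q \<circ> cdf N) has_real_derivative p x / std_normal_density (transport x)) (at x)"
    by (simp add: field_simps)
  moreover have "Q \<circ> cdf N = transport" unfolding Q_def transport_def by auto
  ultimately show ?thesis by simp
qed

lemma transport_continuous: "continuous_on UNIV transport"
  by (auto intro!: continuous_at_imp_continuous_on DERIV_isCont[OF transport_deriv])

lemma transport_measurable[measurable]: "transport \<in> borel_measurable borel"
  by (rule borel_measurable_continuous_onI[OF transport_continuous])

lemma distr_transport: "distr N borel transport = std_gauss_measure"
proof (rule cdf_unique)
  show "real_distribution (distr N borel transport)"
    by (simp add: real_distribution_def real_distribution_axioms_def prob_space_distr)
  show "real_distribution std_gauss_measure" by (rule gau.real_distribution_axioms)
  show "cdf (distr N borel transport) = cdf std_gauss_measure"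
  proof
    fix y
    obtain x where x: "cdf N x = cdf std_gauss_measure y"
      using cdf_surj[OF gau.cdf_in] by auto
    have "transport z \<le> y \<longleftrightarrow> z \<le> x" for z
      using gau.cdf_le_iff[of "transport z" y] cdf_le_iff[of z x] x by (simp only: cdf_transport)
    then have eq: "transport -` {..y} = {..x}" by auto
    have "cdf (distr N borel transport) y = measure N (transport -` {..y})"
      by (simp add: cdf_def measure_distr)
    then show "cdf (distr N borel transport) y = cdf std_gauss_measure y"
      using x eq by (simp add: cdf_def)
  qed
qed

lemma emeasure_transport:
  "emeasure N {..x} = emeasure std_gauss_measure {..transport x}"
  "emeasure N {x..} = emeasure std_gauss_measure {transport x..}"
proof -
  have "transport -` {..transport x} = {..x}" "transport -` {transport x..} = {x..}"
    using transport_le_iff by auto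
  then show "emeasure N {..x} = emeasure std_gauss_measure {..transport x}"
  "emeasure N {x..} = emeasure std_gauss_measure {transport x..}"
    by (simp_all add: emeasure_distr flip: distr_transport)
qed

end

lemma small_value_beyond:
  fixes G :: "real \<Rightarrow> real"
  assumes "integrable lborel G" "e > 0"
  shows "\<exists>b\<ge>a. \<bar>G b\<bar> < e" "\<exists>b\<le>a. \<bar>G b\<bar> < e"
proof -
  have *: False if "\<And>x. x \<in> A \<Longrightarrow> \<bar>G x\<bar> \<ge> e" "\<And>n::nat. emeasure lborel A \<ge> n" "A \<in> sets borel" for A
  proof -
    have "emeasure lborel A * ennreal e = (\<integral>\<^sup>+x. ennreal e * indicator A x \<partial>lborel)"
      using that by (simp add: nn_integral_cmult mult.commute)
    also have "\<dots> \<le> (\<integral>\<^sup>+x. ennreal (norm (G x)) \<partial>lborel)"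
      using that by (intro nn_integral_mono) (auto split: split_indicator intro: ennreal_leI)
    also have "\<dots> < \<infinity>" using assms(1) by (simp add: integrable_iff_bounded)
    finally have "emeasure lborel A * ennreal e < \<infinity>" .
    then have "emeasure lborel A < \<infinity>"
      using assms(2) by (auto simp: ennreal_mult_less_top)
    then obtain r where "r \<ge> 0" "emeasure lborel A = ennreal r" by (metis ennreal_cases infinity_ennreal_def less_irrefl)
    moreover obtain n :: nat where "r < n" using reals_Archimedean2 by blast
    ultimately show False using that(2)[of n] by (simp add: ennreal_of_nat_eq_real_of_nat)
  qed
  show "\<exists>b\<ge>a. \<bar>G b\<bar> < e"
  proof (rule ccontr)
    assume "\<not> ?thesis"
    then show False
    proof (intro *[of "{a..}"])
      fix n :: nat
      have "emeasure lborel {a..a+n} \<le> emeasure lborel {a..}" by (intro emeasure_mono) auto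
      then show "of_nat n \<le> emeasure lborel {a..}" by (simp add: ennreal_of_nat_eq_real_of_nat)
    qed (auto simp: not_less)
  qed
  show "\<exists>b\<le>a. \<bar>G b\<bar> < e"
  proof (rule ccontr)
    assume "\<not> ?thesis"
    then show False
    proof (intro *[of "{..a}"])
      fix n :: nat
      have "emeasure lborel {a-n..a} \<le> emeasure lborel {..a}" by (intro emeasure_mono) auto
      then show "of_nat n \<le> emeasure lborel {..a}" by (simp add: ennreal_of_nat_eq_real_of_nat)
    qed (auto simp: not_less)
  qed
qed

text \<open>Integration by parts on the whole line when only the part \<open>Q\<close> of the derivative is known to
be integrable. Between boundary points at which the integrable function \<open>G\<close> is small, the
integrals of \<open>P\<close> and \<open>Q\<close> differ little, so Fatou's lemma gives the integrability of \<open>P\<close>.\<close>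

lemma integral_derivative_zero:
  assumes G: "ac_deriv G (\<lambda>x. P x - Q x)" and iG: "integrable lborel G"
    and P: "\<And>x. P x \<ge> 0" and [measurable]: "P \<in> borel_measurable borel" and Q: "integrable lborel Q"
  shows "integrable lborel P" "(\<integral>x. P x \<partial>lborel) = (\<integral>x. Q x \<partial>lborel)"
proof -
  have [measurable]: "Q \<in> borel_measurable borel" using Q by auto
  have "\<exists>b\<ge>real n. \<bar>G b\<bar> < inverse (real (Suc n))" "\<exists>a\<le>-real n. \<bar>G a\<bar> < inverse (real (Suc n))" for n
    using small_value_beyond[OF iG] by simp_all
  then obtain a b where a: "\<And>n. a n \<le> - real n" "\<And>n. \<bar>G (a n)\<bar> < inverse (real (Suc n))"
    and b: "\<And>n. b n \<ge> real n" "\<And>n. \<bar>G (b n)\<bar> < inverse (real (Suc n))" by metis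
  have ab: "a n \<le> b n" for n using a(1)[of n] b(1)[of n] by linarith
  have G0: "(\<lambda>n. G (b n) - G (a n)) \<longlonglongrightarrow> 0 - 0"
    using a(2) b(2) by (intro tendsto_diff Lim_null_comparison[OF _ LIMSEQ_inverse_real_of_nat])
      (auto intro!: always_eventually less_imp_le)
  have iQ: "integrable lborel (\<lambda>x. indicator {a n..b n} x *\<^sub>R Q x)" for n
    using integrable_mult_indicator[OF _ Q] by simp
  have iPQ: "integrable lborel (\<lambda>x. indicator {a n..b n} x *\<^sub>R (P x - Q x))" for n
    using ac_derivD(1)[OF G ab] by (simp add: set_integrable_def)
  have iP: "integrable lborel (\<lambda>x. indicator {a n..b n} x *\<^sub>R P x)" for n
    using Bochner_Integration.integrable_add[OF iPQ[of n] iQ[of n]] by (simp add: algebra_simps)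
  have val: "(\<integral>x. indicator {a n..b n} x *\<^sub>R P x \<partial>lborel) = G (b n) - G (a n) + (\<integral>x. indicator {a n..b n} x *\<^sub>R Q x \<partial>lborel)" for n
    using ac_derivD(2)[OF G ab] Bochner_Integration.integral_add[OF iPQ[of n] iQ[of n]]
    by (simp add: algebra_simps set_lebesgue_integral_def)
  have ev: "\<forall>\<^sub>F n in sequentially. indicator {a n..b n} x = (1::real)" for x
  proof -
    obtain m :: nat where "\<bar>x\<bar> < m" using reals_Archimedean2 by blast
    then have "x \<in> {a n..b n}" if "n \<ge> m" for n
      using a(1)[of n] b(1)[of n] that by (auto simp: abs_less_iff)
    then show ?thesis by (auto simp: eventually_sequentially indicator_def intro!: exI[of _ m])
  qed
  have lim: "(\<lambda>n. indicator {a n..b n} x *\<^sub>R H x) \<longlonglongrightarrow> H x" for x and H :: "real \<Rightarrow> real"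
    by (rule tendsto_eventually) (use ev[of x] in eventually_elim, simp)
  have limQ: "(\<lambda>n. \<integral>x. indicator {a n..b n} x *\<^sub>R Q x \<partial>lborel) \<longlonglongrightarrow> (\<integral>x. Q x \<partial>lborel)"
    by (rule integral_dominated_convergence[where w="\<lambda>x. norm (Q x)"])
      (use Q lim in \<open>auto split: split_indicator\<close>)
  have limP: "(\<lambda>n. \<integral>x. indicator {a n..b n} x *\<^sub>R P x \<partial>lborel) \<longlonglongrightarrow> (\<integral>x. Q x \<partial>lborel)"
    unfolding val using tendsto_add[OF G0 limQ] by simp
  show iP': "integrable lborel P"
  proof (rule integrableI_nonneg)
    have "(\<integral>\<^sup>+x. ennreal (P x) \<partial>lborel) = (\<integral>\<^sup>+x. liminf (\<lambda>n. ennreal (indicator {a n..b n} x *\<^sub>R P x)) \<partial>lborel)"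
      by (intro nn_integral_cong lim_imp_Liminf[symmetric] tendsto_ennrealI lim) simp
    also have "\<dots> \<le> liminf (\<lambda>n. \<integral>\<^sup>+x. ennreal (indicator {a n..b n} x *\<^sub>R P x) \<partial>lborel)"
      by (rule nn_integral_liminf) measurable
    also have "\<dots> = liminf (\<lambda>n. ennreal (\<integral>x. indicator {a n..b n} x *\<^sub>R P x \<partial>lborel))"
      using P iP by (simp add: nn_integral_eq_integral)
    also have "\<dots> = ennreal (\<integral>x. Q x \<partial>lborel)"
      by (intro lim_imp_Liminf tendsto_ennrealI limP) simp
    finally show "(\<integral>\<^sup>+x. ennreal (P x) \<partial>lborel) < \<infinity>" by (simp add: order_le_less_trans)
  qed (use P in auto)
  have "(\<lambda>n. \<integral>x. indicator {a n..b n} x *\<^sub>R P x \<partial>lborel) \<longlonglongrightarrow> (\<integral>x. P x \<partial>lborel)"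
    by (rule integral_dominated_convergence[where w="\<lambda>x. norm (P x)"])
      (use iP' lim in \<open>auto split: split_indicator\<close>)
  then show "(\<integral>x. P x \<partial>lborel) = (\<integral>x. Q x \<partial>lborel)"
    using limP by (rule LIMSEQ_unique)
qed

lemma std_normal_deriv: "(std_normal_density has_real_derivative - x * std_normal_density x) (at x)"
proof -
  have "((\<lambda>x. exp (- x\<^sup>2 / 2)) has_real_derivative exp (- x\<^sup>2 / 2) * (- x)) (at x)"
    by (auto intro!: derivative_eq_intros)
  from DERIV_cmult[OF this, of "1 / sqrt (2 * pi)"] show ?thesis
    unfolding std_normal_density_def by (simp add: mult_ac)
qed

lemma std_normal_tendsto_0: "(std_normal_density \<longlongrightarrow> 0) at_top"
  unfolding std_normal_density_alt by real_asymp

lemma integrable_gauss_iff: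
  fixes g :: "real \<Rightarrow> real"
  assumes [measurable]: "g \<in> borel_measurable borel"
  shows "integrable std_gauss_measure g \<longleftrightarrow> integrable lborel (\<lambda>x. std_normal_density x * g x)"
  by (subst integrable_density) (auto simp: normal_density_nonneg)

lemma gauss_moments:
  "integrable std_gauss_measure (\<lambda>y. y)" "(\<integral>y. y \<partial>std_gauss_measure) = 0"
  "integrable std_gauss_measure (\<lambda>y. y\<^sup>2)" "(\<integral>y. y\<^sup>2 \<partial>std_gauss_measure) = 1"
  using std_normal_moment_odd[of 0] std_normal_moment_even[of 1]
  by (simp_all add: integrable_gauss_iff integral_density normal_density_nonneg has_bochner_integral_iff fact_numeral)

text \<open>The derivative of the Gaussian density is \<open>- y\<close> times the density; the second identity
follows from the first because the total mean vanishes.\<close>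

lemma gauss_mean_beyond:
  "(\<integral>y. indicator {a<..} y * y \<partial>std_gauss_measure) = std_normal_density a"
  "(\<integral>y. indicator {..a} y * y \<partial>std_gauss_measure) = - std_normal_density a"
proof -
  let ?f = "\<lambda>y. std_normal_density y * y"
  have cont: "continuous_on UNIV (\<lambda>y. - y * std_normal_density y)"
    using continuous_std_normal_density by (intro continuous_intros) 
  have i: "integrable lborel ?f"
    using std_normal_moment_odd[of 0] by (simp add: has_bochner_integral_iff)
  have i2: "integrable lborel (\<lambda>y. indicator {a..} y *\<^sub>R ?f y)"
    by (rule integrable_mult_indicator) (use i in auto)
  have "((\<lambda>b. \<integral>y. indicator {..b} y *\<^sub>R (indicator {a..} y *\<^sub>R ?f y) \<partial>lborel) \<longlongrightarrow> (\<integral>y. indicator {a..} y *\<^sub>R ?f y \<partial>lborel)) at_top"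
    using i2 by (intro tendsto_integral_at_top) auto
  moreover have "\<forall>\<^sub>F b in at_top. (\<integral>y. indicator {..b} y *\<^sub>R (indicator {a..} y *\<^sub>R ?f y) \<partial>lborel) = std_normal_density a - std_normal_density b"
  proof (rule eventually_mono[OF eventually_ge_at_top[of a]])
    fix b assume ab: "a \<le> b"
    have "ac_deriv std_normal_density (\<lambda>y. - y * std_normal_density y)"
      using std_normal_deriv cont by (rule ac_deriv_of_continuous_derivative)
    from ac_derivD(2)[OF this ab]
    have "std_normal_density b - std_normal_density a = (\<integral>y. indicator {a..b} y *\<^sub>R (- y * std_normal_density y) \<partial>lborel)"
      by (simp add: set_lebesgue_integral_def)
    also have "\<dots> = (\<integral>y. - (indicator {..b} y *\<^sub>R (indicator {a..} y *\<^sub>R ?f y)) \<partial>lborel)"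
      by (intro Bochner_Integration.integral_cong) (auto split: split_indicator)
    finally show "(\<integral>y. indicator {..b} y *\<^sub>R (indicator {a..} y *\<^sub>R ?f y) \<partial>lborel) = std_normal_density a - std_normal_density b"
      by simp
  qed
  ultimately have "((\<lambda>b. std_normal_density a - std_normal_density b) \<longlongrightarrow> (\<integral>y. indicator {a..} y *\<^sub>R ?f y \<partial>lborel)) at_top"
    by (rule Lim_transform_eventually)
  moreover have "((\<lambda>b. std_normal_density a - std_normal_density b) \<longlongrightarrow> std_normal_density a - 0) at_top"
    by (intro tendsto_diff tendsto_const std_normal_tendsto_0)
  ultimately have "(\<integral>y. indicator {a..} y *\<^sub>R ?f y \<partial>lborel) = std_normal_density a"
    using tendsto_unique[OF trivial_limit_at_top_linorder] by fastforce
  moreover have "(\<integral>y. indicator {a<..} y *\<^sub>R ?f y \<partial>lborel) = (\<integral>y. indicator {a..} y *\<^sub>R ?f y \<partial>lborel)"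
    by (intro integral_cong_AE) (auto intro: AE_mp[OF AE_lborel_singleton[of a]] split: split_indicator)
  moreover have "(\<integral>y. indicator {a<..} y * y \<partial>std_gauss_measure) = (\<integral>y. indicator {a<..} y *\<^sub>R ?f y \<partial>lborel)"
    by (subst integral_density) (auto simp: normal_density_nonneg ac_simps)
  ultimately show 1: "(\<integral>y. indicator {a<..} y * y \<partial>std_gauss_measure) = std_normal_density a" by simp
  have "(\<integral>y. y \<partial>std_gauss_measure) = (\<integral>y. indicator {a<..} y * y + indicator {..a} y * y \<partial>std_gauss_measure)"
    by (intro Bochner_Integration.integral_cong) (auto split: split_indicator)
  also have "\<dots> = (\<integral>y. indicator {a<..} y * y \<partial>std_gauss_measure) + (\<integral>y. indicator {..a} y * y \<partial>std_gauss_measure)"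
    using integrable_mult_indicator[OF _ gauss_moments(1), of "{a<..}"] integrable_mult_indicator[OF _ gauss_moments(1), of "{..a}"]
    by (intro Bochner_Integration.integral_add) auto
  finally show "(\<integral>y. indicator {..a} y * y \<partial>std_gauss_measure) = - std_normal_density a"
    using 1 gauss_moments(2) by simp
qed

context pos_density
begin

lemma integrable_transport:
  fixes g :: "real \<Rightarrow> real"
  assumes [measurable]: "g \<in> borel_measurable borel"
  shows "integrable N (\<lambda>x. g (transport x)) \<longleftrightarrow> integrable std_gauss_measure g"
    "(\<integral>x. g (transport x) \<partial>N) = (\<integral>y. g y \<partial>std_gauss_measure)"
  unfolding distr_transport[symmetric]
  by (subst integrable_distr_eq, auto) (subst integral_distr, auto)

text \<open>Both sides are the same double integral of \<open>transport s\<close> over the pairs for which \<open>x\<close> lies on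
the oriented segment from 0 to \<open>s\<close>. Integrating over \<open>s\<close> first gives the Gaussian mean beyond
\<open>transport x\<close>, that is the density there. An integration by parts would give the same identity,
but only with a tail estimate for \<open>x * std_normal_density (transport x)\<close>.\<close>

lemma integral_density_at_transport:
  assumes int: "integrable N (\<lambda>s. s * transport s)"
  shows "integrable lborel (\<lambda>x. std_normal_density (transport x))"
    "(\<integral>x. std_normal_density (transport x) \<partial>lborel) = (\<integral>s. s * transport s \<partial>N)"
proof -
  interpret PP: pair_sigma_finite N lborel by standard
  have [measurable]: "(\<lambda>(s, x). transport s * oriented_seg s x) \<in> borel_measurable (N \<Otimes>\<^sub>M lborel)"
    by measurable
  have seg: "has_bochner_integral lborel (\<lambda>x. oriented_seg s x) s" "has_bochner_integral lborel (\<lambda>x. \<bar>oriented_seg s x\<bar>) \<bar>s\<bar>" for s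
  proof -
    have "(\<lambda>x. oriented_seg s x) = (if s \<ge> 0 then indicator {0..<s} else (\<lambda>x. - indicator {s..<0} x))"
      "(\<lambda>x. \<bar>oriented_seg s x\<bar>) = (if s \<ge> 0 then indicator {0..<s} else indicator {s..<0})"
      by (auto simp: oriented_seg_def fun_eq_iff split: split_indicator)
    then show "has_bochner_integral lborel (\<lambda>x. oriented_seg s x) s" "has_bochner_integral lborel (\<lambda>x. \<bar>oriented_seg s x\<bar>) \<bar>s\<bar>"
      by (auto simp: has_bochner_integral_iff)
  qed
  have I: "integrable (N \<Otimes>\<^sub>M lborel) (\<lambda>(s, x). transport s * oriented_seg s x)"
  proof (rule PP.Fubini_integrable)
    have "(\<integral>x. norm (case (s, x) of (s, x) \<Rightarrow> transport s * oriented_seg s x) \<partial>lborel) = norm (s * transport s)" for s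
      using seg(2)[of s] by (simp add: has_bochner_integral_iff abs_mult mult.commute)
    then show "integrable N (\<lambda>s. \<integral>x. norm (case (s, x) of (s, x) \<Rightarrow> transport s * oriented_seg s x) \<partial>lborel)"
      using int by (simp only:) (rule integrable_norm)
    show "AE s in N. integrable lborel (\<lambda>x. case (s, x) of (s, x) \<Rightarrow> transport s * oriented_seg s x)"
      using seg(1) by (simp add: has_bochner_integral_iff)
  qed simp
  have val: "(\<integral>s. transport s * oriented_seg s x \<partial>N) = std_normal_density (transport x)" for x
  proof (cases "x \<ge> 0")
    case True
    have "(\<integral>s. transport s * oriented_seg s x \<partial>N) = (\<integral>s. indicator {transport x<..} (transport s) * transport s \<partial>N)"
      using True transport_le_iff[of _ x]
      by (intro Bochner_Integration.integral_cong) (auto simp: oriented_seg_def not_le[symmetric] split: split_indicator)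
    also have "\<dots> = std_normal_density (transport x)"
      by (subst integrable_transport(2)[of "\<lambda>y. indicator {transport x<..} y * y"]) (auto simp: gauss_mean_beyond)
    finally show ?thesis .
  next
    case False
    have "(\<integral>s. transport s * oriented_seg s x \<partial>N) = (\<integral>s. - (indicator {..transport x} (transport s) * transport s) \<partial>N)"
      using False transport_le_iff[of _ x]
      by (intro Bochner_Integration.integral_cong) (auto simp: oriented_seg_def split: split_indicator)
    also have "\<dots> = std_normal_density (transport x)"
      by (subst Bochner_Integration.integral_minus, subst integrable_transport(2)[of "\<lambda>y. indicator {..transport x} y * y"]) (auto simp: gauss_mean_beyond)
    finally show ?thesis .
  qed
  show "integrable lborel (\<lambda>x. std_normal_density (transport x))"
    using PP.integrable_snd[OF I] by (simp add: val)
  show "(\<integral>x. std_normal_density (transport x) \<partial>lborel) = (\<integral>s. s * transport s \<partial>N)"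
  proof -
    have "(\<integral>x. std_normal_density (transport x) \<partial>lborel) = (\<integral>x. (\<integral>s. transport s * oriented_seg s x \<partial>N) \<partial>lborel)"
      by (simp only: val)
    also have "\<dots> = (\<integral>s. (\<integral>x. transport s * oriented_seg s x \<partial>lborel) \<partial>N)"
      using PP.Fubini_integral[OF I] by simp
    also have "\<dots> = (\<integral>s. s * transport s \<partial>N)"
      using seg(1) by (simp add: has_bochner_integral_iff mult.commute)
    finally show ?thesis .
  qed
qed

end

section \<open>Stability of the logarithmic Sobolev inequality on the line\<close>

text \<open>The entropy integrand, normalised to be nonnegative with its zero at 1. For a function \<open>f\<close> of
mean \<open>m > 0\<close> the integral of \<open>m * ent_fun (f / m)\<close> is the entropy of \<open>f\<close>.\<close>

definition ent_fun :: "real \<Rightarrow> real" where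
  "ent_fun t = t * ln t - t + 1"

text \<open>This is \<open>ln y \<le> y - 1\<close> at \<open>y = 1 / sqrt t\<close>.\<close>

lemma ent_fun_ge_hellinger:
  assumes "t \<ge> 0"
  shows "(sqrt t - 1)\<^sup>2 \<le> ent_fun t"
proof (cases "t = 0")
  case False
  then have t: "t > 0" using assms by simp
  have "ln (1 / sqrt t) \<le> 1 / sqrt t - 1" using t by (intro ln_le_minus_one) simp
  then have "2 * t * (- ln (sqrt t)) \<le> 2 * t * (1 / sqrt t - 1)"
    using t by (intro mult_left_mono) (auto simp: ln_div)
  moreover have "ln t = 2 * ln (sqrt t)" using t by (simp add: ln_sqrt)
  moreover have "2 * t * (1 / sqrt t - 1) = 2 * sqrt t - 2 * t"
  proof -
    have "2 * t * (1 / sqrt t - 1) = 2 * (t / sqrt t) - 2 * t" by (simp add: right_diff_distrib)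
    then show ?thesis using t by (simp only: real_div_sqrt less_imp_le)
  qed
  ultimately show ?thesis using t unfolding ent_fun_def by (simp add: power2_eq_square algebra_simps)
qed (simp add: ent_fun_def)

lemma ent_fun_nonneg: "t \<ge> 0 \<Longrightarrow> 0 \<le> ent_fun t"
  using ent_fun_ge_hellinger[of t] zero_le_power2[of "sqrt t - 1"] by linarith

lemma ent_fun_le_square: "t > 0 \<Longrightarrow> ent_fun t \<le> (t - 1)\<^sup>2"
proof -
  assume "t > 0"
  then have "t * ln t \<le> t * (t - 1)" by (intro mult_left_mono ln_le_minus_one) auto
  then show ?thesis by (simp add: ent_fun_def power2_eq_square algebra_simps)
qed

text \<open>Factor \<open>t - 1\<close> as \<open>(sqrt t - 1) * (sqrt t + 1)\<close> and split the product by the weighted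
arithmetic-geometric mean inequality; the square of the second factor is at most \<open>2 * (1 + t)\<close>.\<close>

lemma abs_minus_one_le_ent_fun:
  assumes "t \<ge> 0" "\<eta> > 0"
  shows "\<bar>t - 1\<bar> \<le> ent_fun t / (2 * \<eta>) + \<eta> * (1 + t)"
proof -
  define s where "s = sqrt t"
  have s: "s \<ge> 0" "t = s\<^sup>2" using assms by (auto simp: s_def)
  have "\<bar>t - 1\<bar> = \<bar>s - 1\<bar> * (s + 1)"
  proof -
    have "t - 1 = (s - 1) * (s + 1)" using s by (simp add: power2_eq_square algebra_simps)
    then show ?thesis using s by (simp add: abs_mult)
  qed
  also have "\<dots> \<le> (s - 1)\<^sup>2 / (2 * \<eta>) + \<eta> / 2 * (s + 1)\<^sup>2"
  proof -
    have "2 * \<eta> * (u * v) \<le> u\<^sup>2 + \<eta>\<^sup>2 * v\<^sup>2" for u v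
      using zero_le_power2[of "u - \<eta> * v"] by (simp add: power2_eq_square algebra_simps)
    from this[of "\<bar>s - 1\<bar>" "s + 1"]
    have "2 * \<eta> * (\<bar>s - 1\<bar> * (s + 1)) \<le> (s - 1)\<^sup>2 + \<eta>\<^sup>2 * (s + 1)\<^sup>2" by simp
    then show ?thesis using assms(2) by (simp add: field_simps power2_eq_square)
  qed
  also have "\<dots> \<le> ent_fun t / (2 * \<eta>) + \<eta> / 2 * (2 * (1 + t))"
  proof (intro add_mono divide_right_mono mult_left_mono)
    show "(s - 1)\<^sup>2 \<le> ent_fun t" using ent_fun_ge_hellinger[OF assms(1)] by (simp add: s_def)
    have "0 \<le> (s - 1)\<^sup>2" by simp
    then show "(s + 1)\<^sup>2 \<le> 2 * (1 + t)" using s by (simp add: power2_eq_square algebra_simps)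
  qed (use assms in auto)
  also have "\<eta> / 2 * (2 * (1 + t)) = \<eta> * (1 + t)" by simp
  finally show ?thesis .
qed

lemma abs_le_half_square_sum:
  assumes "h > (0::real)" "c > 0"
  shows "\<bar>x\<bar> \<le> c / 2 * h + x\<^sup>2 / h / (2 * c)"
proof -
  have "0 \<le> (c * h - \<bar>x\<bar>)\<^sup>2" by simp
  then have "2 * (c * h) * \<bar>x\<bar> \<le> (c * h)\<^sup>2 + x\<^sup>2" by (simp add: power2_diff)
  then show ?thesis using assms by (simp add: field_simps power2_eq_square)
qed

lemma nn_le_imp_integral_le:
  assumes "integrable M f" "\<And>x. f x \<ge> 0" "(\<integral>\<^sup>+x. ennreal (f x) \<partial>M) \<le> ennreal c" "c \<ge> 0"
  shows "(\<integral>x. f x \<partial>M) \<le> c"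
  using assms by (subst (asm) nn_integral_eq_integral) (auto simp: ennreal_le_iff)

lemma integral_gauss:
  fixes g :: "real \<Rightarrow> real"
  assumes [measurable]: "g \<in> borel_measurable borel"
  shows "integral\<^sup>L std_gauss_measure g = (\<integral>x. std_normal_density x * g x \<partial>lborel)"
  by (subst integral_density) (auto simp: normal_density_nonneg)

text \<open>The bookkeeping for the estimate below, with its notation: \<open>S\<close> is the second moment,
\<open>A\<close> the squared transport distance, \<open>X\<close> the correlation of \<open>x\<close> and \<open>T x\<close>, \<open>D\<close> and \<open>R\<close> the two
remainders, \<open>W\<close> the mean displacement, \<open>L\<close> the mean of \<open>\<bar>h'\<bar>\<close> and \<open>L1\<close> the distance of \<open>h\<close> from 1.
The bounds on \<open>D\<close> and \<open>W\<close> are chained with weights \<open>\<eta>\<^sup>2\<close> and \<open>\<eta>\<close>; this produces the third power.\<close>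

lemma stability_constants:
  fixes \<eta> A D S X R M \<delta> W L L1 K :: real
  assumes "\<eta> > 0" "\<eta> \<le> 1" "0 \<le> K" "K \<le> 3" "0 \<le> A" "A = 1 - 2 * X + S" "- (1 + S) / 2 \<le> X" "0 \<le> S" "S \<le> M"
    "R \<le> 2 * \<delta>" "0 \<le> R" "D \<le> \<eta>\<^sup>2 * A / 2 + R / (2 * \<eta>\<^sup>2)" "0 \<le> D"
    "W \<le> 2 * K * (D / (2 * \<eta>) + \<eta> * (X + 1))"
    "L \<le> \<eta> / 2 + R / (2 * \<eta>) + W" "L1 \<le> 2 * K * L" "0 \<le> L"
  shows "L1 \<le> 100 * (\<eta> * (1 + M) + \<delta> / \<eta> ^ 3)"
proof -
  have \<delta>: "0 \<le> \<delta>" using assms by linarith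
  have X: "X \<le> (1 + M) / 2" "A \<le> 2 * (1 + M)" using assms by auto
  have q: "\<delta> / \<eta> \<le> \<delta> / \<eta> ^ 3"
  proof -
    have "\<eta> ^ 3 \<le> \<eta> ^ 1" using assms(1,2) by (intro power_decreasing) auto
    then show ?thesis using \<delta> assms(1) by (intro divide_left_mono) auto
  qed
  have "D / (2 * \<eta>) \<le> (\<eta>\<^sup>2 * (2 * (1 + M)) / 2 + (2 * \<delta>) / (2 * \<eta>\<^sup>2)) / (2 * \<eta>)"
    using assms X by (intro divide_right_mono order_trans[OF assms(12)] add_mono mult_left_mono) auto
  also have "\<dots> = \<eta> * (1 + M) / 2 + \<delta> / \<eta> ^ 3 / 2"
    using assms(1) by (simp add: field_simps power2_eq_square power3_eq_cube)
  finally have "D / (2 * \<eta>) + \<eta> * (X + 1) \<le> \<eta> * (1 + M) / 2 + \<delta> / \<eta> ^ 3 / 2 + \<eta> * ((1 + M) / 2 + 1)"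
    using X assms(1) by (intro add_mono mult_left_mono) auto
  also have "\<dots> \<le> 2 * (\<eta> * (1 + M)) + \<delta> / \<eta> ^ 3 / 2"
    using assms(1,8,9) by (simp add: algebra_simps)
  finally have *: "D / (2 * \<eta>) + \<eta> * (X + 1) \<le> 2 * (\<eta> * (1 + M)) + \<delta> / \<eta> ^ 3 / 2" .
  have nn: "0 \<le> \<eta> * (1 + M)" "0 \<le> \<delta> / \<eta> ^ 3" using assms \<delta> by auto
  have "W \<le> 2 * K * (2 * (\<eta> * (1 + M)) + \<delta> / \<eta> ^ 3 / 2)"
    using * assms(3) by (intro order_trans[OF assms(14)] mult_left_mono) auto
  also have "\<dots> \<le> 6 * (2 * (\<eta> * (1 + M)) + \<delta> / \<eta> ^ 3 / 2)"
    using nn assms(4) by (intro mult_right_mono) auto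
  finally have W: "W \<le> 12 * (\<eta> * (1 + M)) + 3 * (\<delta> / \<eta> ^ 3)" by simp
  have "R / (2 * \<eta>) \<le> (2 * \<delta>) / (2 * \<eta>)" using assms by (intro divide_right_mono) auto
  moreover have "\<eta> / 2 \<le> \<eta> * (1 + M)" using assms by (simp add: algebra_simps)
  ultimately have L: "L \<le> 13 * (\<eta> * (1 + M)) + 4 * (\<delta> / \<eta> ^ 3)"
    using W q assms(15) by simp
  have "L1 \<le> 6 * L" using assms by (intro order_trans[OF assms(16)] mult_right_mono) auto
  with L nn show ?thesis by (simp add: distrib_left)
qed

text \<open>The transport argument for \<open>h\<close> bounded below. The lower bound makes
the transport map a diffeomorphism of the line, and all integrals that occur are then finite.\<close>

lemma lsi_stability_positive:
  fixes h k :: "real \<Rightarrow> real" and e \<eta> M :: real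
  assumes ac: "ac_deriv h k" and e: "e > 0" "\<And>x. h x \<ge> e"
    and h1: "integrable std_gauss_measure h" "(\<integral>x. h x \<partial>std_gauss_measure) = 1"
    and hx: "integrable std_gauss_measure (\<lambda>x. h x * x)" "(\<integral>x. h x * x \<partial>std_gauss_measure) = 0"
    and hxx: "integrable std_gauss_measure (\<lambda>x. h x * x\<^sup>2)" "(\<integral>x. h x * x\<^sup>2 \<partial>std_gauss_measure) \<le> M"
    and I: "integrable std_gauss_measure (\<lambda>x. (k x)\<^sup>2 / h x)"
    and \<eta>: "\<eta> > 0"
  shows "integrable std_gauss_measure (\<lambda>x. h x * ln (h x))"
    and "(\<integral>x. \<bar>h x - 1\<bar> \<partial>std_gauss_measure) \<le> 100 * (\<eta> * (1 + M) +
      ((\<integral>x. (k x)\<^sup>2 / h x \<partial>std_gauss_measure) / 2 - (\<integral>x. h x * ln (h x) \<partial>std_gauss_measure)) / \<eta> ^ 3)"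
proof -
  let ?\<rho> = std_normal_density
  interpret g: prob_space std_gauss_measure by (rule prob_space_normal_density) simp
  have \<rho>pos: "?\<rho> x > 0" for x by (rule normal_density_pos) simp
  have hpos: "h x > 0" for x using e(1) e(2)[of x] by linarith
  have [measurable]: "k \<in> borel_measurable borel" by (rule ac_deriv_measurable[OF ac])
  have h_cont: "continuous_on UNIV h" by (rule ac_deriv_continuous[OF ac])
  have [measurable]: "h \<in> borel_measurable borel" by (rule borel_measurable_continuous_onI[OF h_cont])
  define p where "p x = ?\<rho> x * h x" for x
  have p_pos: "p x > 0" for x using \<rho>pos hpos by (simp add: p_def)
  have p_cont: "continuous_on UNIV p"
    unfolding p_def using h_cont continuous_std_normal_density by (intro continuous_intros)
  have [measurable]: "p \<in> borel_measurable borel" by (rule borel_measurable_continuous_onI[OF p_cont])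
  have ip: "integrable lborel p" "(\<integral>x. p x \<partial>lborel) = 1"
    using h1 by (simp_all add: integrable_gauss_iff integral_gauss p_def[abs_def])
  have ipx: "integrable lborel (\<lambda>x. p x * x)" "(\<integral>x. p x * x \<partial>lborel) = 0"
    using hx by (simp_all add: integrable_gauss_iff integral_gauss p_def mult.assoc)
  define S where "S = (\<integral>x. p x * x\<^sup>2 \<partial>lborel)"
  have ipxx: "integrable lborel (\<lambda>x. p x * x\<^sup>2)"  and SM: "S \<le> M"
    using hxx by (simp_all add: integrable_gauss_iff integral_gauss p_def S_def mult.assoc)
  have S0: "0 \<le> S" unfolding S_def using p_pos by (intro Bochner_Integration.integral_nonneg) (auto simp: less_imp_le)
  have "emeasure (density lborel (\<lambda>x. ennreal (p x))) UNIV = 1"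
    using ip p_pos by (simp add: emeasure_density nn_integral_eq_integral less_imp_le)
  then have p_ps: "prob_space (density lborel (\<lambda>x. ennreal (p x)))"
    by (intro prob_spaceI) simp
  interpret pos_density p by (rule pos_density.intro[OF p_cont p_pos p_ps])
  let ?T = transport
  have iN: "integrable N f \<longleftrightarrow> integrable lborel (\<lambda>x. p x * f x)"
    "integral\<^sup>L N f = (\<integral>x. p x * f x \<partial>lborel)" if "f \<in> borel_measurable borel" for f :: "real \<Rightarrow> real"
    using that p_pos by (subst integrable_density integral_density, auto simp: less_imp_le)+
  have tr: "integrable lborel (\<lambda>x. p x * g (?T x)) \<longleftrightarrow> integrable std_gauss_measure g"
    "(\<integral>x. p x * g (?T x) \<partial>lborel) = integral\<^sup>L std_gauss_measure g"
    if g: "g \<in> borel_measurable borel" for g :: "real \<Rightarrow> real"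
  proof -
    have "(\<lambda>x. g (?T x)) \<in> borel_measurable borel" using g by (rule measurable_compose[OF transport_measurable])
    note iN(1)[OF this] iN(2)[OF this]
    then show "integrable lborel (\<lambda>x. p x * g (?T x)) \<longleftrightarrow> integrable std_gauss_measure g"
      "(\<integral>x. p x * g (?T x) \<partial>lborel) = integral\<^sup>L std_gauss_measure g"
      using integrable_transport(1)[OF g] integrable_transport(2)[OF g] by (simp_all only:)
  qed
  have ipT: "integrable lborel (\<lambda>x. p x * ?T x)" "(\<integral>x. p x * ?T x \<partial>lborel) = 0"
    using tr(1)[of "\<lambda>y. y"] tr(2)[of "\<lambda>y. y"] gauss_moments(1,2) by (simp_all only: measurable_ident_sets)
  have ipTT: "integrable lborel (\<lambda>x. p x * (?T x)\<^sup>2)" "(\<integral>x. p x * (?T x)\<^sup>2 \<partial>lborel) = 1"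
    using tr(1)[of "\<lambda>y. y\<^sup>2"] tr(2)[of "\<lambda>y. y\<^sup>2"] gauss_moments(3,4) by (simp_all only: borel_measurable_power measurable_ident_sets)
  have ipxT: "integrable lborel (\<lambda>x. p x * (x * ?T x))"
  proof (rule integrable_bound_pointwise)
    show "integrable lborel (\<lambda>x. p x * x\<^sup>2 + p x * (?T x)\<^sup>2)" using ipxx ipTT(1) by simp
    show "norm (p x * (x * ?T x)) \<le> norm (p x * x\<^sup>2 + p x * (?T x)\<^sup>2)" for x
    proof -
      have "2 * (\<bar>x\<bar> * \<bar>?T x\<bar>) \<le> \<bar>x\<bar>\<^sup>2 + \<bar>?T x\<bar>\<^sup>2" by (rule sum_squares_bound[unfolded mult.assoc])
      moreover have "0 \<le> \<bar>x\<bar> * \<bar>?T x\<bar>" by simp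
      ultimately have "\<bar>x\<bar> * \<bar>?T x\<bar> \<le> \<bar>x\<bar>\<^sup>2 + \<bar>?T x\<bar>\<^sup>2" by linarith
      then have "\<bar>x * ?T x\<bar> \<le> x\<^sup>2 + (?T x)\<^sup>2" by (simp add: abs_mult)
      then have "p x * \<bar>x * ?T x\<bar> \<le> p x * (x\<^sup>2 + (?T x)\<^sup>2)" using p_pos by (simp add: mult_left_mono less_imp_le)
      then show ?thesis using p_pos[of x] by (simp add: abs_mult distrib_left)
    qed
  qed simp
  define X where "X = (\<integral>x. p x * (x * ?T x) \<partial>lborel)"
  have i\<rho>T: "integrable lborel (\<lambda>x. ?\<rho> (?T x))" "(\<integral>x. ?\<rho> (?T x) \<partial>lborel) = X"
    using integral_density_at_transport ipxT by (simp_all add: iN X_def)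
  define \<theta> where "\<theta> x = ?T x - x" for x
  have \<theta>_meas[measurable]: "\<theta> \<in> borel_measurable borel" unfolding \<theta>_def by measurable
  define A where "A = (\<integral>x. p x * (\<theta> x)\<^sup>2 \<partial>lborel)"
  have p\<theta>2: "p x * (\<theta> x)\<^sup>2 = p x * (?T x)\<^sup>2 - 2 * (p x * (x * ?T x)) + p x * x\<^sup>2" for x
    by (simp add: \<theta>_def power2_eq_square algebra_simps)
  have ip\<theta>2: "integrable lborel (\<lambda>x. p x * (\<theta> x)\<^sup>2)"
    unfolding p\<theta>2 using ipTT(1) ipxT ipxx by simp
  have A: "A = 1 - 2 * X + S"
    unfolding A_def p\<theta>2 using ipTT ipxT ipxx by (simp add: X_def S_def)
  have A0: "0 \<le> A" unfolding A_def using p_pos by (intro Bochner_Integration.integral_nonneg) (auto simp: less_imp_le)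
  have X: "- (1 + S) / 2 \<le> X"
  proof -
    have "0 \<le> (\<integral>x. p x * (?T x + x)\<^sup>2 \<partial>lborel)"
      using p_pos by (intro Bochner_Integration.integral_nonneg) (auto simp: less_imp_le)
    also have "\<dots> = (\<integral>x. p x * (?T x)\<^sup>2 + 2 * (p x * (x * ?T x)) + p x * x\<^sup>2 \<partial>lborel)"
      by (intro Bochner_Integration.integral_cong) (simp_all add: power2_eq_square algebra_simps)
    also have "\<dots> = 1 + 2 * X + S" using ipTT ipxT ipxx by (simp add: X_def S_def)
    finally show ?thesis by simp
  qed
  have ip\<theta>: "integrable lborel (\<lambda>x. p x * \<theta> x)" "(\<integral>x. p x * \<theta> x \<partial>lborel) = 0"
    unfolding \<theta>_def right_diff_distrib using ipT ipx by simp_all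
  define I0 where "I0 = (\<integral>x. ?\<rho> x * ((k x)\<^sup>2 / h x) \<partial>lborel)"
  have iI: "integrable lborel (\<lambda>x. ?\<rho> x * ((k x)\<^sup>2 / h x))"
    using I by (simp add: integrable_gauss_iff)
  \<comment> \<open>The coefficient \<open>c\<close> is free: \<open>c = 1\<close> defines the remainder \<open>R\<close>, \<open>c = - 1\<close> helps to dominate \<open>k \<theta>\<close>, and \<open>c = 1 + \<eta>\<^sup>2\<close> replaces the Cauchy-Schwarz inequality.\<close>
  have sq: "?\<rho> x * ((k x + c * (\<theta> x * h x))\<^sup>2 / h x) =
     ?\<rho> x * ((k x)\<^sup>2 / h x) + 2 * c * (?\<rho> x * (k x * \<theta> x)) + c\<^sup>2 * (p x * (\<theta> x)\<^sup>2)" for c x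
    using hpos[of x] unfolding p_def by (simp add: power2_eq_square field_simps)
  have ik\<theta>: "integrable lborel (\<lambda>x. ?\<rho> x * (k x * \<theta> x))"
  proof (rule integrable_bound_pointwise)
    show "integrable lborel (\<lambda>x. ?\<rho> x * ((k x)\<^sup>2 / h x) + p x * (\<theta> x)\<^sup>2)" using iI ip\<theta>2 by simp
    show "norm (?\<rho> x * (k x * \<theta> x)) \<le> norm (?\<rho> x * ((k x)\<^sup>2 / h x) + p x * (\<theta> x)\<^sup>2)" for x
    proof -
      have nn: "0 \<le> ?\<rho> x * ((k x + c * (\<theta> x * h x))\<^sup>2 / h x)" for c
        using \<rho>pos[of x] hpos[of x] by (simp add: less_imp_le)
      have "0 \<le> ?\<rho> x * ((k x)\<^sup>2 / h x)" "0 \<le> p x * (\<theta> x)\<^sup>2"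
        using \<rho>pos[of x] hpos[of x] p_pos[of x] by (simp_all add: less_imp_le)
      then show ?thesis
        using nn[of 1, unfolded sq] nn[of "-1", unfolded sq] unfolding real_norm_def by simp
    qed
  qed simp
  define J where "J = (\<integral>x. ?\<rho> x * (k x * \<theta> x) \<partial>lborel)"
  have isq: "integrable lborel (\<lambda>x. ?\<rho> x * ((k x + c * (\<theta> x * h x))\<^sup>2 / h x))"
    "(\<integral>x. ?\<rho> x * ((k x + c * (\<theta> x * h x))\<^sup>2 / h x) \<partial>lborel) = I0 + 2 * c * J + c\<^sup>2 * A" for c
    unfolding sq I0_def J_def A_def using iI ik\<theta> ip\<theta>2 by simp_all
  have Qnn: "0 \<le> I0 + 2 * c * J + c\<^sup>2 * A" for c
    unfolding isq(2)[symmetric] using \<rho>pos hpos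
    by (intro Bochner_Integration.integral_nonneg) (auto simp: less_imp_le)
  define \<tau> where "\<tau> x = p x / ?\<rho> (?T x)" for x
  have \<tau>pos: "\<tau> x > 0" for x using p_pos \<rho>pos by (simp add: \<tau>_def)
  have \<rho>\<tau>: "?\<rho> (?T x) * \<tau> x = p x" for x using \<rho>pos[of "?T x"] by (simp add: \<tau>_def)
  have \<tau>_cont: "continuous_on UNIV \<tau>"
    unfolding \<tau>_def using \<rho>pos
    by (intro continuous_on_divide p_cont continuous_on_compose2[OF continuous_std_normal_density transport_continuous])
      (auto simp: less_imp_neq[symmetric])
  have [measurable]: "\<tau> \<in> borel_measurable borel" by (rule borel_measurable_continuous_onI[OF \<tau>_cont])
  have ac\<theta>: "ac_deriv \<theta> (\<lambda>x. \<tau> x - 1)"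
    unfolding \<theta>_def \<tau>_def
    using transport_deriv \<tau>_cont unfolding \<tau>_def
    by (intro ac_deriv_of_continuous_derivative) (auto intro!: derivative_eq_intros continuous_intros)
  have "ac_deriv ?\<rho> (\<lambda>x. - x * ?\<rho> x)"
    using std_normal_deriv continuous_std_normal_density
    by (intro ac_deriv_of_continuous_derivative continuous_intros) auto
  from ac_deriv_mult[OF ac_deriv_mult[OF this ac] ac\<theta>]
  \<comment> \<open>Integrating the derivative of \<open>p \<theta>\<close> over the line gives the mean of \<open>\<tau> = T'\<close> under \<open>p\<close>; \<open>p \<tau>\<close> is the part not yet known to be integrable.\<close>
  have acp\<theta>: "ac_deriv (\<lambda>x. p x * \<theta> x) (\<lambda>x. p x * \<tau> x - (p x + p x * (x * ?T x) - p x * x\<^sup>2 - ?\<rho> x * (k x * \<theta> x)))"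
    by (simp add: p_def \<theta>_def power2_eq_square algebra_simps)
  have ip\<tau>: "integrable lborel (\<lambda>x. p x * \<tau> x)" "(\<integral>x. p x * \<tau> x \<partial>lborel) = 1 + X - S - J"
    using integral_derivative_zero[OF acp\<theta> ip\<theta>(1)] p_pos \<tau>pos ip ipxT ipxx ik\<theta>
    by (simp_all add: less_imp_le X_def S_def J_def)
  have pln: "p x * ln (\<tau> x) = ?\<rho> (?T x) * ent_fun (\<tau> x) - ?\<rho> (?T x) + p x" for x
  proof -
    have "?\<rho> (?T x) * ent_fun (\<tau> x) = (?\<rho> (?T x) * \<tau> x) * ln (\<tau> x) - ?\<rho> (?T x) * \<tau> x + ?\<rho> (?T x)"
      unfolding ent_fun_def by algebra
    then show ?thesis unfolding \<rho>\<tau> by simp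
  qed
  have iE: "integrable lborel (\<lambda>x. ?\<rho> (?T x) * ent_fun (\<tau> x))"
  proof (rule integrable_bound_pointwise)
    show "integrable lborel (\<lambda>x. p x * \<tau> x - 2 * p x + ?\<rho> (?T x))" using ip\<tau>(1) ip(1) i\<rho>T(1) by simp
    show "(\<lambda>x. ?\<rho> (?T x) * ent_fun (\<tau> x)) \<in> borel_measurable lborel" unfolding ent_fun_def by measurable
    show "norm (?\<rho> (?T x) * ent_fun (\<tau> x)) \<le> norm (p x * \<tau> x - 2 * p x + ?\<rho> (?T x))" for x
    proof -
      have "(?\<rho> (?T x) * \<tau> x) * \<tau> x - 2 * (?\<rho> (?T x) * \<tau> x) + ?\<rho> (?T x) = ?\<rho> (?T x) * (\<tau> x - 1)\<^sup>2"
        by algebra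
      then have "p x * \<tau> x - 2 * p x + ?\<rho> (?T x) = ?\<rho> (?T x) * (\<tau> x - 1)\<^sup>2"
        unfolding \<rho>\<tau> .
      moreover have "?\<rho> (?T x) * ent_fun (\<tau> x) \<le> ?\<rho> (?T x) * (\<tau> x - 1)\<^sup>2"
        using \<rho>pos[of "?T x"] \<tau>pos by (intro mult_left_mono ent_fun_le_square) (auto simp: less_imp_le)
      moreover have "0 \<le> ?\<rho> (?T x) * ent_fun (\<tau> x)"
        using \<rho>pos[of "?T x"] \<tau>pos[of x] by (simp add: ent_fun_nonneg less_imp_le)
      ultimately show ?thesis by simp
    qed
  qed
  \<comment> \<open>\<open>D\<close> is the remainder in Talagrand's inequality.\<close>
  define D where "D = (\<integral>x. ?\<rho> (?T x) * ent_fun (\<tau> x) \<partial>lborel)"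
  have D0: "0 \<le> D" unfolding D_def using \<rho>pos \<tau>pos
    by (intro Bochner_Integration.integral_nonneg) (auto simp: ent_fun_nonneg less_imp_le)
  have ipln: "integrable lborel (\<lambda>x. p x * ln (\<tau> x))" "(\<integral>x. p x * ln (\<tau> x) \<partial>lborel) = D - X + 1"
    unfolding pln D_def using iE i\<rho>T ip by simp_all
  \<comment> \<open>Concavity of the logarithm is the only loss on the way to the HWI inequality.\<close>
  have "(\<integral>x. p x * ln (\<tau> x) \<partial>lborel) \<le> (\<integral>x. p x * \<tau> x - p x \<partial>lborel)"
  proof (rule integral_mono)
    fix x
    have "p x * ln (\<tau> x) \<le> p x * (\<tau> x - 1)"
      using p_pos \<tau>pos by (intro mult_left_mono ln_le_minus_one) (auto simp: less_imp_le)
    then show "p x * ln (\<tau> x) \<le> p x * \<tau> x - p x" by (simp add: right_diff_distrib)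
  qed (use ipln(1) ip\<tau>(1) ip(1) in simp_all)
  then have DAJ: "D \<le> - A - J" using ip\<tau> ip ipln A by simp
  have lnh: "?\<rho> x * (h x * ln (h x)) = (p x * x\<^sup>2 - p x * (?T x)\<^sup>2) / 2 + p x * ln (\<tau> x)" for x
  proof -
    have "h x = \<tau> x * (?\<rho> (?T x) / ?\<rho> x)"
      using \<rho>\<tau>[of x] \<rho>pos[of x] unfolding p_def by (simp add: field_simps)
    moreover have "?\<rho> (?T x) / ?\<rho> x = exp ((x\<^sup>2 - (?T x)\<^sup>2) / 2)"
      unfolding std_normal_density_alt by (simp add: exp_diff[symmetric] diff_divide_distrib)
    ultimately have "ln (h x) = ln (\<tau> x) + (x\<^sup>2 - (?T x)\<^sup>2) / 2"
      using \<tau>pos[of x] by (simp add: ln_mult)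
    then have "?\<rho> x * (h x * ln (h x)) = p x * (ln (\<tau> x) + (x\<^sup>2 - (?T x)\<^sup>2) / 2)"
      unfolding p_def by (simp only: mult.assoc)
    also have "\<dots> = (p x * x\<^sup>2 - p x * (?T x)\<^sup>2) / 2 + p x * ln (\<tau> x)"
      by (simp add: field_simps)
    finally show ?thesis .
  qed
  define H where "H = (\<integral>x. h x * ln (h x) \<partial>std_gauss_measure)"
  have iH: "integrable lborel (\<lambda>x. ?\<rho> x * (h x * ln (h x)))"
    unfolding lnh using ipxx ipTT ipln by simp
  then show "integrable std_gauss_measure (\<lambda>x. h x * ln (h x))" by (simp add: integrable_gauss_iff)
  have H: "H = A / 2 + D"
  proof -
    have "H = (S - 1) / 2 + (D - X + 1)"
      unfolding H_def using ipxx ipTT ipln by (simp add: integral_gauss lnh S_def)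
    then show ?thesis using A by (simp add: field_simps)
  qed
  define L1 where "L1 = (\<integral>x. \<bar>h x - 1\<bar> \<partial>std_gauss_measure)"
  define \<delta> where "\<delta> = I0 / 2 - H"
  define R where "R = I0 + 2 * J + A"
  have R: "0 \<le> R" "R \<le> 2 * \<delta>" using Qnn[of 1] DAJ by (simp_all add: R_def \<delta>_def H)
  \<comment> \<open>Nonnegativity of the quadratic at \<open>c = 1 + \<eta>\<^sup>2\<close>.\<close>
  have DR: "D \<le> \<eta>\<^sup>2 * A / 2 + R / (2 * \<eta>\<^sup>2)"
  proof -
    define l where "l = \<eta>\<^sup>2"
    have l: "l > 0" using \<eta> by (simp add: l_def)
    have "0 \<le> R + 2 * l * (A + J) + l\<^sup>2 * A"
      using Qnn[of "1 + l"] by (simp add: R_def power2_eq_square algebra_simps)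
    then have "2 * l * D \<le> R + l\<^sup>2 * A"
      using mult_left_mono[OF DAJ, of "2 * l"] l by (simp add: algebra_simps)
    then show ?thesis using l unfolding l_def[symmetric] by (simp add: field_simps power2_eq_square)
  qed
  define K where "K = sqrt (2 * pi)"
  have K: "0 \<le> K" "K \<le> 3"
  proof -
    show "0 \<le> K" by (simp add: K_def)
    have "2 * pi \<le> 3\<^sup>2" using pi_less_4 by simp
    then show "K \<le> 3" unfolding K_def by (rule real_le_lsqrt[rotated -1]) auto
  qed
  define W where "W = (\<integral>x. p x * \<bar>\<theta> x\<bar> \<partial>lborel)"
  have ipa\<theta>: "integrable lborel (\<lambda>x. p x * \<bar>\<theta> x\<bar>)"
    using integrable_norm[OF ip\<theta>(1)] p_pos by (simp add: abs_mult less_imp_le)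
  have W: "W \<le> 2 * K * (D / (2 * \<eta>) + \<eta> * (X + 1))"
  proof -
    let ?w = "\<lambda>x. (?\<rho> (?T x) * ent_fun (\<tau> x)) / (2 * \<eta>) + \<eta> * (?\<rho> (?T x) + p x)"
    have w0: "?\<rho> (?T x) * \<bar>\<tau> x - 1\<bar> \<le> ?w x" for x
    proof -
      have "?\<rho> (?T x) * \<bar>\<tau> x - 1\<bar> \<le> ?\<rho> (?T x) * (ent_fun (\<tau> x) / (2 * \<eta>) + \<eta> * (1 + \<tau> x))"
        using \<rho>pos \<tau>pos \<eta> by (intro mult_left_mono abs_minus_one_le_ent_fun) (auto simp: less_imp_le)
      also have "\<dots> = (?\<rho> (?T x) * ent_fun (\<tau> x)) / (2 * \<eta>) + \<eta> * (?\<rho> (?T x) + ?\<rho> (?T x) * \<tau> x)"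
        by (simp add: distrib_left mult_ac)
      also have "\<dots> = ?w x" unfolding \<rho>\<tau> ..
      finally show ?thesis .
    qed
    have w1: "integrable lborel ?w" "(\<integral>x. ?w x \<partial>lborel) = D / (2 * \<eta>) + \<eta> * (X + 1)"
      using iE i\<rho>T ip by (simp_all add: D_def)
    have w2: "0 \<le> ?w x" for x
      using w0[of x] \<rho>pos[of "?T x"] by (meson abs_ge_zero less_imp_le mult_nonneg_nonneg order_trans)
    have c0: "0 \<le> D / (2 * \<eta>) + \<eta> * (X + 1)"
      unfolding w1(2)[symmetric] using w2 by (intro Bochner_Integration.integral_nonneg) auto
    have "(\<integral>\<^sup>+s. ennreal \<bar>\<theta> s - (\<integral>r. \<theta> r \<partial>N)\<bar> \<partial>N) \<le> 2 * (\<integral>\<^sup>+x. ennreal \<bar>\<tau> x - 1\<bar> * ennreal (K * ?\<rho> (?T x)) \<partial>lborel)"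
    proof (rule L1_poincare[OF _ _ ac\<theta>])
      show "integrable N \<theta>" using ip\<theta>(1) by (simp add: iN)
      show "emeasure N {..x} * emeasure N {x..} \<le> ennreal (K * ?\<rho> (?T x))" for x
        unfolding emeasure_transport K_def by (rule gauss_isoperimetric)
    qed (auto intro: p_prob)
    also have "(\<integral>r. \<theta> r \<partial>N) = 0" using ip\<theta>(2) by (simp add: iN)
    also have "(\<integral>\<^sup>+x. ennreal \<bar>\<tau> x - 1\<bar> * ennreal (K * ?\<rho> (?T x)) \<partial>lborel) \<le> (\<integral>\<^sup>+x. ennreal (K * ?w x) \<partial>lborel)"
    proof (rule nn_integral_mono)
      fix x
      have "\<bar>\<tau> x - 1\<bar> * (K * ?\<rho> (?T x)) = K * (?\<rho> (?T x) * \<bar>\<tau> x - 1\<bar>)" by simp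
      also have "\<dots> \<le> K * ?w x" using w0 K by (intro mult_left_mono)
      finally show "ennreal \<bar>\<tau> x - 1\<bar> * ennreal (K * ?\<rho> (?T x)) \<le> ennreal (K * ?w x)"
        using K \<rho>pos[of "?T x"] by (subst ennreal_mult[symmetric]) (auto intro!: ennreal_leI simp: less_imp_le)
    qed
    also have "(\<integral>\<^sup>+x. ennreal (K * ?w x) \<partial>lborel) = ennreal (\<integral>x. K * ?w x \<partial>lborel)"
      using w1(1) w2 K by (intro nn_integral_eq_integral) (simp_all del: times_divide_eq_left)
    also have "(\<integral>x. K * ?w x \<partial>lborel) = K * (D / (2 * \<eta>) + \<eta> * (X + 1))"
      using w1 by simp
    finally have "(\<integral>\<^sup>+s. ennreal \<bar>\<theta> s\<bar> \<partial>N) \<le> 2 * ennreal (K * (D / (2 * \<eta>) + \<eta> * (X + 1)))"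
      by (simp add: mult_left_mono)
    also have "\<dots> = ennreal (2 * (K * (D / (2 * \<eta>) + \<eta> * (X + 1))))"
      using K c0 by (subst ennreal_mult) auto
    finally have "(\<integral>s. \<bar>\<theta> s\<bar> \<partial>N) \<le> 2 * (K * (D / (2 * \<eta>) + \<eta> * (X + 1)))"
      using K c0 ip\<theta>(1) by (intro nn_le_imp_integral_le) (auto simp: iN intro: ipa\<theta>)
    then show ?thesis by (simp add: iN W_def)
  qed
  have irk: "integrable lborel (\<lambda>x. ?\<rho> x * \<bar>k x\<bar>)" and L: "(\<integral>x. ?\<rho> x * \<bar>k x\<bar> \<partial>lborel) \<le> \<eta> / 2 + R / (2 * \<eta>) + W"
  proof -
    define r where "r x = ?\<rho> x * ((k x + 1 * (\<theta> x * h x))\<^sup>2 / h x)" for x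
    have r: "integrable lborel r" "(\<integral>x. r x \<partial>lborel) = R"
      using isq[of 1] by (simp_all add: r_def[abs_def] R_def)
    let ?w = "\<lambda>x. \<eta> / 2 * p x + r x / (2 * \<eta>) + p x * \<bar>\<theta> x\<bar>"
    have w: "?\<rho> x * \<bar>k x\<bar> \<le> ?w x" for x
    proof -
      have "\<bar>k x\<bar> \<le> \<bar>k x + 1 * (\<theta> x * h x)\<bar> + \<bar>\<theta> x\<bar> * h x"
        using hpos[of x] abs_triangle_ineq4[of "k x + \<theta> x * h x" "\<theta> x * h x"] by (simp add: abs_mult)
      also have "\<dots> \<le> (\<eta> / 2 * h x + (k x + 1 * (\<theta> x * h x))\<^sup>2 / h x / (2 * \<eta>)) + \<bar>\<theta> x\<bar> * h x"
        by (intro add_right_mono abs_le_half_square_sum hpos \<eta>)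
      finally have "?\<rho> x * \<bar>k x\<bar> \<le> ?\<rho> x * ((\<eta> / 2 * h x + (k x + 1 * (\<theta> x * h x))\<^sup>2 / h x / (2 * \<eta>)) + \<bar>\<theta> x\<bar> * h x)"
        using \<rho>pos[of x] by (intro mult_left_mono) auto
      then show ?thesis by (simp add: p_def r_def distrib_left mult_ac)
    qed
    have w1: "integrable lborel ?w" "(\<integral>x. ?w x \<partial>lborel) = \<eta> / 2 + R / (2 * \<eta>) + W"
      using ip r ipa\<theta> by (simp_all add: W_def)
    show "integrable lborel (\<lambda>x. ?\<rho> x * \<bar>k x\<bar>)"
      by (rule Bochner_Integration.integrable_bound[OF w1(1)])
        (use w \<rho>pos in \<open>auto simp: abs_mult less_imp_le intro!: AE_I2 order_trans[OF _ abs_ge_self]\<close>)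
    then show "(\<integral>x. ?\<rho> x * \<bar>k x\<bar> \<partial>lborel) \<le> \<eta> / 2 + R / (2 * \<eta>) + W"
      unfolding w1(2)[symmetric] using w w1(1) by (intro integral_mono) auto
  qed
  define L where "L = (\<integral>x. ?\<rho> x * \<bar>k x\<bar> \<partial>lborel)"
  have L0: "0 \<le> L" unfolding L_def using \<rho>pos by (intro Bochner_Integration.integral_nonneg) (auto simp: less_imp_le)
  have L1: "L1 \<le> 2 * K * L"
  proof -
    have "(\<integral>\<^sup>+s. ennreal \<bar>h s - (\<integral>r. h r \<partial>std_gauss_measure)\<bar> \<partial>std_gauss_measure) \<le> 2 * (\<integral>\<^sup>+x. ennreal \<bar>k x\<bar> * ennreal (K * ?\<rho> x) \<partial>lborel)"
      by (rule L1_poincare[OF _ _ ac]) (auto simp: K_def intro: h1 gauss_isoperimetric g.prob_space_axioms)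
    also have "(\<integral>\<^sup>+x. ennreal \<bar>k x\<bar> * ennreal (K * ?\<rho> x) \<partial>lborel) = (\<integral>\<^sup>+x. ennreal (K * (?\<rho> x * \<bar>k x\<bar>)) \<partial>lborel)"
      using K \<rho>pos by (intro nn_integral_cong) (simp add: ennreal_mult[symmetric] less_imp_le mult_ac)
    also have "\<dots> = ennreal (K * L)"
      unfolding L_def using irk K \<rho>pos by (subst nn_integral_eq_integral) (auto simp: less_imp_le)
    also have "2 * ennreal (K * L) = ennreal (2 * (K * L))"
      using K L0 by (subst ennreal_mult) auto
    finally have "(\<integral>\<^sup>+s. ennreal \<bar>h s - 1\<bar> \<partial>std_gauss_measure) \<le> ennreal (2 * (K * L))" using h1 by simp
    then have "L1 \<le> 2 * (K * L)" unfolding L1_def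
      using K L0 h1 by (intro nn_le_imp_integral_le) auto
    then show ?thesis by simp
  qed
  have "L1 \<le> 100 * (\<eta> * (1 + M) + \<delta> / \<eta> ^ 3)"
  proof (cases "\<eta> \<le> 1")
    case True
    show ?thesis
      by (rule stability_constants[OF \<eta> True K A0 A X S0 SM R(2) R(1) DR D0 W L[folded L_def] L1 L0])
  next
    case False
    \<comment> \<open>For \<open>\<eta> > 1\<close> the trivial bound 2 suffices, because the deficit is nonnegative.\<close>
    have "L1 \<le> (\<integral>x. h x + 1 \<partial>std_gauss_measure)"
      unfolding L1_def using h1(1) hpos by (intro integral_mono) (auto simp: abs_le_iff less_imp_le intro: order_trans[OF less_imp_le])
    also have "\<dots> = 2" using h1 g.prob_space by simp
    finally have "L1 \<le> 2" .
    moreover have "1 * 1 \<le> \<eta> * (1 + M)" using False SM S0 by (intro mult_mono) auto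
    moreover have "0 \<le> \<delta> / \<eta> ^ 3" using R \<eta> by simp
    ultimately show ?thesis by simp
  qed
  then show "(\<integral>x. \<bar>h x - 1\<bar> \<partial>std_gauss_measure) \<le> 100 * (\<eta> * (1 + M) +
      ((\<integral>x. (k x)\<^sup>2 / h x \<partial>std_gauss_measure) / 2 - (\<integral>x. h x * ln (h x) \<partial>std_gauss_measure)) / \<eta> ^ 3)"
    by (simp add: L1_def \<delta>_def I0_def H_def integral_gauss)
qed

lemma ent_fun_regularised_limit:
  assumes "t \<ge> 0"
  shows "(\<lambda>n. ent_fun ((1 - 1 / real (n + 2)) * t + 1 / real (n + 2))) \<longlonglongrightarrow> ent_fun t"
proof (cases "t = 0")
  case True
  have "(\<lambda>n. ent_fun (1 / real (n + 2))) \<longlonglongrightarrow> 1"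
    unfolding ent_fun_def by real_asymp
  then show ?thesis using True by (simp add: ent_fun_def)
next
  case False
  have "(\<lambda>n. (1 - 1 / real (n + 2)) * t + 1 / real (n + 2)) \<longlonglongrightarrow> (1 - 0) * t + 0"
    by (intro tendsto_intros) real_asymp+
  then show ?thesis unfolding ent_fun_def using False by (intro tendsto_intros) auto
qed

lemma fisher_integrand_le: "(2 * w * g)\<^sup>2 / w\<^sup>2 \<le> 4 * (g::real)\<^sup>2"
  by (cases "w = 0") (auto simp: power_mult_distrib)

text \<open>Apply the previous estimate to \<open>(1 - e) * w\<^sup>2 + e\<close>. Mixing with the constant 1
keeps the mass and the centring, raises the second moment by at most 1 and does not increase the
Fisher information. As \<open>e\<close> tends to 0, Fatou's lemma controls the entropy, which stands on the
left-hand side for this reason.\<close>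

lemma lsi_stability_unit_mass:
  fixes w g :: "real \<Rightarrow> real"
  assumes ac: "ac_deriv w g"
    and w1: "integrable std_gauss_measure (\<lambda>x. (w x)\<^sup>2)" "(\<integral>x. (w x)\<^sup>2 \<partial>std_gauss_measure) = 1"
    and wx: "has_bochner_integral std_gauss_measure (\<lambda>x. x * (w x)\<^sup>2) 0"
    and wxx: "integrable std_gauss_measure (\<lambda>x. x\<^sup>2 * (w x)\<^sup>2)" "(\<integral>x. x\<^sup>2 * (w x)\<^sup>2 \<partial>std_gauss_measure) \<le> M"
    and g: "integrable std_gauss_measure (\<lambda>x. (g x)\<^sup>2)" and \<eta>: "\<eta> > 0"
  shows "(\<integral>\<^sup>+x. ennreal (\<bar>(w x)\<^sup>2 - 1\<bar> + 100 / \<eta> ^ 3 * ent_fun ((w x)\<^sup>2)) \<partial>std_gauss_measure)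
     \<le> ennreal (100 * (\<eta> * (2 + M) + (\<integral>x. (2 * w x * g x)\<^sup>2 / (w x)\<^sup>2 \<partial>std_gauss_measure) / 2 / \<eta> ^ 3))"
    (is "_ \<le> ennreal ?R")
proof -
  interpret g: prob_space std_gauss_measure by (rule prob_space_normal_density) simp
  have [measurable]: "g \<in> borel_measurable borel" by (rule ac_deriv_measurable[OF ac])
  have [measurable]: "w \<in> borel_measurable borel"
    by (intro borel_measurable_continuous_onI ac_deriv_continuous[OF ac])
  have iI: "integrable std_gauss_measure (\<lambda>x. (2 * w x * g x)\<^sup>2 / (w x)\<^sup>2)"
    by (rule Bochner_Integration.integrable_bound[of _ "\<lambda>x. 4 * (g x)\<^sup>2"])
      (use g fisher_integrand_le in auto)
  have ineq: "(1 - e) * (\<integral>x. \<bar>(w x)\<^sup>2 - 1\<bar> \<partial>std_gauss_measure) + 100 / \<eta> ^ 3 * (\<integral>x. ent_fun ((1 - e) * (w x)\<^sup>2 + e) \<partial>std_gauss_measure) \<le> ?R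
     \<and> integrable std_gauss_measure (\<lambda>x. ent_fun ((1 - e) * (w x)\<^sup>2 + e))"
    if e: "0 < e" "e < 1" for e
  proof -
    define h where "h x = (1 - e) * (w x)\<^sup>2 + e" for x
    define k where "k x = (1 - e) * (2 * w x * g x)" for x
    have [measurable]: "h \<in> borel_measurable borel" "k \<in> borel_measurable borel"
      unfolding h_def k_def by measurable
    have he: "h x \<ge> e" for x using e by (simp add: h_def)
    have hpos: "h x > 0" for x using e he[of x] by linarith
    have ach: "ac_deriv h k"
      using ac_deriv_add[OF ac_deriv_cmult[OF ac_deriv_mult[OF ac ac], of "1 - e"] ac_deriv_const[of e]]
      by (simp add: h_def[abs_def] k_def[abs_def] power2_eq_square mult_ac)
    have h1: "integrable std_gauss_measure h" "(\<integral>x. h x \<partial>std_gauss_measure) = 1"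
      unfolding h_def[abs_def] using w1 g.prob_space by simp_all
    have hx': "h x * x = (1 - e) * (x * (w x)\<^sup>2) + e * x" for x by (simp add: h_def algebra_simps)
    have hx: "integrable std_gauss_measure (\<lambda>x. h x * x)" "(\<integral>x. h x * x \<partial>std_gauss_measure) = 0"
      unfolding hx' using wx gauss_moments(1,2) by (simp_all add: has_bochner_integral_iff)
    have hxx': "h x * x\<^sup>2 = (1 - e) * (x\<^sup>2 * (w x)\<^sup>2) + e * x\<^sup>2" for x by (simp add: h_def algebra_simps)
    have hxx: "integrable std_gauss_measure (\<lambda>x. h x * x\<^sup>2)"
      unfolding hxx' using wxx(1) gauss_moments(3) by simp
    have hxx_le: "(\<integral>x. h x * x\<^sup>2 \<partial>std_gauss_measure) \<le> M + 1"
    proof -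
      let ?S = "\<integral>x. x\<^sup>2 * (w x)\<^sup>2 \<partial>std_gauss_measure"
      have "(\<integral>x. h x * x\<^sup>2 \<partial>std_gauss_measure) = (1 - e) * ?S + e"
        unfolding hxx' using wxx(1) gauss_moments(3,4) by simp
      also have "\<dots> \<le> 1 * ?S + 1"
        using e by (intro add_mono mult_right_mono Bochner_Integration.integral_nonneg) auto
      finally show ?thesis using wxx(2) by simp
    qed
    have kh: "(k x)\<^sup>2 / h x \<le> (2 * w x * g x)\<^sup>2 / (w x)\<^sup>2" for x
    proof (cases "w x = 0")
      case False
      have "(k x)\<^sup>2 / h x \<le> (k x)\<^sup>2 / ((1 - e) * (w x)\<^sup>2)"
        using False e hpos[of x] by (intro divide_left_mono) (auto simp: h_def)
      also have "\<dots> = (1 - e) * ((2 * w x * g x)\<^sup>2 / (w x)\<^sup>2)"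
        using e by (simp add: k_def power2_eq_square)
      also have "\<dots> \<le> 1 * ((2 * w x * g x)\<^sup>2 / (w x)\<^sup>2)" using e by (intro mult_right_mono) auto
      finally show ?thesis by simp
    qed (simp add: k_def)
    have ik: "integrable std_gauss_measure (\<lambda>x. (k x)\<^sup>2 / h x)"
      by (rule Bochner_Integration.integrable_bound[OF iI])
        (use kh hpos in \<open>auto simp: less_imp_le\<close>)
    have Ik: "(\<integral>x. (k x)\<^sup>2 / h x \<partial>std_gauss_measure) \<le> (\<integral>x. (2 * w x * g x)\<^sup>2 / (w x)\<^sup>2 \<partial>std_gauss_measure)"
      by (intro integral_mono ik iI kh)
    note main = lsi_stability_positive[OF ach e(1) he h1 hx hxx hxx_le ik \<eta>]
    have ent: "ent_fun (h x) = h x * ln (h x) - h x + 1" for x by (simp add: ent_fun_def)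
    have iE: "integrable std_gauss_measure (\<lambda>x. ent_fun (h x))"
      "(\<integral>x. ent_fun (h x) \<partial>std_gauss_measure) = (\<integral>x. h x * ln (h x) \<partial>std_gauss_measure)"
      unfolding ent using main(1) h1 g.prob_space by simp_all
    have "(\<integral>x. \<bar>h x - 1\<bar> \<partial>std_gauss_measure) = (\<integral>x. (1 - e) * \<bar>(w x)\<^sup>2 - 1\<bar> \<partial>std_gauss_measure)"
    proof (intro Bochner_Integration.integral_cong refl)
      fix x
      have "h x - 1 = (1 - e) * ((w x)\<^sup>2 - 1)" by (simp add: h_def algebra_simps)
      then show "\<bar>h x - 1\<bar> = (1 - e) * \<bar>(w x)\<^sup>2 - 1\<bar>" using e by (simp add: abs_mult)
    qed
    then have "(1 - e) * (\<integral>x. \<bar>(w x)\<^sup>2 - 1\<bar> \<partial>std_gauss_measure)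
       \<le> 100 * (\<eta> * (1 + (M + 1)) + ((\<integral>x. (k x)\<^sup>2 / h x \<partial>std_gauss_measure) / 2 - (\<integral>x. ent_fun (h x) \<partial>std_gauss_measure)) / \<eta> ^ 3)"
      using main(2) iE(2) by simp
    also have "\<dots> \<le> 100 * (\<eta> * (1 + (M + 1)) + ((\<integral>x. (2 * w x * g x)\<^sup>2 / (w x)\<^sup>2 \<partial>std_gauss_measure) / 2 - (\<integral>x. ent_fun (h x) \<partial>std_gauss_measure)) / \<eta> ^ 3)"
      using Ik \<eta> by (intro mult_left_mono add_left_mono divide_right_mono diff_right_mono) auto
    finally show ?thesis using iE(1) by (simp add: h_def diff_divide_distrib algebra_simps)
  qed
  define e where "e n = 1 / real (n + 2)" for n :: nat
  have e: "0 < e n" "e n < 1" for n by (auto simp: e_def)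
  have e_lim: "e \<longlonglongrightarrow> 0" unfolding e_def by real_asymp
  define F where "F n x = (1 - e n) * \<bar>(w x)\<^sup>2 - 1\<bar> + 100 / \<eta> ^ 3 * ent_fun ((1 - e n) * (w x)\<^sup>2 + e n)" for n x
  have F0: "0 \<le> F n x" for n x
    unfolding F_def using e[of n] \<eta>
    by (intro add_nonneg_nonneg mult_nonneg_nonneg ent_fun_nonneg) (auto intro: less_imp_le)
  have [measurable]: "F n \<in> borel_measurable borel" for n unfolding F_def ent_fun_def by measurable
  have F_lim: "(\<lambda>n. F n x) \<longlonglongrightarrow> (1 - 0) * \<bar>(w x)\<^sup>2 - 1\<bar> + 100 / \<eta> ^ 3 * ent_fun ((w x)\<^sup>2)" for x
    unfolding F_def using ent_fun_regularised_limit[of "(w x)\<^sup>2"]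
    by (intro tendsto_intros e_lim) (simp add: e_def)
  have iabs: "integrable std_gauss_measure (\<lambda>x. \<bar>(w x)\<^sup>2 - 1\<bar>)" using w1(1) by simp
  have "(\<integral>\<^sup>+x. ennreal (\<bar>(w x)\<^sup>2 - 1\<bar> + 100 / \<eta> ^ 3 * ent_fun ((w x)\<^sup>2)) \<partial>std_gauss_measure)
    = (\<integral>\<^sup>+x. liminf (\<lambda>n. ennreal (F n x)) \<partial>std_gauss_measure)"
    using F_lim by (intro nn_integral_cong lim_imp_Liminf[symmetric] tendsto_ennrealI) auto
  also have "\<dots> \<le> liminf (\<lambda>n. \<integral>\<^sup>+x. ennreal (F n x) \<partial>std_gauss_measure)"
    by (rule nn_integral_liminf) measurable
  also have "\<dots> \<le> liminf (\<lambda>n::nat. ennreal ?R)"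
  proof (intro Liminf_mono always_eventually allI)
    fix n
    have "integrable std_gauss_measure (F n)"
      unfolding F_def[abs_def] using iabs ineq[OF e] by simp
    moreover have "(\<integral>x. F n x \<partial>std_gauss_measure) \<le> ?R"
      unfolding F_def using iabs ineq[OF e[of n]] by simp
    ultimately show "(\<integral>\<^sup>+x. ennreal (F n x) \<partial>std_gauss_measure) \<le> ennreal ?R"
      using F0 by (subst nn_integral_eq_integral) (auto intro: ennreal_leI)
  qed
  also have "\<dots> = ennreal ?R" by (simp add: Liminf_const)
  finally show ?thesis .
qed

text \<open>Dividing by the mass \<open>m\<close> reduces this to unit mass, and the result is homogeneous of degree
one: no power of \<open>m\<close> is left over, so the estimate can be integrated over lines of different mass.\<close>

lemma lsi_stability_line:
  fixes w g :: "real \<Rightarrow> real"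
  defines "m \<equiv> (\<integral>x. (w x)\<^sup>2 \<partial>std_gauss_measure)"
  assumes ac: "ac_deriv w g"
    and w1: "integrable std_gauss_measure (\<lambda>x. (w x)\<^sup>2)"
    and wx: "has_bochner_integral std_gauss_measure (\<lambda>x. x * (w x)\<^sup>2) 0"
    and wxx: "(\<integral>\<^sup>+x. ennreal (x\<^sup>2 * (w x)\<^sup>2) \<partial>std_gauss_measure) \<le> ennreal M" and M: "M \<ge> 0"
    and g: "integrable std_gauss_measure (\<lambda>x. (g x)\<^sup>2)" and \<eta>: "\<eta> > 0"
  shows "(\<integral>\<^sup>+x. ennreal (\<bar>(w x)\<^sup>2 - m\<bar> + 100 / \<eta> ^ 3 * (m * ent_fun ((w x)\<^sup>2 / m))) \<partial>std_gauss_measure)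
     \<le> ennreal (100 * (\<eta> * (2 * m + M) + (\<integral>x. (2 * w x * g x)\<^sup>2 / (w x)\<^sup>2 \<partial>std_gauss_measure) / 2 / \<eta> ^ 3))"
proof -
  have [measurable]: "g \<in> borel_measurable borel" by (rule ac_deriv_measurable[OF ac])
  have [measurable]: "w \<in> borel_measurable borel"
    by (intro borel_measurable_continuous_onI ac_deriv_continuous[OF ac])
  have m0: "0 \<le> m" unfolding m_def by simp
  define I where "I = (\<integral>x. (2 * w x * g x)\<^sup>2 / (w x)\<^sup>2 \<partial>std_gauss_measure)"
  have wxx': "integrable std_gauss_measure (\<lambda>x. x\<^sup>2 * (w x)\<^sup>2)"
    using wxx by (intro integrableI_nonneg) (auto simp: order_le_less_trans)
  then have wxx_le: "(\<integral>x. x\<^sup>2 * (w x)\<^sup>2 \<partial>std_gauss_measure) \<le> M"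
    using wxx M by (intro nn_le_imp_integral_le) auto
  show ?thesis
  proof (cases "m = 0")
    case True
    then have ae: "AE x in std_gauss_measure. (w x)\<^sup>2 = 0"
      using w1 by (subst (asm) m_def, subst (asm) integral_nonneg_eq_0_iff_AE) auto
    have "(\<integral>\<^sup>+x. ennreal (\<bar>(w x)\<^sup>2 - m\<bar> + 100 / \<eta> ^ 3 * (m * ent_fun ((w x)\<^sup>2 / m))) \<partial>std_gauss_measure) = (\<integral>\<^sup>+x. 0 \<partial>std_gauss_measure)"
      by (rule nn_integral_cong_AE) (rule AE_mp[OF ae], rule AE_I2, simp add: True)
    then show ?thesis by simp
  next
    case False
    then have m: "m > 0" using m0 by simp
    define c where "c = 1 / sqrt m"
    have c2: "c\<^sup>2 = 1 / m" and c0: "c \<noteq> 0" using m by (auto simp: c_def power_divide)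
    have cw: "(c * w x)\<^sup>2 = (w x)\<^sup>2 / m" "(c * g x)\<^sup>2 = (g x)\<^sup>2 / m" for x
      using c2 by (simp_all add: power_mult_distrib)
    have fi: "(2 * (c * w x) * (c * g x))\<^sup>2 / (c * w x)\<^sup>2 = (2 * w x * g x)\<^sup>2 / (w x)\<^sup>2 / m" for x
    proof -
      have "(2 * (c * w x) * (c * g x))\<^sup>2 / (c * w x)\<^sup>2 = c\<^sup>2 * ((2 * w x * g x)\<^sup>2 / (w x)\<^sup>2)"
        using c0 by (simp add: power_mult_distrib power2_eq_square)
      then show ?thesis using c2 by simp
    qed
    have "(\<integral>\<^sup>+x. ennreal (\<bar>(c * w x)\<^sup>2 - 1\<bar> + 100 / \<eta> ^ 3 * ent_fun ((c * w x)\<^sup>2)) \<partial>std_gauss_measure)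
     \<le> ennreal (100 * (\<eta> * (2 + M / m) + (\<integral>x. (2 * (c * w x) * (c * g x))\<^sup>2 / (c * w x)\<^sup>2 \<partial>std_gauss_measure) / 2 / \<eta> ^ 3))"
    proof (rule lsi_stability_unit_mass)
      show "ac_deriv (\<lambda>x. c * w x) (\<lambda>x. c * g x)" by (rule ac_deriv_cmult[OF ac])
      show "has_bochner_integral std_gauss_measure (\<lambda>x. x * (c * w x)\<^sup>2) 0"
        unfolding cw using wx by (simp add: has_bochner_integral_iff)
      show "(\<integral>x. x\<^sup>2 * (c * w x)\<^sup>2 \<partial>std_gauss_measure) \<le> M / m"
        unfolding cw using wxx_le m by (simp add: divide_right_mono)
    qed (use w1 wxx' g \<eta> m in \<open>simp_all add: cw m_def[symmetric]\<close>)
    moreover have "(\<integral>x. (2 * w x * g x)\<^sup>2 / (w x)\<^sup>2 / m \<partial>std_gauss_measure) = I / m"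
      unfolding I_def by (rule integral_divide_zero)
    ultimately have *: "(\<integral>\<^sup>+x. ennreal (\<bar>(w x)\<^sup>2 / m - 1\<bar> + 100 / \<eta> ^ 3 * ent_fun ((w x)\<^sup>2 / m)) \<partial>std_gauss_measure)
     \<le> ennreal (100 * (\<eta> * (2 + M / m) + I / m / 2 / \<eta> ^ 3))"
      unfolding fi unfolding cw by (simp only:)
    have "(\<integral>\<^sup>+x. ennreal (\<bar>(w x)\<^sup>2 - m\<bar> + 100 / \<eta> ^ 3 * (m * ent_fun ((w x)\<^sup>2 / m))) \<partial>std_gauss_measure)
      = (\<integral>\<^sup>+x. ennreal m * ennreal (\<bar>(w x)\<^sup>2 / m - 1\<bar> + 100 / \<eta> ^ 3 * ent_fun ((w x)\<^sup>2 / m)) \<partial>std_gauss_measure)"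
    proof (rule nn_integral_cong)
      fix x
      have "(w x)\<^sup>2 - m = m * ((w x)\<^sup>2 / m - 1)" using m by (simp add: field_simps)
      then have "\<bar>(w x)\<^sup>2 - m\<bar> = m * \<bar>(w x)\<^sup>2 / m - 1\<bar>" using m by (simp add: abs_mult)
      then have "\<bar>(w x)\<^sup>2 - m\<bar> + 100 / \<eta> ^ 3 * (m * ent_fun ((w x)\<^sup>2 / m)) = m * (\<bar>(w x)\<^sup>2 / m - 1\<bar> + 100 / \<eta> ^ 3 * ent_fun ((w x)\<^sup>2 / m))"
        by (simp add: distrib_left)
      then show "ennreal (\<bar>(w x)\<^sup>2 - m\<bar> + 100 / \<eta> ^ 3 * (m * ent_fun ((w x)\<^sup>2 / m))) =
        ennreal m * ennreal (\<bar>(w x)\<^sup>2 / m - 1\<bar> + 100 / \<eta> ^ 3 * ent_fun ((w x)\<^sup>2 / m))"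
        using m \<eta> by (simp add: ennreal_mult' )
    qed
    also have "\<dots> \<le> ennreal m * ennreal (100 * (\<eta> * (2 + M / m) + I / m / 2 / \<eta> ^ 3))"
      using * unfolding ent_fun_def by (subst nn_integral_cmult) (auto intro: mult_left_mono)
    also have "\<dots> = ennreal (m * (100 * (\<eta> * (2 + M / m) + I / m / 2 / \<eta> ^ 3)))"
      using m0 by (simp add: ennreal_mult')
    also have "m * (100 * (\<eta> * (2 + M / m) + I / m / 2 / \<eta> ^ 3)) = 100 * (\<eta> * (2 * m + M) + I / 2 / \<eta> ^ 3)"
      using m by (simp add: field_simps)
    finally show ?thesis by (simp add: I_def)
  qed
qed

section \<open>Test functions and the fundamental lemma\<close>

text \<open>This class of functions, flat at the origin, is closed under differentiation. Hence all orders
of differentiability are obtained by one induction over an arbitrary \<open>q\<close>.\<close>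

definition flat_exp :: "real poly \<Rightarrow> real \<Rightarrow> real" where
  "flat_exp q t = (if t > 0 then poly q (1 / t) * exp (- (1 / t)) else 0)"

lemma poly_exp_decay: "((\<lambda>y::real. poly q y * exp (- y)) \<longlongrightarrow> 0) at_top"
proof -
  have "((\<lambda>y. \<Sum>i\<le>degree q. coeff q i * (y ^ i / exp y)) \<longlongrightarrow> (\<Sum>i\<le>degree q. coeff q i * 0)) at_top"
    by (intro tendsto_sum tendsto_mult tendsto_const tendsto_power_div_exp_0)
  then show ?thesis
    by (simp add: poly_altdef sum_distrib_right exp_minus divide_inverse mult.assoc)
qed

text \<open>At the origin the difference quotient is again of the form polynomial times exponential in
\<open>1 / t\<close>, and therefore tends to 0.\<close>

lemma flat_exp_deriv:
  "(flat_exp q has_real_derivative flat_exp ([:0, 0, 1:] * (q - pderiv q)) t) (at t)"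
proof -
  consider "t > 0" | "t < 0" | "t = 0" by linarith
  then show ?thesis
  proof cases
    case 1
    have "((\<lambda>t. poly q (1 / t) * exp (- (1 / t))) has_real_derivative
       poly ([:0, 0, 1:] * (q - pderiv q)) (1/t) * exp (- (1 / t))) (at t)"
      using 1 by (auto intro!: derivative_eq_intros poly_DERIV[THEN DERIV_chain2]
        simp: power2_eq_square field_simps)
    moreover have "\<forall>\<^sub>F y in nhds t. poly q (1 / y) * exp (- (1 / y)) = flat_exp q y"
    proof -
      have "\<forall>\<^sub>F y in nhds t. y \<in> {0<..}" using 1 by (intro eventually_nhds_in_open) auto
      then show ?thesis by eventually_elim (simp add: flat_exp_def)
    qed
    ultimately show ?thesis using 1
      by (subst (asm) DERIV_cong_ev) (auto simp: flat_exp_def)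
  next
    case 2
    have "((\<lambda>t. 0) has_real_derivative 0) (at t)" by simp
    moreover have "\<forall>\<^sub>F y in nhds t. 0 = flat_exp q y"
    proof -
      have "\<forall>\<^sub>F y in nhds t. y \<in> {..<0}" using 2 by (intro eventually_nhds_in_open) auto
      then show ?thesis by eventually_elim (simp add: flat_exp_def)
    qed
    ultimately have "(flat_exp q has_real_derivative 0) (at t)"
      by (subst (asm) DERIV_cong_ev) auto
    then show ?thesis using 2 by (simp add: flat_exp_def)
  next
    case 3
    have "((\<lambda>h. flat_exp q h / h) \<longlongrightarrow> 0) (at 0)"
    proof (rule filterlim_split_at)
      have "\<forall>\<^sub>F h in at_left 0. h < (0::real)" by (simp add: eventually_at_left_field) (metis lt_ex)
      then have "\<forall>\<^sub>F h in at_left 0. 0 = flat_exp q h / h"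
        by eventually_elim (simp add: flat_exp_def)
      then show "((\<lambda>h. flat_exp q h / h) \<longlongrightarrow> 0) (at_left 0)"
        using tendsto_const Lim_transform_eventually by fast
      have "((\<lambda>h. poly ([:0, 1:] * q) (inverse h) * exp (- inverse h)) \<longlongrightarrow> 0) (at_right (0::real))"
        using filterlim_compose[OF poly_exp_decay filterlim_inverse_at_top_right] .
      moreover have "\<forall>\<^sub>F h in at_right 0. h > (0::real)" by (simp add: eventually_at_right_less)
      then have "\<forall>\<^sub>F h in at_right 0. poly ([:0, 1:] * q) (inverse h) * exp (- inverse h) = flat_exp q h / h"
        by eventually_elim (simp add: flat_exp_def field_simps)
      ultimately show "((\<lambda>h. flat_exp q h / h) \<longlongrightarrow> 0) (at_right 0)"
        by (rule Lim_transform_eventually)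
    qed
    then show ?thesis using 3 by (simp add: has_field_derivative_iff flat_exp_def)
  qed
qed

lemma flat_exp_continuous: "continuous_on A (flat_exp q)"
  by (auto intro!: continuous_at_imp_continuous_on DERIV_isCont[OF flat_exp_deriv])

lemma GDERIV_imp_continuous:
  assumes "\<And>x. GDERIV f x :> D x"
  shows "continuous_on UNIV f"
  using assms by (auto simp: gderiv_def intro!: continuous_at_imp_continuous_on has_derivative_continuous)

lemma Ck_zero: "Ck k (\<lambda>x. 0)"
proof (induction k)
  case (Suc k)
  have "\<forall>x. GDERIV (\<lambda>x. 0) x :> 0" by (simp add: GDERIV_const)
  then show ?case using Suc by (auto intro!: exI[of _ "\<lambda>x. 0"])
qed simp

lemma Ck_const: "Ck k (\<lambda>x. c)"
proof (cases k)
  case (Suc j)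
  have "\<forall>x. GDERIV (\<lambda>x. c) x :> 0" by (simp add: GDERIV_const)
  then show ?thesis using Ck_zero by (auto simp: Suc intro!: exI[of _ "\<lambda>x. 0"])
qed simp

lemma Ck_add:
  assumes "Ck k f" "Ck k g"
  shows "Ck k (\<lambda>x. f x + g x)"
  using assms
proof (induction k arbitrary: f g)
  case 0
  then show ?case by (auto intro: continuous_intros)
next
  case (Suc k)
  then obtain D D' where D: "\<forall>x. GDERIV f x :> D x" "\<forall>b\<in>Basis. Ck k (\<lambda>x. D x \<bullet> b)"
    and D': "\<forall>x. GDERIV g x :> D' x" "\<forall>b\<in>Basis. Ck k (\<lambda>x. D' x \<bullet> b)" by auto
  have "\<forall>x. GDERIV (\<lambda>x. f x + g x) x :> (D x + D' x)"
    using D D' GDERIV_add by blast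
  moreover have "\<forall>b\<in>Basis. Ck k (\<lambda>x. (D x + D' x) \<bullet> b)"
    using D D' Suc.IH by (simp add: inner_add_left)
  ultimately show ?case unfolding Ck.simps by (intro exI[of _ "\<lambda>x. D x + D' x"]) simp
qed

lemma Ck_SucD: "Ck (Suc k) f \<Longrightarrow> Ck k f"
proof (induction k arbitrary: f)
  case 0
  then show ?case using GDERIV_imp_continuous by fastforce
next
  case (Suc k)
  then obtain D where D: "\<forall>x. GDERIV f x :> D x" "\<forall>b\<in>Basis. Ck (Suc k) (\<lambda>x. D x \<bullet> b)"
    unfolding Ck.simps(2)[of "Suc k"] by blast
  then have "\<forall>b\<in>Basis. Ck k (\<lambda>x. D x \<bullet> b)" using Suc.IH by blast
  with D show ?case unfolding Ck.simps(2) by blast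
qed

lemma Ck_mult:
  assumes "Ck k f" "Ck k g"
  shows "Ck k (\<lambda>x. f x * g x)"
  using assms
proof (induction k arbitrary: f g)
  case 0
  then show ?case by (auto intro: continuous_intros)
next
  case (Suc k)
  then obtain D D' where D: "\<forall>x. GDERIV f x :> D x" "\<forall>b\<in>Basis. Ck k (\<lambda>x. D x \<bullet> b)"
    and D': "\<forall>x. GDERIV g x :> D' x" "\<forall>b\<in>Basis. Ck k (\<lambda>x. D' x \<bullet> b)" by auto
  have "\<forall>x. GDERIV (\<lambda>x. f x * g x) x :> (f x *\<^sub>R D' x + g x *\<^sub>R D x)"
    using D(1) D'(1) GDERIV_mult by blast
  moreover have "Ck k f" "Ck k g" using Suc.prems Ck_SucD by auto
  then have "\<forall>b\<in>Basis. Ck k (\<lambda>x. (f x *\<^sub>R D' x + g x *\<^sub>R D x) \<bullet> b)"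
    using D D' Suc.IH by (auto simp: inner_add_left intro!: Ck_add)
  ultimately show ?case unfolding Ck.simps by (intro exI[of _ "\<lambda>x. f x *\<^sub>R D' x + g x *\<^sub>R D x"]) simp
qed

lemma Ck_prod:
  "finite I \<Longrightarrow> (\<And>i. i \<in> I \<Longrightarrow> Ck k (f i)) \<Longrightarrow> Ck k (\<lambda>x. \<Prod>i\<in>I. f i x)"
  by (induction I rule: finite_induct) (auto intro: Ck_const Ck_mult)

lemma Ck_flat_exp: "Ck k (\<lambda>x. flat_exp q (c * (x \<bullet> b) + d))"
proof (induction k arbitrary: q)
  case 0
  show ?case
    by (auto intro!: continuous_intros continuous_on_compose2[OF flat_exp_continuous[of UNIV]])
next
  case (Suc k)
  let ?D = "\<lambda>x. flat_exp ([:0, 0, 1:] * (q - pderiv q)) (c * (x \<bullet> b) + d) *\<^sub>R (c *\<^sub>R b)"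
  have "GDERIV (\<lambda>x. c * (x \<bullet> b) + d) x :> (c *\<^sub>R b)" for x
    unfolding gderiv_def by (auto intro!: derivative_eq_intros simp: inner_commute)
  from GDERIV_DERIV_compose[OF this flat_exp_deriv]
  have "\<forall>x. GDERIV (\<lambda>x. flat_exp q (c * (x \<bullet> b) + d)) x :> ?D x" by blast
  moreover have "\<forall>b'\<in>Basis. Ck k (\<lambda>x. ?D x \<bullet> b')"
    using Suc.IH by (auto intro!: Ck_mult Ck_const)
  ultimately show ?case unfolding Ck.simps by (intro exI[of _ ?D]) simp
qed

text \<open>For fixed argument, \<open>flat_exp 1 (real (Suc k) * t)\<close> tends to 1 for \<open>t > 0\<close> and vanishes for
\<open>t \<le> 0\<close>. The product over both faces in every direction thus tends to the indicator of the open box.\<close>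

definition box_bump :: "'a::euclidean_space \<Rightarrow> 'a \<Rightarrow> nat \<Rightarrow> 'a \<Rightarrow> real" where
  "box_bump l u k x = (\<Prod>b\<in>Basis. flat_exp 1 (real (Suc k) * (x \<bullet> b) + - real (Suc k) * (l \<bullet> b)) *
      flat_exp 1 (- real (Suc k) * (x \<bullet> b) + real (Suc k) * (u \<bullet> b)))"

lemma flat_exp_1_bounds: "0 \<le> flat_exp 1 t" "flat_exp 1 t \<le> 1"
  by (auto simp: flat_exp_def)

lemma box_bump_bounds: "0 \<le> box_bump l u k x" "box_bump l u k x \<le> 1"
  unfolding box_bump_def using flat_exp_1_bounds
  by (auto intro!: prod_nonneg prod_le_1 mult_le_one mult_nonneg_nonneg)

lemma box_bump_zero: "x \<notin> box l u \<Longrightarrow> box_bump l u k x = 0"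
proof -
  assume "x \<notin> box l u"
  then obtain b where b: "b \<in> Basis" "\<not> (l \<bullet> b < x \<bullet> b \<and> x \<bullet> b < u \<bullet> b)" by (auto simp: mem_box)
  then have "flat_exp 1 (real (Suc k) * (x \<bullet> b) + - real (Suc k) * (l \<bullet> b)) *
      flat_exp 1 (- real (Suc k) * (x \<bullet> b) + real (Suc k) * (u \<bullet> b)) = 0"
    by (auto simp: flat_exp_def zero_less_mult_iff simp flip: right_diff_distrib simp del: of_nat_Suc)
  then show ?thesis unfolding box_bump_def using b(1) by (intro prod_zero) auto
qed

lemma flat_exp_1_limit: "t > 0 \<Longrightarrow> (\<lambda>k. flat_exp 1 (real (Suc k) * t)) \<longlonglongrightarrow> 1"
proof -
  assume "t > 0"
  then have "(\<lambda>k. exp (- (1 / t * (1 / real (Suc k))))) \<longlonglongrightarrow> exp (- (1 / t * 0))"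
    by (intro tendsto_exp tendsto_minus tendsto_mult tendsto_const) (rule lim_1_over_n[THEN LIMSEQ_Suc])
  moreover have "flat_exp 1 (real (Suc k) * t) = exp (- (1 / t * (1 / real (Suc k))))" for k
    using \<open>t > 0\<close> by (simp add: flat_exp_def del: of_nat_Suc)
  ultimately show ?thesis by simp
qed

lemma box_bump_limit: "(\<lambda>k. box_bump l u k x) \<longlonglongrightarrow> indicator (box l u) x"
proof (cases "x \<in> box l u")
  case True
  have "(\<lambda>k. box_bump l u k x) \<longlonglongrightarrow> (\<Prod>b\<in>(Basis::'a set). 1 * 1)"
    unfolding box_bump_def
  proof (intro tendsto_prod tendsto_mult)
    fix b :: 'a assume "b \<in> Basis"
    then have "x \<bullet> b - l \<bullet> b > 0" "u \<bullet> b - x \<bullet> b > 0" using True by (auto simp: mem_box)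
    from this[THEN flat_exp_1_limit]
    show "(\<lambda>k. flat_exp 1 (real (Suc k) * (x \<bullet> b) + - real (Suc k) * (l \<bullet> b))) \<longlonglongrightarrow> 1"
      "(\<lambda>k. flat_exp 1 (- real (Suc k) * (x \<bullet> b) + real (Suc k) * (u \<bullet> b))) \<longlonglongrightarrow> 1"
      by (simp_all add: right_diff_distrib algebra_simps)
  qed
  then show ?thesis using True by simp
qed (simp add: box_bump_zero)

lemma test_function_box_bump: "test_function (box_bump l u k)"
proof -
  have "Ck m (box_bump l u k)" for m
    unfolding box_bump_def by (intro Ck_prod Ck_mult Ck_flat_exp) auto
  moreover have "{x. box_bump l u k x \<noteq> 0} \<subseteq> cbox l u"
    using box_bump_zero box_subset_cbox by blast
  then have "closure {x. box_bump l u k x \<noteq> 0} \<subseteq> cbox l u" by (rule closure_minimal[OF _ closed_cbox])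
  then have "compact (closure {x. box_bump l u k x \<noteq> 0})"
    by (metis bounded_cbox bounded_subset compact_eq_bounded_closed closed_closure)
  ultimately show ?thesis unfolding test_function_def by auto
qed

lemma locally_integrable_inner:
  assumes "locally_integrable g"
  shows "locally_integrable (\<lambda>x. g x \<bullet> b)"
proof -
  have "integrable lborel (\<lambda>x. indicator K x *\<^sub>R (g x \<bullet> b))" if "compact K" for K
  proof -
    have "integrable lborel (\<lambda>x. (indicator K x *\<^sub>R g x) \<bullet> b)"
      using assms that unfolding locally_integrable_def set_integrable_def by (intro integrable_inner_left) auto
    then show ?thesis by simp
  qed
  moreover have "(\<lambda>x. g x \<bullet> b) \<in> borel_measurable borel"
    using assms unfolding locally_integrable_def by auto
  ultimately show ?thesis unfolding locally_integrable_def set_integrable_def by blast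
qed

lemma locally_integrable_measurable: "locally_integrable g \<Longrightarrow> g \<in> borel_measurable borel"
  by (simp add: locally_integrable_def)

lemma set_integrable_box:
  fixes g :: "'a::euclidean_space \<Rightarrow> real"
  assumes "locally_integrable g" shows "set_integrable lborel (box l u) g"
proof -
  have "set_integrable lborel (cbox l u) g" using assms by (auto simp: locally_integrable_def)
  then show ?thesis by (rule set_integrable_subset) (auto simp: box_subset_cbox)
qed

text \<open>On a large box the positive and the negative part of \<open>g\<close> are densities of finite measures.
By assumption these agree on all boxes, an intersection-stable generator.\<close>

lemma AE_zero_of_box_integrals:
  fixes g :: "'a::euclidean_space \<Rightarrow> real"
  assumes g: "locally_integrable g" and z: "\<And>l u. (LINT x:box l u|lborel. g x) = 0"
  shows "AE x in lborel. g x = 0"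
proof -
  have [measurable]: "g \<in> borel_measurable borel" using g by (rule locally_integrable_measurable)
  define P where "P n = density lborel (\<lambda>x. ennreal (max 0 (g x)) * indicator (box (- (real n *\<^sub>R One)) (real n *\<^sub>R One)) x)" for n :: nat
  define Q where "Q n = density lborel (\<lambda>x. ennreal (max 0 (- g x)) * indicator (box (- (real n *\<^sub>R One)) (real n *\<^sub>R One)) x)" for n :: nat
  have val: "emeasure (P n) (box l u) = emeasure (Q n) (box l u) \<and> emeasure (P n) (box l u) \<noteq> \<infinity>" for n l u
  proof -
    obtain l' u' where lu: "box (- (real n *\<^sub>R One)) (real n *\<^sub>R One) \<inter> box l u = (box l' u' :: 'a set)"
      by (rule that, rule box_Int_box)
    have i: "integrable lborel (\<lambda>x. indicator (box l' u') x *\<^sub>R g x)"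
      using set_integrable_box[OF g] by (simp add: set_integrable_def)
    have "emeasure (P n) (box l u) = (\<integral>\<^sup>+x. ennreal (indicator (box l' u') x *\<^sub>R g x) \<partial>lborel)"
      unfolding P_def lu[symmetric]
      by (subst emeasure_density) (auto intro!: nn_integral_cong split: split_indicator simp: ennreal_max_0 max.commute)
    moreover have "emeasure (Q n) (box l u) = (\<integral>\<^sup>+x. ennreal (- (indicator (box l' u') x *\<^sub>R g x)) \<partial>lborel)"
      unfolding Q_def lu[symmetric]
      by (subst emeasure_density) (auto intro!: nn_integral_cong split: split_indicator simp: ennreal_max_0 max.commute)
    moreover have "(\<integral>x. indicator (box l' u') x *\<^sub>R g x \<partial>lborel) = 0"
      using z by (simp add: set_lebesgue_integral_def)
    moreover define A B where "A = (\<integral>\<^sup>+x. ennreal (indicator (box l' u') x *\<^sub>R g x) \<partial>lborel)"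
      and "B = (\<integral>\<^sup>+x. ennreal (- (indicator (box l' u') x *\<^sub>R g x)) \<partial>lborel)"
    moreover have fin: "A \<noteq> \<infinity>" "B \<noteq> \<infinity>"
      using i unfolding A_def B_def real_integrable_def by auto
    ultimately have "enn2real A = enn2real B"
      using real_lebesgue_integral_def[OF i] by simp
    with fin have "A = B"
      by (metis ennreal_enn2real_if infinity_ennreal_def)
    then show ?thesis
      using fin \<open>emeasure (P n) (box l u) = _\<close> \<open>emeasure (Q n) (box l u) = _\<close>
      unfolding A_def B_def by simp
  qed
  have PQ: "P n = Q n" for n
  proof (rule measure_eqI_generator_eq)
    let ?E = "range (\<lambda>(a, b). box a b::'a set)"
    show "Int_stable ?E" by (auto simp: Int_stable_def box_Int_box)
    show "?E \<subseteq> Pow UNIV" "sets (P n) = sigma_sets UNIV ?E" "sets (Q n) = sigma_sets UNIV ?E"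
      by (simp_all add: borel_eq_box P_def Q_def)
    let ?A = "\<lambda>n::nat. box (- (real n *\<^sub>R One)) (real n *\<^sub>R One) :: 'a set"
    show "range ?A \<subseteq> ?E" "(\<Union>i. ?A i) = UNIV" unfolding UN_box_eq_UNIV by auto
    show "emeasure (P n) (?A i) \<noteq> \<infinity>" for i by (rule conjunct2[OF val])
    show "emeasure (P n) X = emeasure (Q n) X" if "X \<in> ?E" for X using that val by auto
  qed
  have "AE x in lborel. \<forall>n. ennreal (max 0 (g x)) * indicator (box (- (real n *\<^sub>R One)) (real n *\<^sub>R One)) x =
     ennreal (max 0 (- g x)) * indicator (box (- (real n *\<^sub>R One)) (real n *\<^sub>R One)) x"
    unfolding AE_all_countable
  proof
    fix n
    show "AE x in lborel. ennreal (max 0 (g x)) * indicator (box (- (real n *\<^sub>R One)) (real n *\<^sub>R One)) x =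
     ennreal (max 0 (- g x)) * indicator (box (- (real n *\<^sub>R One)) (real n *\<^sub>R One)) x"
      by (subst sigma_finite_measure.density_unique_iff[OF lborel.sigma_finite_measure_axioms, symmetric])
        (use PQ[of n] in \<open>auto simp: P_def Q_def\<close>)
  qed
  then show ?thesis
  proof eventually_elim
    case (elim x)
    obtain n :: nat where n: "x \<in> box (- (real n *\<^sub>R One)) (real n *\<^sub>R One)"
      using UN_box_eq_UNIV by blast
    from elim[rule_format, of n] n show ?case
      by (auto simp: max_def ennreal_eq_0_iff split: if_splits)
  qed
qed

text \<open>Bumps converge boundedly to indicators of boxes.\<close>

lemma fundamental_lemma:
  fixes g :: "'a::euclidean_space \<Rightarrow> real"
  assumes g: "locally_integrable g" and z: "\<And>\<phi>. test_function \<phi> \<Longrightarrow> (\<integral>x. \<phi> x * g x \<partial>lborel) = 0"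
  shows "AE x in lborel. g x = 0"
proof (rule AE_zero_of_box_integrals[OF g])
  fix l u :: 'a
  have [measurable]: "g \<in> borel_measurable borel" using g by (rule locally_integrable_measurable)
  have [measurable]: "box_bump l u k \<in> borel_measurable borel" for k
  proof -
    have "Ck 0 (box_bump l u k)" using test_function_box_bump unfolding test_function_def by blast
    then show ?thesis by (simp add: borel_measurable_continuous_onI)
  qed
  have "(\<lambda>k. \<integral>x. box_bump l u k x * g x \<partial>lborel) \<longlonglongrightarrow> (\<integral>x. indicator (box l u) x * g x \<partial>lborel)"
  proof (rule integral_dominated_convergence[where w="\<lambda>x. norm (indicator (box l u) x *\<^sub>R g x)"])
    show "integrable lborel (\<lambda>x. norm (indicator (box l u) x *\<^sub>R g x))"
      using set_integrable_box[OF g, of l u] unfolding set_integrable_def by (rule integrable_norm)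
    show "AE x in lborel. (\<lambda>k. box_bump l u k x * g x) \<longlonglongrightarrow> indicator (box l u) x * g x"
      by (intro AE_I2 tendsto_mult box_bump_limit tendsto_const)
    show "AE x in lborel. norm (box_bump l u k x * g x) \<le> norm (indicator (box l u) x *\<^sub>R g x)" for k
    proof (rule AE_I2)
      fix x
      show "norm (box_bump l u k x * g x) \<le> norm (indicator (box l u) x *\<^sub>R g x)"
        using box_bump_bounds[of l u k x] box_bump_zero[of x l u k]
        by (cases "x \<in> box l u") (auto simp: abs_mult mult_left_le_one_le)
    qed
  qed measurable
  then have "(\<lambda>k. 0::real) \<longlonglongrightarrow> (\<integral>x. indicator (box l u) x * g x \<partial>lborel)"
    using z[OF test_function_box_bump] by simp
  then show "(LINT x:box l u|lborel. g x) = 0"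
    by (simp add: set_lebesgue_integral_def LIMSEQ_const_iff)
qed

section \<open>The Gaussian measure and slicing along a coordinate\<close>

lemma subst_coord_nth: "subst_coord x i t $ j = (if j = i then t else x $ j)"
  by (simp add: subst_coord_def)

lemma subst_coord_subst_coord [simp]: "subst_coord (subst_coord x i s) i t = subst_coord x i t"
  by (simp add: subst_coord_def vec_eq_iff)

lemma subst_coord_commute:
  "i \<noteq> j \<Longrightarrow> subst_coord (subst_coord x i s) j t = subst_coord (subst_coord x j t) i s"
  by (auto simp: subst_coord_def vec_eq_iff)

lemma subst_coord_eq_shift: "subst_coord x i t = x + (t - x $ i) *\<^sub>R axis i 1"
  by (simp add: subst_coord_def vec_eq_iff axis_def)

lemma measurable_subst_coord [measurable]:
  "(\<lambda>(x :: real ^ 'n, t). subst_coord x i t) \<in> borel_measurable (borel \<Otimes>\<^sub>M borel)"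
proof -
  have "(\<lambda>x :: real ^ 'n. x $ i) \<in> borel_measurable borel"
    by (intro borel_measurable_continuous_onI continuous_intros)
  then show ?thesis unfolding subst_coord_eq_shift by measurable
qed

lemma measurable_subst_coord_lborel [measurable]:
  "(\<lambda>(x :: real ^ 'n, t). subst_coord x i t) \<in> borel_measurable (lborel \<Otimes>\<^sub>M lborel)"
  "(\<lambda>(x :: real ^ 'n, t). subst_coord x i t) \<in> borel_measurable (gauss \<Otimes>\<^sub>M gauss)"
  using measurable_subst_coord by (simp_all add: gauss_def cong: measurable_cong_sets sets_pair_measure_cong)

lemma measurable_subst_coord_slice [measurable]:
  "(\<lambda>t. subst_coord (x :: real ^ 'n) i t) \<in> borel_measurable borel"
  using measurable_compose[OF measurable_Pair1' measurable_subst_coord, of x] by simp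

lemma measurable_slice_integral:
  fixes F :: "real ^ 'n::finite \<Rightarrow> ennreal"
  assumes F[measurable]: "F \<in> borel_measurable borel" and M: "sigma_finite_measure M" "sets M = sets borel"
  shows "(\<lambda>x. \<integral>\<^sup>+t. F (subst_coord x i t) \<partial>M) \<in> borel_measurable borel"
proof -
  have "(\<lambda>(x, t). F (subst_coord x i t)) \<in> borel_measurable (borel \<Otimes>\<^sub>M borel)" by measurable
  then have "(\<lambda>(x, t). F (subst_coord x i t)) \<in> borel_measurable (borel \<Otimes>\<^sub>M M)"
    by (subst measurable_cong_sets[OF sets_pair_measure_cong[OF refl M(2)] refl])
  from sigma_finite_measure.borel_measurable_nn_integral_fst[OF M(1) this] show ?thesis by simp
qed

lemma open_unit_slab_measurable [measurable]: "{x :: real ^ 'n::finite. 0 < x $ i \<and> x $ i < 1} \<in> sets borel"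
proof -
  have "open {x :: real ^ 'n. 0 < x $ i \<and> x $ i < 1}"
    by (intro open_Collect_conj open_Collect_less continuous_intros)
  then show ?thesis by simp
qed

lemma emeasure_distr_eq_nn_integral:
  assumes "T \<in> M \<rightarrow>\<^sub>M borel" "B \<in> sets borel"
  shows "emeasure (distr M borel T) B = (\<integral>\<^sup>+z. indicator B (T z) \<partial>M)"
proof -
  have "(\<integral>\<^sup>+y. indicator B y \<partial>distr M borel T) = (\<integral>\<^sup>+z. indicator B (T z) \<partial>M)"
    using assms by (intro nn_integral_distr) auto
  then show ?thesis using assms by simp
qed

text \<open>Fubini for one coordinate without leaving \<open>real ^ 'n\<close>: the \<open>i\<close>-th coordinate of the base
point is overwritten anyway, so it is confined to the unit interval in order to carry total weight 1.\<close>

lemma lborel_slicing_measure: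
  fixes i :: "'n::finite"
  defines "Q \<equiv> density lborel (indicator {x :: real ^ 'n. 0 < x $ i \<and> x $ i < 1})"
  shows "lborel = distr (Q \<Otimes>\<^sub>M lborel) borel (\<lambda>(x, t). subst_coord x i t)"
proof (rule lborel_eqI)
  fix l u :: "real ^ 'n"
  assume lu: "\<And>b. b \<in> Basis \<Longrightarrow> l \<bullet> b \<le> u \<bullet> b"
  have lu': "l $ j \<le> u $ j" for j using lu[of "axis j 1"] by (simp add: inner_axis)
  have m: "(\<lambda>(x, t). subst_coord x i t) \<in> borel_measurable (Q \<Otimes>\<^sub>M lborel)"
    using measurable_subst_coord by (simp add: Q_def cong: measurable_cong_sets sets_pair_measure_cong)
  have "emeasure (distr (Q \<Otimes>\<^sub>M lborel) borel (\<lambda>(x, t). subst_coord x i t)) (box l u)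
    = (\<integral>\<^sup>+z. indicator (box l u) (case z of (x, t) \<Rightarrow> subst_coord x i t) \<partial>(Q \<Otimes>\<^sub>M lborel))"
    by (rule emeasure_distr_eq_nn_integral[OF m]) simp
  also have "\<dots> = (\<integral>\<^sup>+x. \<integral>\<^sup>+t. indicator (box l u) (subst_coord x i t) \<partial>lborel \<partial>Q)"
    using m by (subst lborel.nn_integral_fst[symmetric]) simp_all
  also have "\<dots> = (\<integral>\<^sup>+x. indicator {x. 0 < x $ i \<and> x $ i < 1} x * (\<integral>\<^sup>+t. indicator (box l u) (subst_coord x i t) \<partial>lborel) \<partial>lborel)"
    unfolding Q_def
    by (intro nn_integral_density measurable_slice_integral borel_measurable_indicator lborel.sigma_finite_measure_axioms) auto
  also have "\<dots> = (\<integral>\<^sup>+x. indicator (box (subst_coord l i 0) (subst_coord u i 1)) x * ennreal (u $ i - l $ i) \<partial>lborel)"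
  proof (rule nn_integral_cong)
    fix x :: "real ^ 'n"
    have "indicator {x. 0 < x $ i \<and> x $ i < 1} x * (indicator (box l u) (subst_coord x i t) :: ennreal) =
      indicator (box (subst_coord l i 0) (subst_coord u i 1)) x * indicator {l $ i<..<u $ i} t" for t
      by (auto simp: mem_box_cart subst_coord_nth split: split_indicator if_splits)
    then have "indicator {x. 0 < x $ i \<and> x $ i < 1} x * (\<integral>\<^sup>+t. indicator (box l u) (subst_coord x i t) \<partial>lborel)
      = (\<integral>\<^sup>+t. indicator (box (subst_coord l i 0) (subst_coord u i 1)) x * indicator {l $ i<..<u $ i} t \<partial>lborel)"
      by (subst nn_integral_cmult[symmetric]) simp_all
    also have "\<dots> = indicator (box (subst_coord l i 0) (subst_coord u i 1)) x * ennreal (u $ i - l $ i)"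
      using lu' by (simp add: nn_integral_cmult)
    finally show "indicator {x. 0 < x $ i \<and> x $ i < 1} x * (\<integral>\<^sup>+t. indicator (box l u) (subst_coord x i t) \<partial>lborel)
      = indicator (box (subst_coord l i 0) (subst_coord u i 1)) x * ennreal (u $ i - l $ i)" .
  qed
  also have "\<dots> = emeasure lborel (box (subst_coord l i 0) (subst_coord u i 1)) * ennreal (u $ i - l $ i)"
    by (simp add: nn_integral_multc)
  also have "emeasure lborel (box (subst_coord l i 0) (subst_coord u i 1)) = ennreal (\<Prod>b\<in>Basis. (subst_coord u i 1 - subst_coord l i 0) \<bullet> b)"
    using lu' by (intro emeasure_lborel_box) (auto simp: Basis_vec_def inner_axis subst_coord_nth)
  also have "(\<Prod>b\<in>Basis. (subst_coord u i 1 - subst_coord l i 0) \<bullet> b) = (\<Prod>b\<in>Basis - {axis i 1}. (u - l) \<bullet> b)"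
  proof -
    have "(\<Prod>b\<in>Basis. (subst_coord u i 1 - subst_coord l i 0) \<bullet> b)
      = ((subst_coord u i 1 - subst_coord l i 0) \<bullet> axis i 1) * (\<Prod>b\<in>Basis - {axis i 1}. (subst_coord u i 1 - subst_coord l i 0) \<bullet> b)"
      by (rule prod.remove) auto
    also have "(\<Prod>b\<in>Basis - {axis i 1}. (subst_coord u i 1 - subst_coord l i 0) \<bullet> b) = (\<Prod>b\<in>Basis - {axis i 1}. (u - l) \<bullet> b)"
      by (intro prod.cong) (auto simp: Basis_vec_def inner_axis subst_coord_nth axis_eq_axis)
    finally show ?thesis by (simp add: inner_axis subst_coord_nth)
  qed
  also have "ennreal \<dots> * ennreal (u $ i - l $ i) = ennreal ((\<Prod>b\<in>Basis - {axis i 1}. (u - l) \<bullet> b) * (u $ i - l $ i))"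
    using lu lu' by (subst ennreal_mult) (auto intro!: prod_nonneg simp: inner_diff_left)
  also have "(\<Prod>b\<in>Basis - {axis i 1}. (u - l) \<bullet> b) * (u $ i - l $ i) = (\<Prod>b\<in>Basis. (u - l) \<bullet> b)"
    by (subst prod.remove[of Basis "axis i 1"]) (auto simp: inner_axis)
  finally show "emeasure (distr (Q \<Otimes>\<^sub>M lborel) borel (\<lambda>(x, t). subst_coord x i t)) (box l u) = (\<Prod>b\<in>Basis. (u - l) \<bullet> b)" .
qed simp

lemma nn_integral_lborel_slices:
  fixes F :: "real ^ 'n::finite \<Rightarrow> ennreal" and i :: "'n::finite"
  assumes [measurable]: "F \<in> borel_measurable borel"
  shows "(\<integral>\<^sup>+x. F x \<partial>lborel) =
    (\<integral>\<^sup>+x. indicator {x. 0 < x $ i \<and> x $ i < 1} x * (\<integral>\<^sup>+t. F (subst_coord x i t) \<partial>lborel) \<partial>lborel)"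
proof -
  define Q where "Q = density lborel (indicator {x :: real ^ 'n. 0 < x $ i \<and> x $ i < 1})"
  have m[measurable]: "(\<lambda>(x, t). subst_coord x i t) \<in> borel_measurable (Q \<Otimes>\<^sub>M lborel)"
    using measurable_subst_coord by (simp add: Q_def cong: measurable_cong_sets sets_pair_measure_cong)
  have "(\<integral>\<^sup>+x. F x \<partial>lborel) = (\<integral>\<^sup>+z. F (case z of (x, t) \<Rightarrow> subst_coord x i t) \<partial>(Q \<Otimes>\<^sub>M lborel))"
    by (subst lborel_slicing_measure[of i, folded Q_def], subst nn_integral_distr) simp_all
  also have "\<dots> = (\<integral>\<^sup>+x. \<integral>\<^sup>+t. F (subst_coord x i t) \<partial>lborel \<partial>Q)"
    by (subst lborel.nn_integral_fst[symmetric]) simp_all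
  also have "\<dots> = (\<integral>\<^sup>+x. indicator {x. 0 < x $ i \<and> x $ i < 1} x * (\<integral>\<^sup>+t. F (subst_coord x i t) \<partial>lborel) \<partial>lborel)"
    unfolding Q_def
    by (intro nn_integral_density measurable_slice_integral borel_measurable_indicator lborel.sigma_finite_measure_axioms) auto
  finally show ?thesis .
qed

definition gauss_density :: "'a::euclidean_space \<Rightarrow> real" where
  "gauss_density x = (2 * pi) powr (- real DIM('a) / 2) * exp (- (norm x)\<^sup>2 / 2)"

lemma gauss_eq: "gauss = density lborel (\<lambda>x. ennreal (gauss_density x))"
  by (simp add: gauss_def gauss_density_def)

lemma sets_gauss [measurable_cong, simp]: "sets gauss = sets borel"
  by (simp add: gauss_eq)

lemma space_gauss [simp]: "space gauss = UNIV"
  by (simp add: gauss_eq)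

lemma gauss_density_pos: "gauss_density x > 0"
  by (simp add: gauss_density_def)

lemma gauss_density_measurable [measurable]: "gauss_density \<in> borel_measurable borel"
  unfolding gauss_density_def by measurable

lemma AE_gauss_iff: "(AE x in gauss. P x) \<longleftrightarrow> (AE x in lborel. P x)"
  unfolding gauss_eq by (subst AE_density) (auto simp: gauss_density_pos)

lemma gauss_density_subst_coord:
  fixes x :: "real ^ 'n::finite"
  shows "gauss_density (subst_coord x i t) = sqrt (2 * pi) * gauss_density (subst_coord x i 0) * std_normal_density t"
proof -
  have n: "(norm (subst_coord x i s))\<^sup>2 = s\<^sup>2 + (\<Sum>j\<in>UNIV - {i}. (x $ j)\<^sup>2)" for s
  proof -
    have "(norm (subst_coord x i s))\<^sup>2 = (\<Sum>j\<in>UNIV. (subst_coord x i s $ j)\<^sup>2)"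
      unfolding norm_vec_def L2_set_def by (simp add: sum_nonneg)
    also have "\<dots> = (subst_coord x i s $ i)\<^sup>2 + (\<Sum>j\<in>UNIV - {i}. (subst_coord x i s $ j)\<^sup>2)"
      by (rule sum.remove) auto
    also have "(\<Sum>j\<in>UNIV - {i}. (subst_coord x i s $ j)\<^sup>2) = (\<Sum>j\<in>UNIV - {i}. (x $ j)\<^sup>2)"
      by (rule sum.cong) (auto simp: subst_coord_nth)
    finally show ?thesis by (simp add: subst_coord_nth)
  qed
  have "(norm (subst_coord x i t))\<^sup>2 = t\<^sup>2 + (norm (subst_coord x i 0))\<^sup>2"
    using n[of t] n[of 0] by simp
  then have "exp (- (norm (subst_coord x i t))\<^sup>2 / 2) = exp (- (norm (subst_coord x i 0))\<^sup>2 / 2) * exp (- t\<^sup>2 / 2)"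
    by (simp add: exp_add[symmetric] add_divide_distrib)
  then show ?thesis unfolding gauss_density_def std_normal_density_def by simp
qed

text \<open>Resampling one coordinate preserves the Gaussian measure. The density factorises into
a factor constant along the line and the one-dimensional density.\<close>

lemma nn_integral_gauss_slices:
  fixes F :: "real ^ 'n::finite \<Rightarrow> ennreal" and i :: "'n::finite"
  assumes [measurable]: "F \<in> borel_measurable borel"
  shows "(\<integral>\<^sup>+x. F x \<partial>gauss) = (\<integral>\<^sup>+x. \<integral>\<^sup>+t. F (subst_coord x i t) \<partial>gauss \<partial>gauss)"
proof -
  let ?c = "\<lambda>x :: real ^ 'n. sqrt (2 * pi) * gauss_density (subst_coord x i 0)"
  let ?S = "\<lambda>x. \<integral>\<^sup>+t. F (subst_coord x i t) \<partial>gauss"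
  have c: "?c x \<ge> 0" for x using gauss_density_pos[of "subst_coord x i 0"] by (simp add: less_imp_le)
  have [measurable]: "?S \<in> borel_measurable borel"
  proof -
    interpret g: prob_space "gauss :: real measure" unfolding gauss_real by (rule prob_space_normal_density) simp
    show ?thesis by (rule measurable_slice_integral) (auto intro: g.sigma_finite_measure_axioms)
  qed
  have dens: "ennreal (gauss_density (subst_coord x i t)) = ennreal (?c x) * ennreal (std_normal_density t)" for x t
    unfolding gauss_density_subst_coord[of x i t] using c normal_density_nonneg by (subst ennreal_mult) auto
  have inner: "(\<integral>\<^sup>+s. ennreal (gauss_density (subst_coord x i s)) * ?S (subst_coord x i s) \<partial>lborel)
       = (\<integral>\<^sup>+t. ennreal (gauss_density (subst_coord x i t)) * F (subst_coord x i t) \<partial>lborel)" for x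
  proof -
    have "(\<integral>\<^sup>+s. ennreal (gauss_density (subst_coord x i s)) * ?S (subst_coord x i s) \<partial>lborel)
      = (\<integral>\<^sup>+s. ennreal (?c x) * ?S x * ennreal (std_normal_density s) \<partial>lborel)"
      unfolding dens by (simp add: mult_ac)
    also have "\<dots> = ennreal (?c x) * ?S x"
      by (simp add: nn_integral_cmult nn_integral_std_normal)
    also have "?S x = (\<integral>\<^sup>+t. ennreal (std_normal_density t) * F (subst_coord x i t) \<partial>lborel)"
      unfolding gauss_real by (subst nn_integral_density) auto
    also have "ennreal (?c x) * \<dots> = (\<integral>\<^sup>+t. ennreal (?c x) * (ennreal (std_normal_density t) * F (subst_coord x i t)) \<partial>lborel)"
      by (subst nn_integral_cmult) auto
    also have "\<dots> = (\<integral>\<^sup>+t. ennreal (gauss_density (subst_coord x i t)) * F (subst_coord x i t) \<partial>lborel)"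
      unfolding dens by (simp add: mult_ac)
    finally show ?thesis .
  qed
  have "(\<integral>\<^sup>+x. ?S x \<partial>gauss) = (\<integral>\<^sup>+x. ennreal (gauss_density x) * ?S x \<partial>lborel)"
    unfolding gauss_eq[where ?'a = "real ^ 'n"] by (subst nn_integral_density) auto
  also have "\<dots> = (\<integral>\<^sup>+x. indicator {x. 0 < x $ i \<and> x $ i < 1} x * (\<integral>\<^sup>+s. ennreal (gauss_density (subst_coord x i s)) * ?S (subst_coord x i s) \<partial>lborel) \<partial>lborel)"
    by (rule nn_integral_lborel_slices) measurable
  also have "\<dots> = (\<integral>\<^sup>+x. indicator {x. 0 < x $ i \<and> x $ i < 1} x * (\<integral>\<^sup>+t. ennreal (gauss_density (subst_coord x i t)) * F (subst_coord x i t) \<partial>lborel) \<partial>lborel)"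
    by (simp only: inner)
  also have "\<dots> = (\<integral>\<^sup>+x. ennreal (gauss_density x) * F x \<partial>lborel)"
    by (rule nn_integral_lborel_slices[symmetric]) measurable
  also have "\<dots> = (\<integral>\<^sup>+x. F x \<partial>gauss)"
    unfolding gauss_eq by (subst nn_integral_density) auto
  finally show ?thesis ..
qed

lemma prob_space_gauss: "prob_space (gauss :: 'a::euclidean_space measure)"
proof
  let ?c = "(2 * pi) powr (- 1 / 2)"
  have "emeasure (gauss :: 'a measure) (space gauss) = (\<integral>\<^sup>+x. ennreal (gauss_density (x :: 'a)) \<partial>lborel)"
    by (simp add: gauss_eq emeasure_density)
  also have "\<dots> = (\<integral>\<^sup>+x. (\<Prod>b\<in>(Basis :: 'a set). ennreal (std_normal_density (x \<bullet> b))) \<partial>lborel)"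
  proof (rule nn_integral_cong)
    fix x :: 'a
    have "(2 * pi) powr (- real DIM('a) / 2) = ((2 * pi) powr (- 1 / 2)) ^ DIM('a)"
      by (simp add: powr_power)
    also have "(2 * pi) powr (- 1 / 2) = 1 / sqrt (2 * pi)"
      by (simp add: powr_minus_divide powr_half_sqrt)
    finally have c: "(2 * pi) powr (- real DIM('a) / 2) = (1 / sqrt (2 * pi)) ^ DIM('a)" .
    have "(norm x)\<^sup>2 = (\<Sum>b\<in>Basis. (x \<bullet> b)\<^sup>2)"
      by (subst power2_norm_eq_inner, subst euclidean_inner) (simp add: power2_eq_square)
    then have "- (norm x)\<^sup>2 / 2 = (\<Sum>b\<in>Basis. - (x \<bullet> b)\<^sup>2 / 2)"
      by (simp only: sum_negf sum_divide_distrib[symmetric])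
    with c have "gauss_density x = (\<Prod>b\<in>(Basis :: 'a set). 1 / sqrt (2 * pi)) * exp (\<Sum>b\<in>(Basis :: 'a set). - (x \<bullet> b)\<^sup>2 / 2)"
      unfolding gauss_density_def by (simp only: prod_constant)
    also have "\<dots> = (\<Prod>b\<in>(Basis :: 'a set). std_normal_density (x \<bullet> b))"
      unfolding std_normal_density_def prod.distrib exp_sum[OF finite_Basis] ..
    finally show "ennreal (gauss_density x) = (\<Prod>b\<in>(Basis :: 'a set). ennreal (std_normal_density (x \<bullet> b)))"
      by (simp add: prod_ennreal normal_density_nonneg)
  qed
  also have "\<dots> = (\<Prod>b\<in>(Basis :: 'a set). \<integral>\<^sup>+x. ennreal (std_normal_density x) \<partial>lborel)"
    by (rule nn_integral_lborel_prod) (auto simp: normal_density_nonneg)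
  also have "\<dots> = 1" by (simp add: nn_integral_std_normal)
  finally show "emeasure (gauss :: 'a measure) (space gauss) = 1" .
qed

lemma gauss_eq_distr:
  fixes i :: "'n::finite"
  shows "(gauss :: (real ^ 'n) measure) = distr (gauss \<Otimes>\<^sub>M gauss) borel (\<lambda>(x, t). subst_coord x i t)"
proof (rule measure_eqI)
  interpret g: prob_space "gauss :: real measure" by (rule prob_space_gauss)
  fix A :: "(real ^ 'n) set" assume "A \<in> sets gauss"
  then have [measurable]: "A \<in> sets borel" by simp
  have "emeasure gauss A = (\<integral>\<^sup>+x. \<integral>\<^sup>+t. indicator A (subst_coord x i t) \<partial>gauss \<partial>gauss)"
    by (subst nn_integral_gauss_slices[symmetric]) auto
  also have "\<dots> = (\<integral>\<^sup>+z. indicator A (case z of (x, t) \<Rightarrow> subst_coord x i t) \<partial>(gauss \<Otimes>\<^sub>M gauss))"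
    by (subst g.nn_integral_fst[symmetric]) simp_all
  also have "\<dots> = emeasure (distr (gauss \<Otimes>\<^sub>M gauss) borel (\<lambda>(x, t). subst_coord x i t)) A"
    by (subst emeasure_distr_eq_nn_integral) simp_all
  finally show "emeasure gauss A = emeasure (distr (gauss \<Otimes>\<^sub>M gauss) borel (\<lambda>(x, t). subst_coord x i t)) A" .
qed simp

lemma integral_gauss_slices:
  fixes F :: "real ^ 'n::finite \<Rightarrow> real" and i :: "'n::finite"
  assumes F: "integrable gauss F"
  shows "AE x in gauss. integrable gauss (\<lambda>t. F (subst_coord x i t))"
    and "integrable gauss (\<lambda>x. \<integral>t. F (subst_coord x i t) \<partial>gauss)"
    and "(\<integral>x. F x \<partial>gauss) = (\<integral>x. \<integral>t. F (subst_coord x i t) \<partial>gauss \<partial>gauss)"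
proof -
  interpret g: prob_space "gauss :: real measure" by (rule prob_space_gauss)
  interpret gn: prob_space "gauss :: (real ^ 'n) measure" by (rule prob_space_gauss)
  interpret P: pair_sigma_finite "gauss :: (real ^ 'n) measure" "gauss :: real measure" by standard
  have [measurable]: "F \<in> borel_measurable borel" using borel_measurable_integrable[OF F] by simp
  have i: "integrable (gauss \<Otimes>\<^sub>M gauss) (\<lambda>z. F (case z of (x, t) \<Rightarrow> subst_coord x i t))"
    using F by (subst (asm) gauss_eq_distr[of i], subst (asm) integrable_distr_eq) simp_all
  show "AE x in gauss. integrable gauss (\<lambda>t. F (subst_coord x i t))"
    using P.AE_integrable_fst'[OF i] by simp
  show "integrable gauss (\<lambda>x. \<integral>t. F (subst_coord x i t) \<partial>gauss)"
    using P.integrable_fst'[OF i] by simp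
  have "(\<integral>x. F x \<partial>gauss) = (\<integral>z. F (case z of (x, t) \<Rightarrow> subst_coord x i t) \<partial>(gauss \<Otimes>\<^sub>M gauss))"
    by (subst gauss_eq_distr[of i], subst integral_distr) simp_all
  then show "(\<integral>x. F x \<partial>gauss) = (\<integral>x. \<integral>t. F (subst_coord x i t) \<partial>gauss \<partial>gauss)"
    using P.integral_fst'[OF i] by simp
qed

section \<open>Weak gradients on lines\<close>

lemma nn_integral_lborel_translate:
  fixes F :: "'a::euclidean_space \<Rightarrow> ennreal"
  assumes [measurable]: "F \<in> borel_measurable borel"
  shows "(\<integral>\<^sup>+x. F (x + v) \<partial>lborel) = (\<integral>\<^sup>+x. F x \<partial>lborel)"
  by (subst lborel_distr_plus[of v, symmetric], subst nn_integral_distr) (auto simp: add.commute)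

lemma lborel_translate:
  fixes F :: "'a::euclidean_space \<Rightarrow> real"
  assumes [measurable]: "F \<in> borel_measurable borel"
  shows "integrable lborel (\<lambda>x. F (x + v)) \<longleftrightarrow> integrable lborel F"
    and "(\<integral>x. F (x + v) \<partial>lborel) = (\<integral>x. F x \<partial>lborel)"
proof -
  have "integrable lborel F \<longleftrightarrow> integrable (distr lborel borel ((+) v)) F"
    by (simp add: lborel_distr_plus)
  then show "integrable lborel (\<lambda>x. F (x + v)) \<longleftrightarrow> integrable lborel F"
    by (subst (asm) integrable_distr_eq) (auto simp: add.commute)
  have "(\<integral>x. F x \<partial>lborel) = (\<integral>x. F x \<partial>distr lborel borel ((+) v))"
    by (simp add: lborel_distr_plus)
  then show "(\<integral>x. F (x + v) \<partial>lborel) = (\<integral>x. F x \<partial>lborel)"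
    by (subst (asm) integral_distr) (auto simp: add.commute)
qed

lemma locally_integrable_translate:
  fixes u :: "'a::euclidean_space \<Rightarrow> real"
  assumes u: "locally_integrable u"
  shows "locally_integrable (\<lambda>x. u (x + v))"
proof -
  have [measurable]: "u \<in> borel_measurable borel" by (rule locally_integrable_measurable[OF u])
  have "integrable lborel (\<lambda>x. indicator K x *\<^sub>R u (x + v))" if K: "compact K" for K
  proof -
    have [measurable]: "K \<in> sets borel" using K by (simp add: compact_imp_closed)
    have [measurable]: "((+) v ` K) \<in> sets borel" using compact_translation[OF K, of v] by (simp add: compact_imp_closed)
    have "integrable lborel (\<lambda>x. indicator ((+) v ` K) x *\<^sub>R u x)"
      using u compact_translation[OF K, of v] unfolding locally_integrable_def set_integrable_def by blast
    then have "integrable lborel (\<lambda>x. indicator ((+) v ` K) (x + v) *\<^sub>R u (x + v))"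
      by (subst lborel_translate(1)[of "\<lambda>x. indicator ((+) v ` K) x *\<^sub>R u x"]) auto
    moreover have "indicator ((+) v ` K) (x + v) = (indicator K x :: real)" for x
      by (auto simp: image_iff add.commute split: split_indicator)
    ultimately show ?thesis by simp
  qed
  then show ?thesis unfolding locally_integrable_def set_integrable_def by simp
qed

lemma locally_integrable_diff:
  assumes "locally_integrable f" "locally_integrable g"
  shows "locally_integrable (\<lambda>x. f x - g x)"
  using assms unfolding locally_integrable_def by auto

lemma integrable_locally_times_compact:
  fixes u :: "'a::euclidean_space \<Rightarrow> 'b::{banach, second_countable_topology}"
    and \<psi> :: "'a \<Rightarrow> real"
  assumes u: "locally_integrable u" and [measurable]: "\<psi> \<in> borel_measurable borel"
    and \<psi>: "\<And>x. \<bar>\<psi> x\<bar> \<le> B * indicator (cball 0 r) x"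
  shows "integrable lborel (\<lambda>x. \<psi> x *\<^sub>R u x)"
proof (rule integrable_bound_pointwise)
  have [measurable]: "u \<in> borel_measurable borel" using u by (simp add: locally_integrable_def)
  show "integrable lborel (\<lambda>x. B *\<^sub>R (indicator (cball 0 r) x :: real) *\<^sub>R u x)"
    using u compact_cball[of "0::'a" r] unfolding locally_integrable_def set_integrable_def
    by (intro integrable_scaleR_right) blast
  show "(\<lambda>x. \<psi> x *\<^sub>R u x) \<in> borel_measurable lborel" by measurable
  show "norm (\<psi> x *\<^sub>R u x) \<le> norm (B *\<^sub>R (indicator (cball 0 r) x :: real) *\<^sub>R u x)" for x
  proof -
    have "\<bar>\<psi> x\<bar> * norm (u x) \<le> (B * indicator (cball 0 r) x) * norm (u x)"
      by (intro mult_right_mono \<psi>) simp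
    also have "\<dots> \<le> \<bar>B * indicator (cball 0 r) x\<bar> * norm (u x)"
      by (intro mult_right_mono) auto
    finally show ?thesis by (simp add: abs_mult)
  qed
qed

lemma integrable_locally_times_gradient:
  fixes u :: "'a::euclidean_space \<Rightarrow> real" and D :: "'a \<Rightarrow> 'a"
  assumes u: "locally_integrable u" and [measurable]: "D \<in> borel_measurable borel" and B: "B \<ge> 0"
    and D: "\<And>x. norm (D x) \<le> B * indicator (cball 0 r) x"
  shows "integrable lborel (\<lambda>x. u x *\<^sub>R D x)"
proof (rule integrable_bound_pointwise)
  have [measurable]: "u \<in> borel_measurable borel" by (rule locally_integrable_measurable[OF u])
  have Bm: "(\<lambda>x :: 'a. B * indicator (cball 0 r) x :: real) \<in> borel_measurable borel"
    by (intro borel_measurable_times borel_measurable_const borel_measurable_indicator) simp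
  show "integrable lborel (\<lambda>x. (B * indicator (cball 0 r) x) *\<^sub>R u x)"
    by (rule integrable_locally_times_compact[OF u Bm, of B r]) (use B in \<open>auto simp: abs_mult\<close>)
  show "(\<lambda>x. u x *\<^sub>R D x) \<in> borel_measurable lborel" by measurable
  show "norm (u x *\<^sub>R D x) \<le> norm ((B * indicator (cball 0 r) x) *\<^sub>R u x)" for x
  proof -
    have "norm (D x) * \<bar>u x\<bar> \<le> B * indicator (cball 0 r) x * \<bar>u x\<bar>"
      by (intro mult_right_mono D) simp
    then show ?thesis using B by (simp add: abs_mult mult.commute)
  qed
qed

text \<open>This justifies exchanging segment integrals and space integrals: a segment of length \<open>\<bar>h\<bar>\<close>
starting in a ball stays in a larger ball, and translations preserve Lebesgue measure.\<close>

lemma integrable_along_segments: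
  fixes \<gamma> :: "'a::euclidean_space \<Rightarrow> real"
    and \<psi> :: "'a \<Rightarrow> real"
  assumes \<gamma>: "locally_integrable \<gamma>" and e: "norm e = 1" and \<psi>m[measurable]: "\<psi> \<in> borel_measurable borel"
    and \<psi>: "\<And>x. \<bar>\<psi> x\<bar> \<le> B * indicator (cball 0 r) x"
  shows "integrable (lborel \<Otimes>\<^sub>M lborel) (\<lambda>(x, s). \<psi> x * (oriented_seg h s * \<gamma> (x + s *\<^sub>R e)))"
proof (rule integrableI_bounded)
  have [measurable]: "\<gamma> \<in> borel_measurable borel" by (rule locally_integrable_measurable[OF \<gamma>])
  have B: "0 \<le> B * indicator (cball 0 r) x" for x :: 'a using \<psi>[of x] by linarith
  show "(\<lambda>(x, s). \<psi> x * (oriented_seg h s * \<gamma> (x + s *\<^sub>R e))) \<in> borel_measurable (lborel \<Otimes>\<^sub>M lborel)"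
    by measurable
  have [measurable]: "cball 0 (r + \<bar>h\<bar>) \<in> sets (borel :: 'a measure)" by simp
  have Gm: "(\<lambda>x. ennreal (norm (indicator (cball 0 (r + \<bar>h\<bar>)) x *\<^sub>R \<gamma> x))) \<in> borel_measurable borel"
    by measurable
  have "(\<lambda>x :: 'a. x + s *\<^sub>R e) \<in> borel_measurable borel" for s
    by (intro borel_measurable_continuous_onI continuous_intros)
  from measurable_compose[OF this Gm]
  have Gs: "(\<lambda>x. ennreal (norm (indicator (cball 0 (r + \<bar>h\<bar>)) (x + s *\<^sub>R e) *\<^sub>R \<gamma> (x + s *\<^sub>R e)))) \<in> borel_measurable lborel" for s
    by simp
  define C where "C = (\<integral>\<^sup>+x. ennreal (norm (indicator (cball 0 (r + \<bar>h\<bar>)) x *\<^sub>R \<gamma> x)) \<partial>lborel)"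
  have "integrable lborel (\<lambda>x. indicator (cball 0 (r + \<bar>h\<bar>)) x *\<^sub>R \<gamma> x)"
    using \<gamma> compact_cball[of "0::'a" "r + \<bar>h\<bar>"] unfolding locally_integrable_def set_integrable_def by blast
  then have C: "C < \<infinity>" unfolding C_def by (simp add: integrable_iff_bounded)
  have "(\<integral>\<^sup>+z. ennreal (norm (case z of (x, s) \<Rightarrow> \<psi> x * (oriented_seg h s * \<gamma> (x + s *\<^sub>R e)))) \<partial>(lborel \<Otimes>\<^sub>M lborel))
    = (\<integral>\<^sup>+s. \<integral>\<^sup>+x. ennreal (norm (\<psi> x * (oriented_seg h s * \<gamma> (x + s *\<^sub>R e)))) \<partial>lborel \<partial>lborel)"
    by (subst lborel_pair.nn_integral_snd[symmetric]) simp_all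
  also have "\<dots> \<le> (\<integral>\<^sup>+s. ennreal \<bar>B\<bar> * C * indicator {- \<bar>h\<bar>..\<bar>h\<bar>} s \<partial>lborel)"
  proof (rule nn_integral_mono)
    fix s
    show "(\<integral>\<^sup>+x. ennreal (norm (\<psi> x * (oriented_seg h s * \<gamma> (x + s *\<^sub>R e)))) \<partial>lborel) \<le> ennreal \<bar>B\<bar> * C * indicator {- \<bar>h\<bar>..\<bar>h\<bar>} s"
    proof (cases "s \<in> {- \<bar>h\<bar>..\<bar>h\<bar>}")
      case False
      then have "oriented_seg h s = 0" using abs_oriented_seg_le[of h s] by simp
      then show ?thesis by simp
    next
      case True
      have "(\<integral>\<^sup>+x. ennreal (norm (\<psi> x * (oriented_seg h s * \<gamma> (x + s *\<^sub>R e)))) \<partial>lborel)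
        \<le> (\<integral>\<^sup>+x. ennreal \<bar>B\<bar> * ennreal (norm (indicator (cball 0 (r + \<bar>h\<bar>)) (x + s *\<^sub>R e) *\<^sub>R \<gamma> (x + s *\<^sub>R e))) \<partial>lborel)"
      proof (rule nn_integral_mono)
        fix x
        have "\<bar>\<psi> x\<bar> * \<bar>oriented_seg h s\<bar> \<le> \<bar>B\<bar> * indicator (cball 0 (r + \<bar>h\<bar>)) (x + s *\<^sub>R e)"
        proof (cases "x \<in> cball 0 r")
          case in_ball: True
          have "norm (x + s *\<^sub>R e) \<le> norm x + \<bar>s\<bar>" using norm_triangle_ineq[of x "s *\<^sub>R e"] e by simp
          then have "x + s *\<^sub>R e \<in> cball 0 (r + \<bar>h\<bar>)" using in_ball True by auto
          moreover have "\<bar>\<psi> x\<bar> * \<bar>oriented_seg h s\<bar> \<le> B * 1"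
            using \<psi>[of x] in_ball abs_oriented_seg_le[of h s] True B[of x] by (intro mult_mono) auto
          ultimately show ?thesis by simp
        qed (use \<psi>[of x] in simp)
        then have "\<bar>\<psi> x\<bar> * \<bar>oriented_seg h s\<bar> * \<bar>\<gamma> (x + s *\<^sub>R e)\<bar> \<le> \<bar>B\<bar> * indicator (cball 0 (r + \<bar>h\<bar>)) (x + s *\<^sub>R e) * \<bar>\<gamma> (x + s *\<^sub>R e)\<bar>"
          by (intro mult_right_mono) auto
        then show "ennreal (norm (\<psi> x * (oriented_seg h s * \<gamma> (x + s *\<^sub>R e)))) \<le>
          ennreal \<bar>B\<bar> * ennreal (norm (indicator (cball 0 (r + \<bar>h\<bar>)) (x + s *\<^sub>R e) *\<^sub>R \<gamma> (x + s *\<^sub>R e)))"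
          by (simp add: ennreal_mult[symmetric] abs_mult mult.assoc ennreal_leI)
      qed
      also have "\<dots> = ennreal \<bar>B\<bar> * (\<integral>\<^sup>+x. ennreal (norm (indicator (cball 0 (r + \<bar>h\<bar>)) (x + s *\<^sub>R e) *\<^sub>R \<gamma> (x + s *\<^sub>R e))) \<partial>lborel)"
        using Gs by (rule nn_integral_cmult)
      also have "(\<integral>\<^sup>+x. ennreal (norm (indicator (cball 0 (r + \<bar>h\<bar>)) (x + s *\<^sub>R e) *\<^sub>R \<gamma> (x + s *\<^sub>R e))) \<partial>lborel) = C"
        unfolding C_def using Gm by (rule nn_integral_lborel_translate)
      finally show ?thesis using True by simp
    qed
  qed
  also have "\<dots> = ennreal \<bar>B\<bar> * C * emeasure lborel {- \<bar>h\<bar>..\<bar>h\<bar>}" by (simp add: nn_integral_cmult)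
  also have "\<dots> < \<infinity>" using C by (simp add: ennreal_mult_less_top)
  finally show "(\<integral>\<^sup>+z. ennreal (norm (case z of (x, s) \<Rightarrow> \<psi> x * (oriented_seg h s * \<gamma> (x + s *\<^sub>R e)))) \<partial>(lborel \<Otimes>\<^sub>M lborel)) < \<infinity>" .
qed

lemma GDERIV_translate:
  assumes "\<And>x. GDERIV \<phi> x :> D x"
  shows "GDERIV (\<lambda>x. \<phi> (x + v)) x :> D (x + v)"
proof -
  have "((\<lambda>x. \<phi> (x + v)) has_derivative (\<lambda>h. h \<bullet> D (x + v))) (at x)"
    using assms[of "x + v"] unfolding gderiv_def
    by (rule has_derivative_compose[of "\<lambda>x. x + v" "\<lambda>h. h", rotated]) (auto intro!: derivative_eq_intros)
  then show ?thesis by (simp add: gderiv_def)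
qed

lemma Ck_translate: "Ck k \<phi> \<Longrightarrow> Ck k (\<lambda>x. \<phi> (x + v))"
proof (induction k arbitrary: \<phi>)
  case 0
  then show ?case by (auto intro!: continuous_on_compose2[of UNIV \<phi>] continuous_intros)
next
  case (Suc k)
  then obtain D where D: "\<forall>x. GDERIV \<phi> x :> D x" "\<forall>b\<in>Basis. Ck k (\<lambda>x. D x \<bullet> b)" by auto
  have "GDERIV (\<lambda>x. \<phi> (x + v)) x :> D (x + v)" for x
    using D(1) by (intro GDERIV_translate) blast
  moreover have "\<forall>b\<in>Basis. Ck k (\<lambda>x. D (x + v) \<bullet> b)" using D(2) Suc.IH by blast
  ultimately show ?case unfolding Ck.simps by (intro exI[of _ "\<lambda>x. D (x + v)"]) simp
qed

lemma test_function_translate: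
  assumes "test_function \<phi>"
  shows "test_function (\<lambda>x. \<phi> (x + v))"
proof -
  have "bounded {x. \<phi> x \<noteq> 0}" using assms by (simp add: test_function_def)
  then have "bounded ((+) (- v) ` {x. \<phi> x \<noteq> 0})" by (rule bounded_translation)
  moreover have "{x. \<phi> (x + v) \<noteq> 0} \<subseteq> (+) (- v) ` {x. \<phi> x \<noteq> 0}"
    by (auto simp: image_iff intro!: exI[of _ "_ + v"])
  ultimately have "bounded {x. \<phi> (x + v) \<noteq> 0}" by (rule bounded_subset)
  then show ?thesis using assms Ck_translate by (auto simp: test_function_def)
qed

lemma test_function_has_gradient:
  assumes "test_function \<phi>"
  obtains D where "\<And>x. GDERIV \<phi> x :> D x"
proof -
  have "Ck (Suc 0) \<phi>" using assms unfolding test_function_def by blast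
  then show ?thesis using that by auto
qed

lemma GDERIV_unique:
  assumes "GDERIV \<phi> x :> D" "GDERIV \<phi> x :> D'"
  shows "D = D'"
proof -
  have "(\<lambda>h. h \<bullet> D) = (\<lambda>h. h \<bullet> D')"
    using assms has_derivative_unique unfolding gderiv_def by blast
  then have "(D - D') \<bullet> (D - D') = 0" by (metis inner_diff_right right_minus_eq)
  then show ?thesis by simp
qed

text \<open>The gradient of a test function vanishes outside the support because the function is locally
constant there.\<close>

lemma test_function_gradient:
  fixes \<phi> :: "'a::euclidean_space \<Rightarrow> real"
  assumes t: "test_function \<phi>" and D: "\<And>x. GDERIV \<phi> x :> D x"
  obtains B r where "continuous_on UNIV D" "continuous_on UNIV \<phi>" "r \<ge> 0" "B \<ge> 0"
    "\<And>x. \<bar>\<phi> x\<bar> \<le> B * indicator (cball 0 r) x" "\<And>x. norm (D x) \<le> B * indicator (cball 0 r) x"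
proof -
  have "Ck 1 \<phi>" "Ck 0 \<phi>" using t unfolding test_function_def by blast+
  then obtain D' where D': "\<And>x. GDERIV \<phi> x :> D' x" "\<And>b. b \<in> Basis \<Longrightarrow> continuous_on UNIV (\<lambda>x. D' x \<bullet> b)"
    and cont: "continuous_on UNIV \<phi>" by auto
  have "D' = D" using GDERIV_unique[OF D'(1) D] by auto
  then have cD: "continuous_on UNIV D" using D'(2) continuous_on_componentwise[of UNIV D] by auto
  have "bounded {x. \<phi> x \<noteq> 0}" using t by (simp add: test_function_def)
  then obtain r where r: "r > 0" "{x. \<phi> x \<noteq> 0} \<subseteq> cball 0 r"
    by (auto simp: bounded_pos subset_iff)
  have z: "\<phi> x = 0" if "x \<notin> cball 0 r" for x using r that by auto
  have Dz: "D x = 0" if "x \<notin> cball 0 r" for x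
  proof -
    have "(\<phi> has_derivative (\<lambda>h. 0)) (at x)"
      by (rule has_derivative_transform_within_open[of "\<lambda>x. 0" _ x UNIV "- cball 0 r"]) (use that z in auto)
    then have "(\<lambda>h. h \<bullet> D x) = (\<lambda>h. 0)"
      using D[of x] has_derivative_unique unfolding gderiv_def by blast
    then show ?thesis by (metis inner_eq_zero_iff)
  qed
  have "bounded (\<phi> ` cball 0 r)" "bounded (D ` cball 0 r)"
    using cont cD by (auto intro!: compact_imp_bounded compact_continuous_image intro: continuous_on_subset)
  then obtain B1 B2 where "\<And>x. x \<in> cball 0 r \<Longrightarrow> norm (\<phi> x) \<le> B1" "\<And>x. x \<in> cball 0 r \<Longrightarrow> norm (D x) \<le> B2"
    unfolding bounded_iff by (metis imageI)
  then have "\<bar>\<phi> x\<bar> \<le> max 0 (max B1 B2) * indicator (cball 0 r) x" "norm (D x) \<le> max 0 (max B1 B2) * indicator (cball 0 r) x" for x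
    using z[of x] Dz[of x] by (cases "x \<in> cball 0 r", force, simp)+
  with cD cont r(1) show ?thesis by (intro that[of r "max 0 (max B1 B2)"]) auto
qed

lemma weak_gradient_directional:
  fixes u :: "'a::euclidean_space \<Rightarrow> real"
  assumes w: "is_weak_gradient u g" and \<phi>: "test_function \<phi>" and D: "\<And>x. GDERIV \<phi> x :> D x"
  shows "(\<integral>x. u x * (D x \<bullet> e) \<partial>lborel) = - (\<integral>x. \<phi> x * (g x \<bullet> e) \<partial>lborel)"
proof -
  have u: "locally_integrable u" and g: "locally_integrable g"
    and eq: "(\<integral>x. u x *\<^sub>R D x \<partial>lborel) = - (\<integral>x. \<phi> x *\<^sub>R g x \<partial>lborel)"
    using w \<phi> D unfolding is_weak_gradient_def by blast+
  obtain B r where D': "continuous_on UNIV D" "continuous_on UNIV \<phi>" "r \<ge> 0" "B \<ge> 0"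
    "\<And>x. \<bar>\<phi> x\<bar> \<le> B * indicator (cball 0 r) x" "\<And>x. norm (D x) \<le> B * indicator (cball 0 r) x"
    by (rule test_function_gradient[OF \<phi> D]) blast
  have [measurable]: "D \<in> borel_measurable borel" "\<phi> \<in> borel_measurable borel"
    using D'(1,2) by (auto intro: borel_measurable_continuous_onI)
  have i1: "integrable lborel (\<lambda>x. u x *\<^sub>R D x)"
    by (rule integrable_locally_times_gradient[OF u _ D'(4,6)]) simp
  have i2: "integrable lborel (\<lambda>x. \<phi> x *\<^sub>R g x)"
    by (rule integrable_locally_times_compact[OF g _ D'(5)]) simp
  have "(\<integral>x. u x * (D x \<bullet> e) \<partial>lborel) = (\<integral>x. u x *\<^sub>R D x \<partial>lborel) \<bullet> e"
    by (subst integral_inner_left[symmetric]) (use i1 in auto)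
  also have "\<dots> = - ((\<integral>x. \<phi> x *\<^sub>R g x \<partial>lborel) \<bullet> e)" unfolding eq by simp
  also have "(\<integral>x. \<phi> x *\<^sub>R g x \<partial>lborel) \<bullet> e = (\<integral>x. \<phi> x * (g x \<bullet> e) \<partial>lborel)"
    by (subst integral_inner_left[symmetric]) (use i2 in auto)
  finally show ?thesis .
qed

lemma has_derivative_along_line:
  assumes "\<And>x. GDERIV \<phi> x :> D x"
  shows "((\<lambda>s. \<phi> (x + s *\<^sub>R e)) has_real_derivative D (x + s *\<^sub>R e) \<bullet> e) (at s)"
proof -
  have "((\<lambda>s. \<phi> (x + s *\<^sub>R e)) has_derivative (\<lambda>h. (h *\<^sub>R e) \<bullet> D (x + s *\<^sub>R e))) (at s)"
    using assms[of "x + s *\<^sub>R e"] unfolding gderiv_def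
    by (rule has_derivative_compose[of "\<lambda>s. x + s *\<^sub>R e" "\<lambda>h. h *\<^sub>R e", rotated]) (auto intro!: derivative_eq_intros)
  then show ?thesis by (simp add: has_field_derivative_def inner_commute mult_commute_abs)
qed

lemma integral_pull_scalar:
  fixes f g :: "'a \<Rightarrow> real"
  shows "(\<integral>x. f x * (c * g x) \<partial>M) = c * (\<integral>x. f x * g x \<partial>M)"
  by (subst integral_mult_right_zero[symmetric]) (simp only: mult.left_commute)

lemma subst_coord_eq_line: "subst_coord x i t = subst_coord x i 0 + t *\<^sub>R axis i 1"
  by (simp add: subst_coord_def vec_eq_iff axis_def)

text \<open>By the fundamental lemma it suffices to test against \<open>\<phi>\<close>. Fubini and a translation move the
segment integral onto \<open>\<phi>\<close>, the weak gradient is applied to the translates of \<open>\<phi>\<close>, and the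
fundamental theorem of calculus along the segment turns the result into an increment of \<open>\<phi>\<close>;
translating back gives the increment of \<open>u\<close>.\<close>

lemma weak_gradient_increment:
  fixes u :: "'a::euclidean_space \<Rightarrow> real"
  assumes w: "is_weak_gradient u g" and e: "norm e = 1"
  shows "AE x in lborel. u (x + h *\<^sub>R e) - u x - (\<integral>s. oriented_seg h s * (g (x + s *\<^sub>R e) \<bullet> e) \<partial>lborel) = 0"
proof (rule fundamental_lemma)
  have u: "locally_integrable u" using w unfolding is_weak_gradient_def by blast
  define \<gamma> where "\<gamma> x = g x \<bullet> e" for x
  have \<gamma>: "locally_integrable \<gamma>"
    unfolding \<gamma>_def[abs_def] using w locally_integrable_inner unfolding is_weak_gradient_def by blast
  have [measurable]: "u \<in> borel_measurable borel" "\<gamma> \<in> borel_measurable borel"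
    using u \<gamma> by (simp_all add: locally_integrable_def)
  define V where "V x = (\<integral>s. oriented_seg h s * \<gamma> (x + s *\<^sub>R e) \<partial>lborel)" for x
  have Vm[measurable]: "V \<in> borel_measurable borel" unfolding V_def by measurable
  have V: "locally_integrable V"
  proof -
    have "integrable lborel (\<lambda>x. indicator K x *\<^sub>R V x)" if K: "compact K" for K
    proof -
      have [measurable]: "K \<in> sets borel" using K by (simp add: compact_imp_closed)
      obtain r where r: "K \<subseteq> cball 0 r" using compact_imp_bounded[OF K] by (auto simp: bounded_iff subset_iff)
      have "integrable (lborel \<Otimes>\<^sub>M lborel) (\<lambda>(x, s). indicator K x * (oriented_seg h s * \<gamma> (x + s *\<^sub>R e)))"
        using r by (intro integrable_along_segments[OF \<gamma> e, of _ 1 r]) (auto split: split_indicator)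
      from lborel_pair.integrable_fst[OF this] show ?thesis by (simp add: V_def)
    qed
    then show ?thesis unfolding locally_integrable_def set_integrable_def by simp
  qed
  have ut: "locally_integrable (\<lambda>x. u (x + h *\<^sub>R e))" by (rule locally_integrable_translate[OF u])
  show "locally_integrable (\<lambda>x. u (x + h *\<^sub>R e) - u x - (\<integral>s. oriented_seg h s * (g (x + s *\<^sub>R e) \<bullet> e) \<partial>lborel))"
    using locally_integrable_diff[OF locally_integrable_diff[OF ut u] V] by (simp add: V_def \<gamma>_def)
  fix \<phi> :: "'a \<Rightarrow> real" assume \<phi>: "test_function \<phi>"
  obtain D where D0: "\<And>x. GDERIV \<phi> x :> D x" by (rule test_function_has_gradient[OF \<phi>]) blast
  obtain B r where D: "continuous_on UNIV D" "continuous_on UNIV \<phi>" "r \<ge> 0" "B \<ge> 0"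
    "\<And>x. \<bar>\<phi> x\<bar> \<le> B * indicator (cball 0 r) x" "\<And>x. norm (D x) \<le> B * indicator (cball 0 r) x"
    by (rule test_function_gradient[OF \<phi> D0]) blast
  have [measurable]: "D \<in> borel_measurable borel" "\<phi> \<in> borel_measurable borel"
    using D(1,2) by (auto intro: borel_measurable_continuous_onI)
  define \<psi> where "\<psi> x = D x \<bullet> e" for x
  have \<psi>m[measurable]: "\<psi> \<in> borel_measurable borel" unfolding \<psi>_def by measurable
  have \<psi>: "\<bar>\<psi> x\<bar> \<le> B * indicator (cball 0 r) x" for x
    using Cauchy_Schwarz_ineq2[of "D x" e] D(6)[of x] e by (simp add: \<psi>_def)
  have i1: "integrable lborel (\<lambda>x. \<phi> x * u (x + h *\<^sub>R e))"
    using integrable_locally_times_compact[OF ut _ D(5)] by simp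
  have i2: "integrable lborel (\<lambda>x. \<phi> x * u x)"
    using integrable_locally_times_compact[OF u _ D(5)] by simp
  have i3: "integrable lborel (\<lambda>x. \<phi> x * V x)"
    using integrable_locally_times_compact[OF V _ D(5)] by simp
  have P1: "integrable (lborel \<Otimes>\<^sub>M lborel) (\<lambda>(x, s). \<phi> x * (oriented_seg h s * \<gamma> (x + s *\<^sub>R e)))"
    by (rule integrable_along_segments[OF \<gamma> e _ D(5)]) simp
  have P2: "integrable (lborel \<Otimes>\<^sub>M lborel) (\<lambda>(x, s). u x * (oriented_seg h s * \<psi> (x + (- s) *\<^sub>R e)))"
  proof (rule Bochner_Integration.integrable_bound)
    have iu: "integrable lborel (\<lambda>x. indicator (cball 0 (r + \<bar>h\<bar>)) x *\<^sub>R u x)"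
      using u compact_cball[of "0::'a" "r + \<bar>h\<bar>"] unfolding locally_integrable_def set_integrable_def by blast
    have iS: "integrable lborel (\<lambda>s. B * indicator {- \<bar>h\<bar>..\<bar>h\<bar>} s :: real)" by simp
    show "integrable (lborel \<Otimes>\<^sub>M lborel) (\<lambda>(x, s). indicator (cball 0 (r + \<bar>h\<bar>)) x *\<^sub>R u x * (B * indicator {- \<bar>h\<bar>..\<bar>h\<bar>} s))"
      by (rule lborel_integrable_prod[OF iu iS])
    show "(\<lambda>(x, s). u x * (oriented_seg h s * \<psi> (x + (- s) *\<^sub>R e))) \<in> borel_measurable (lborel \<Otimes>\<^sub>M lborel)"
      by measurable
    have "\<bar>u x\<bar> * (\<bar>oriented_seg h s\<bar> * \<bar>\<psi> (x + (- s) *\<^sub>R e)\<bar>) \<le> indicator (cball 0 (r + \<bar>h\<bar>)) x * \<bar>u x\<bar> * (B * indicator {- \<bar>h\<bar>..\<bar>h\<bar>} s)" for x s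
    proof (cases "s \<in> {- \<bar>h\<bar>..\<bar>h\<bar>} \<and> x + (- s) *\<^sub>R e \<in> cball 0 r")
      case True
      have "norm x \<le> norm (x + (- s) *\<^sub>R e) + \<bar>s\<bar>"
        using norm_triangle_ineq4[of "x + (- s) *\<^sub>R e" "(- s) *\<^sub>R e"] e by simp
      then have x: "x \<in> cball 0 (r + \<bar>h\<bar>)" using True by auto
      have "\<bar>oriented_seg h s\<bar> * \<bar>\<psi> (x + (- s) *\<^sub>R e)\<bar> \<le> 1 * B"
        using \<psi>[of "x + (- s) *\<^sub>R e"] abs_oriented_seg_le[of h s] True D(4) by (intro mult_mono) auto
      then have "\<bar>u x\<bar> * (\<bar>oriented_seg h s\<bar> * \<bar>\<psi> (x + (- s) *\<^sub>R e)\<bar>) \<le> \<bar>u x\<bar> * B"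
        by (intro mult_left_mono) auto
      then show ?thesis using x True by simp
    next
      case False
      then have "oriented_seg h s = 0 \<or> \<psi> (x + (- s) *\<^sub>R e) = 0"
        using abs_oriented_seg_le[of h s] \<psi>[of "x + (- s) *\<^sub>R e"] by auto
      then show ?thesis using D(4) by auto
    qed
    then show "AE z in lborel \<Otimes>\<^sub>M lborel. norm (case z of (x, s) \<Rightarrow> u x * (oriented_seg h s * \<psi> (x + (- s) *\<^sub>R e)))
      \<le> norm (case z of (x, s) \<Rightarrow> indicator (cball 0 (r + \<bar>h\<bar>)) x *\<^sub>R u x * (B * indicator {- \<bar>h\<bar>..\<bar>h\<bar>} s))"
      using D(4) by (intro AE_I2) (auto simp: abs_mult split: prod.split)
  qed
  have wk: "(\<integral>x. \<phi> x * \<gamma> (x + s *\<^sub>R e) \<partial>lborel) = - (\<integral>x. u x * \<psi> (x + (- s) *\<^sub>R e) \<partial>lborel)" for s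
  proof -
    have "(\<integral>x. \<phi> x * \<gamma> (x + s *\<^sub>R e) \<partial>lborel) = (\<integral>x. (\<lambda>y. \<phi> (y + (- s) *\<^sub>R e) * \<gamma> y) (x + s *\<^sub>R e) \<partial>lborel)"
      by simp
    also have "\<dots> = (\<integral>y. \<phi> (y + (- s) *\<^sub>R e) * \<gamma> y \<partial>lborel)"
      by (rule lborel_translate(2)) measurable
    also have "\<dots> = - (\<integral>x. u x * \<psi> (x + (- s) *\<^sub>R e) \<partial>lborel)"
      using weak_gradient_directional[OF w test_function_translate[OF \<phi>, of "(- s) *\<^sub>R e"] GDERIV_translate[OF D0], of e]
      by (simp add: \<gamma>_def \<psi>_def)
    finally show ?thesis .
  qed
  have ftc: "(\<integral>s. oriented_seg h s * \<psi> (x + (- s) *\<^sub>R e) \<partial>lborel) = \<phi> x - \<phi> (x + (- h) *\<^sub>R e)" for x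
  proof -
    have "ac_deriv (\<lambda>s. - \<phi> (x + s *\<^sub>R (- e))) (\<lambda>s. \<psi> (x + s *\<^sub>R (- e)))"
    proof (rule ac_deriv_of_continuous_derivative)
      show "((\<lambda>s. - \<phi> (x + s *\<^sub>R (- e))) has_real_derivative \<psi> (x + s *\<^sub>R (- e))) (at s)" for s
        using DERIV_minus[OF has_derivative_along_line[OF D0, of x "- e" s]] by (simp add: \<psi>_def)
      show "continuous_on UNIV (\<lambda>s. \<psi> (x + s *\<^sub>R (- e)))"
        unfolding \<psi>_def by (intro continuous_intros continuous_on_compose2[OF D(1)]) auto
    qed
    from oriented_FTC[OF this, of h] show ?thesis by simp
  qed
  have "(\<integral>x. \<phi> x * V x \<partial>lborel) = (\<integral>x. \<integral>s. \<phi> x * (oriented_seg h s * \<gamma> (x + s *\<^sub>R e)) \<partial>lborel \<partial>lborel)"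
    by (simp add: V_def)
  also have "\<dots> = (\<integral>s. \<integral>x. \<phi> x * (oriented_seg h s * \<gamma> (x + s *\<^sub>R e)) \<partial>lborel \<partial>lborel)"
    using lborel_pair.Fubini_integral[OF P1] by simp
  also have "\<dots> = (\<integral>s. oriented_seg h s * (\<integral>x. \<phi> x * \<gamma> (x + s *\<^sub>R e) \<partial>lborel) \<partial>lborel)"
    by (simp only: integral_pull_scalar)
  also have "\<dots> = - (\<integral>s. oriented_seg h s * (\<integral>x. u x * \<psi> (x + (- s) *\<^sub>R e) \<partial>lborel) \<partial>lborel)"
    unfolding wk by simp
  also have "(\<integral>s. oriented_seg h s * (\<integral>x. u x * \<psi> (x + (- s) *\<^sub>R e) \<partial>lborel) \<partial>lborel)
     = (\<integral>s. \<integral>x. u x * (oriented_seg h s * \<psi> (x + (- s) *\<^sub>R e)) \<partial>lborel \<partial>lborel)"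
    by (simp only: integral_pull_scalar)
  also have "\<dots> = (\<integral>x. \<integral>s. u x * (oriented_seg h s * \<psi> (x + (- s) *\<^sub>R e)) \<partial>lborel \<partial>lborel)"
    using lborel_pair.Fubini_integral[OF P2] by simp
  also have "\<dots> = (\<integral>x. u x * (\<phi> x - \<phi> (x + (- h) *\<^sub>R e)) \<partial>lborel)"
    by (simp only: integral_mult_right_zero ftc)
  also have "\<dots> = (\<integral>x. \<phi> x * u x \<partial>lborel) - (\<integral>x. \<phi> (x + (- h) *\<^sub>R e) * u x \<partial>lborel)"
  proof -
    have "integrable lborel (\<lambda>x. (\<lambda>y. \<phi> (y + (- h) *\<^sub>R e) * u y) (x + h *\<^sub>R e))"
      using i1 by simp
    then have "integrable lborel (\<lambda>y. \<phi> (y + (- h) *\<^sub>R e) * u y)"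
      by (subst (asm) lborel_translate(1)) measurable
    then show ?thesis using i2 by (simp add: right_diff_distrib mult.commute)
  qed
  also have "(\<integral>x. \<phi> (x + (- h) *\<^sub>R e) * u x \<partial>lborel) = (\<integral>x. (\<lambda>y. \<phi> (y + (- h) *\<^sub>R e) * u y) (x + h *\<^sub>R e) \<partial>lborel)"
    by (rule lborel_translate(2)[symmetric]) measurable
  finally have "(\<integral>x. \<phi> x * V x \<partial>lborel) = (\<integral>x. \<phi> x * u (x + h *\<^sub>R e) \<partial>lborel) - (\<integral>x. \<phi> x * u x \<partial>lborel)"
    by simp
  then have "(\<integral>x. \<phi> x * (u (x + h *\<^sub>R e) - u x - V x) \<partial>lborel) = 0"
    using i1 i2 i3 by (simp add: right_diff_distrib)
  then show "(\<integral>x. \<phi> x * (u (x + h *\<^sub>R e) - u x - (\<integral>s. oriented_seg h s * (g (x + s *\<^sub>R e) \<bullet> e) \<partial>lborel)) \<partial>lborel) = 0"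
    by (simp add: V_def \<gamma>_def)
qed

text \<open>The Gaussian density is bounded below on compact sets.\<close>

lemma integrable_gauss_imp_locally_integrable:
  fixes F :: "'a::euclidean_space \<Rightarrow> 'b::{banach, second_countable_topology}"
  assumes F: "integrable gauss F"
  shows "locally_integrable F"
proof -
  have Fm[measurable]: "F \<in> borel_measurable borel" using borel_measurable_integrable[OF F] by simp
  have i: "integrable lborel (\<lambda>x. gauss_density x *\<^sub>R F x)"
    using F unfolding gauss_eq by (subst (asm) integrable_density) (auto simp: less_imp_le gauss_density_pos)
  have "integrable lborel (\<lambda>x. indicator K x *\<^sub>R F x)" if K: "compact K" for K
  proof -
    have [measurable]: "K \<in> sets borel" using K by (simp add: compact_imp_closed)
    obtain r where r: "\<And>x. x \<in> K \<Longrightarrow> norm x \<le> r" using compact_imp_bounded[OF K] by (auto simp: bounded_iff)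
    define c where "c = (2 * pi) powr (- real DIM('a) / 2) * exp (- r\<^sup>2 / 2)"
    have c: "c > 0" by (simp add: c_def)
    have cle: "c \<le> gauss_density x" if "x \<in> K" for x
      using power_mono[OF r[OF that], of 2] unfolding c_def gauss_density_def by (intro mult_left_mono) auto
    show ?thesis
    proof (rule integrable_bound_pointwise)
      show "integrable lborel (\<lambda>x. (1 / c) *\<^sub>R (gauss_density x *\<^sub>R F x))"
        by (intro integrable_scaleR_right i)
      show "norm (indicator K x *\<^sub>R F x) \<le> norm ((1 / c) *\<^sub>R (gauss_density x *\<^sub>R F x))" for x
      proof (cases "x \<in> K")
        case True
        have "1 * norm (F x) \<le> (1 / c * gauss_density x) * norm (F x)"
          using cle[OF True] c by (intro mult_right_mono) auto
        then show ?thesis using True c gauss_density_pos[of x] by (simp add: abs_of_pos)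
      qed simp
    qed measurable
  qed
  then show ?thesis using Fm unfolding locally_integrable_def set_integrable_def by simp
qed

lemma square_integrable_imp_set_integrable:
  fixes V :: "real \<Rightarrow> real"
  assumes [measurable]: "V \<in> borel_measurable borel" and V: "integrable gauss (\<lambda>t. (V t)\<^sup>2)"
  shows "set_integrable lborel {a..b} V"
proof -
  interpret prob_space "gauss :: real measure" by (rule prob_space_gauss)
  have "integrable gauss V"
  proof (rule Bochner_Integration.integrable_bound)
    show "integrable gauss (\<lambda>t. 1 + (V t)\<^sup>2)" using V by simp
    have "\<bar>V t\<bar> \<le> 1 + (V t)\<^sup>2" for t
      using zero_le_power2[of "\<bar>V t\<bar> - 1"] abs_ge_zero[of "V t"] by (simp add: power2_diff del: abs_ge_zero)
    then show "AE t in gauss. norm (V t) \<le> norm (1 + (V t)\<^sup>2)"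
      by (intro AE_I2) (simp add: abs_of_nonneg)
  qed simp
  then have "locally_integrable V" by (rule integrable_gauss_imp_locally_integrable)
  then show ?thesis by (auto simp: locally_integrable_def)
qed

text \<open>The increment formula holds for every \<open>h\<close> and almost every \<open>x\<close>, hence by Fubini for almost
every \<open>x\<close> and almost every \<open>h\<close>. For such an \<open>x\<close> its right-hand side is the absolutely continuous
representative on the line through \<open>x\<close>.\<close>

lemma weak_gradient_ac_on_lines:
  fixes u :: "real ^ 'n::finite \<Rightarrow> real"
  assumes w: "is_weak_gradient u g" and g2: "integrable gauss (\<lambda>x. (norm (g x))\<^sup>2)"
  shows "AE x in gauss. \<exists>v. ac_deriv v (\<lambda>t. g (subst_coord x i t) $ i) \<and> (AE t in lborel. u (subst_coord x i t) = v t)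
    \<and> integrable gauss (\<lambda>t. (g (subst_coord x i t) $ i)\<^sup>2)"
proof -
  define e :: "real ^ 'n" where "e = axis i 1"
  have e: "norm e = 1" by (simp add: e_def)
  have ge: "g x \<bullet> e = g x $ i" for x by (simp add: e_def inner_axis)
  have [measurable]: "u \<in> borel_measurable borel" "g \<in> borel_measurable borel"
    using w by (simp_all add: is_weak_gradient_def locally_integrable_def)
  have gi[measurable]: "(\<lambda>x. g x $ i) \<in> borel_measurable borel"
    unfolding ge[symmetric] by measurable
  have "integrable gauss (\<lambda>x. (g x $ i)\<^sup>2)"
  proof (rule Bochner_Integration.integrable_bound[OF g2])
    show "AE x in gauss. norm ((g x $ i)\<^sup>2) \<le> norm ((norm (g x))\<^sup>2)"
    proof (rule AE_I2)
      fix x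
      have "\<bar>g x $ i\<bar> \<le> norm (g x)" by (rule component_le_norm_cart)
      then show "norm ((g x $ i)\<^sup>2) \<le> norm ((norm (g x))\<^sup>2)" by (simp add: abs_le_square_iff[symmetric])
    qed
  qed simp
  from integral_gauss_slices(1)[OF this, of i]
  have sl: "AE x in gauss. integrable gauss (\<lambda>t. (g (subst_coord x i t) $ i)\<^sup>2)" .
  let ?K = "\<lambda>x h. u (x + h *\<^sub>R e) - u x - (\<integral>s. oriented_seg h s * (g (x + s *\<^sub>R e) \<bullet> e) \<partial>lborel)"
  have "AE h in lborel. AE x in lborel. ?K x h = 0"
    by (intro AE_I2 weak_gradient_increment[OF w e])
  moreover have "{z \<in> space (lborel \<Otimes>\<^sub>M lborel). ?K (snd z) (fst z) = 0} \<in> sets (lborel \<Otimes>\<^sub>M lborel)"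
    unfolding ge by measurable
  ultimately have "AE x in lborel. AE h in lborel. ?K x h = 0"
    using lborel_pair.AE_commute[of "\<lambda>h x. ?K x h = 0"] by simp
  then have "AE x in gauss. AE h in lborel. ?K x h = 0" by (simp add: AE_gauss_iff)
  with sl show ?thesis
  proof eventually_elim
    case (elim x)
    define V where "V t = g (subst_coord x i t) $ i" for t
    have Vm[measurable]: "V \<in> borel_measurable borel" unfolding V_def by measurable
    have Vi: "set_integrable lborel {a..b} V" for a b
      by (rule square_integrable_imp_set_integrable[OF Vm]) (use elim(1) in \<open>simp add: V_def\<close>)
    let ?W = "\<lambda>t. \<integral>s. oriented_seg t s * V s \<partial>lborel"
    define v where "v t = (u x - ?W (x $ i)) + ?W t" for t
    have "ac_deriv v V" unfolding v_def[abs_def] by (rule ac_deriv_oriented_integral[OF Vm Vi])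
    moreover have "AE t in lborel. u (subst_coord x i t) = v t"
    proof -
      have *: "u (subst_coord x i (x $ i + h)) = v (x $ i + h)" if "?K x h = 0" for h
      proof -
        have "(\<integral>s. oriented_seg h s * (g (x + s *\<^sub>R e) \<bullet> e) \<partial>lborel) = (\<integral>s. (\<lambda>r. oriented_seg h (r - x $ i) * V r) (s + x $ i) \<partial>lborel)"
          unfolding ge by (simp add: V_def subst_coord_eq_shift e_def)
        also have "\<dots> = (\<integral>r. oriented_seg h (r - x $ i) * V r \<partial>lborel)"
          by (rule lborel_translate(2)) measurable
        also have "\<dots> = (\<integral>r. oriented_seg (x $ i + h) r * V r - oriented_seg (x $ i) r * V r \<partial>lborel)"
          using oriented_seg_shift[of "x $ i + h" "x $ i"] by (simp add: left_diff_distrib)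
        also have "\<dots> = ?W (x $ i + h) - ?W (x $ i)"
          by (intro Bochner_Integration.integral_diff integrable_oriented_seg_mult[OF Vm Vi])
        finally show ?thesis using that by (simp add: v_def subst_coord_eq_shift e_def)
      qed
      have "AE h in lborel. u (subst_coord x i (x $ i + h)) = v (x $ i + h)"
        using elim(2) by eventually_elim (rule *)
      then have "AE t in distr lborel borel ((+) (x $ i)). u (subst_coord x i t) = v t"
      proof (subst AE_distr_iff)
        have [measurable]: "v \<in> borel_measurable borel"
          by (intro borel_measurable_continuous_onI ac_deriv_continuous[OF \<open>ac_deriv v V\<close>])
        show "{t \<in> space borel. u (subst_coord x i t) = v t} \<in> sets borel" by measurable
      qed simp_all
      then show ?thesis by (simp only: lborel_distr_plus)
    qed
    ultimately show ?case using elim(1) unfolding V_def[symmetric] by blast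
  qed
qed

section \<open>Fisher information and stability along one coordinate\<close>

lemma integral_lborel_eq_gauss:
  fixes F :: "'a::euclidean_space \<Rightarrow> real"
  assumes F: "integrable lborel F"
  shows "integrable gauss (\<lambda>x. F x / gauss_density x)" "(\<integral>x. F x \<partial>lborel) = (\<integral>x. F x / gauss_density x \<partial>gauss)"
proof -
  have [measurable]: "F \<in> borel_measurable borel" using F by auto
  have "gauss_density x * (F x / gauss_density x) = F x" for x :: 'a using gauss_density_pos[of x] by simp
  then show "integrable gauss (\<lambda>x. F x / gauss_density x)" "(\<integral>x. F x \<partial>lborel) = (\<integral>x. F x / gauss_density x \<partial>gauss)"
    using F unfolding gauss_eq by (auto simp: integrable_density integral_density less_imp_le gauss_density_pos)
qed

lemma integral_lborel_zero_of_lines: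
  fixes F :: "real ^ 'n::finite \<Rightarrow> real"
  assumes F: "integrable lborel F" and z: "AE x in gauss. (\<integral>t. F (subst_coord x i t) \<partial>lborel) = 0"
  shows "(\<integral>x. F x \<partial>lborel) = 0"
proof -
  have Fm[measurable]: "F \<in> borel_measurable borel" using F by auto
  have "(\<integral>x. F x \<partial>lborel) = (\<integral>x. \<integral>t. F (subst_coord x i t) / gauss_density (subst_coord x i t) \<partial>gauss \<partial>gauss)"
    using integral_lborel_eq_gauss[OF F] integral_gauss_slices(3)[of "\<lambda>x. F x / gauss_density x" i] by simp
  also have "\<dots> = (\<integral>x. 0 \<partial>(gauss :: (real ^ 'n) measure))"
  proof (rule integral_cong_AE)
    have "(\<lambda>x. \<integral>t. F (subst_coord x i t) / gauss_density (subst_coord x i t) \<partial>gauss) \<in> borel_measurable gauss"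
      using integral_gauss_slices(2)[OF integral_lborel_eq_gauss(1)[OF F], of i] by (rule borel_measurable_integrable)
    then show "(\<lambda>x. \<integral>t. F (subst_coord x i t) / gauss_density (subst_coord x i t) \<partial>gauss) \<in> borel_measurable gauss" .
    show "AE x in gauss. (\<integral>t. F (subst_coord x i t) / gauss_density (subst_coord x i t) \<partial>gauss) = 0"
      using z
    proof eventually_elim
      case (elim x)
      \<comment> \<open>The weight \<open>1 / gauss_density\<close> cancels the one-dimensional density up to a constant on the line.\<close>
      define c where "c = sqrt (2 * pi) * gauss_density (subst_coord x i 0)"
      have c: "c > 0" unfolding c_def by (intro mult_pos_pos gauss_density_pos) simp
      have "std_normal_density t * (F (subst_coord x i t) / gauss_density (subst_coord x i t)) = F (subst_coord x i t) / c" for t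
        unfolding gauss_density_subst_coord[of x i t] c_def[symmetric]
        using normal_density_pos[of 1 0 t] c by simp
      then have "(\<integral>t. F (subst_coord x i t) / gauss_density (subst_coord x i t) \<partial>gauss) = (\<integral>t. F (subst_coord x i t) / c \<partial>lborel)"
        unfolding gauss_real by (subst integral_gauss) simp_all
      then show ?case using elim by simp
    qed
  qed simp
  finally show ?thesis by simp
qed

text \<open>On almost every line \<open>u\<close> is absolutely continuous, so the integrand in the weak formulation
is the derivative of the compactly supported absolutely continuous function \<open>u\<^sup>2 \<phi>\<close> and
integrates to zero.\<close>

lemma weak_gradient_square:
  fixes u :: "real ^ 'n::finite \<Rightarrow> real"
  assumes w: "is_weak_gradient u g" and u2: "integrable gauss (\<lambda>x. (u x)\<^sup>2)" and g2: "integrable gauss (\<lambda>x. (norm (g x))\<^sup>2)"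
  shows "is_weak_gradient (\<lambda>x. (u x)\<^sup>2) (\<lambda>x. (2 * u x) *\<^sub>R g x)"
proof -
  have [measurable]: "u \<in> borel_measurable borel" "g \<in> borel_measurable borel"
    using w by (simp_all add: is_weak_gradient_def locally_integrable_def)
  have f: "locally_integrable (\<lambda>x. (u x)\<^sup>2)"
    using u2 by (rule integrable_gauss_imp_locally_integrable)
  have "integrable gauss (\<lambda>x. (2 * u x) *\<^sub>R g x)"
  proof (rule Bochner_Integration.integrable_bound)
    show "integrable gauss (\<lambda>x. (u x)\<^sup>2 + (norm (g x))\<^sup>2)" using u2 g2 by simp
    have "2 * \<bar>u x\<bar> * norm (g x) \<le> (u x)\<^sup>2 + (norm (g x))\<^sup>2" for x
      using sum_squares_bound[of "\<bar>u x\<bar>" "norm (g x)"] by simp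
    then show "AE x in gauss. norm ((2 * u x) *\<^sub>R g x) \<le> norm ((u x)\<^sup>2 + (norm (g x))\<^sup>2)"
      by (intro AE_I2) (simp add: abs_mult)
  qed simp
  then have G: "locally_integrable (\<lambda>x. (2 * u x) *\<^sub>R g x)"
    by (rule integrable_gauss_imp_locally_integrable)
  have "(\<integral>x. (u x)\<^sup>2 *\<^sub>R D x \<partial>lborel) = - (\<integral>x. \<phi> x *\<^sub>R ((2 * u x) *\<^sub>R g x) \<partial>lborel)"
    if \<phi>: "test_function \<phi>" and D0: "\<And>x. GDERIV \<phi> x :> D x" for \<phi> D
  proof -
    obtain B r where D: "continuous_on UNIV D" "continuous_on UNIV \<phi>" "r \<ge> 0" "B \<ge> 0"
      "\<And>x. \<bar>\<phi> x\<bar> \<le> B * indicator (cball 0 r) x" "\<And>x. norm (D x) \<le> B * indicator (cball 0 r) x"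
      by (rule test_function_gradient[OF \<phi> D0]) blast
    have [measurable]: "D \<in> borel_measurable borel" "\<phi> \<in> borel_measurable borel"
      using D(1,2) by (auto intro: borel_measurable_continuous_onI)
    have i1: "integrable lborel (\<lambda>x. (u x)\<^sup>2 *\<^sub>R D x)"
      by (rule integrable_locally_times_gradient[OF f _ D(4,6)]) simp
    have i2: "integrable lborel (\<lambda>x. \<phi> x *\<^sub>R ((2 * u x) *\<^sub>R g x))"
      by (rule integrable_locally_times_compact[OF G _ D(5)]) simp
    show ?thesis
    proof (rule euclidean_eqI)
      fix b :: "real ^ 'n" assume "b \<in> Basis"
      then obtain i where b: "b = axis i 1" by (auto simp: Basis_vec_def)
      define F where "F x = ((u x)\<^sup>2 *\<^sub>R D x) \<bullet> b + (\<phi> x *\<^sub>R ((2 * u x) *\<^sub>R g x)) \<bullet> b" for x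
      have iF: "integrable lborel F" unfolding F_def[abs_def]
        by (intro Bochner_Integration.integrable_add integrable_inner_left i1 i2)
      have "AE x in gauss. (\<integral>t. F (subst_coord x i t) \<partial>lborel) = 0"
        using weak_gradient_ac_on_lines[OF w g2, of i]
      proof eventually_elim
        case (elim x)
        then obtain v where v': "ac_deriv v (\<lambda>t. g (subst_coord x i t) $ i) \<and> (AE t in lborel. u (subst_coord x i t) = v t)
          \<and> integrable gauss (\<lambda>t. (g (subst_coord x i t) $ i)\<^sup>2)" by (rule exE)
        note v = conjunct1[OF v'] and uv = conjunct1[OF conjunct2[OF v']]
        define V where "V t = g (subst_coord x i t) $ i" for t
        define p where "p t = \<phi> (subst_coord x i t)" for t
        define p' where "p' t = D (subst_coord x i t) \<bullet> b" for t
        have p_eq: "p = (\<lambda>t. \<phi> (subst_coord x i 0 + t *\<^sub>R b))" and p'_eq: "p' = (\<lambda>t. D (subst_coord x i 0 + t *\<^sub>R b) \<bullet> b)"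
          unfolding p_def[abs_def] p'_def[abs_def] b
          by (intro ext arg_cong[where f=\<phi>] arg_cong[where f="\<lambda>y. D y \<bullet> axis i 1"] subst_coord_eq_line)+
        have ac_p: "ac_deriv p p'"
          unfolding p_eq p'_eq
        proof (rule ac_deriv_of_continuous_derivative)
          show "((\<lambda>t. \<phi> (subst_coord x i 0 + t *\<^sub>R b)) has_real_derivative D (subst_coord x i 0 + t *\<^sub>R b) \<bullet> b) (at t)" for t
            by (rule has_derivative_along_line[OF D0])
          show "continuous_on UNIV (\<lambda>t. D (subst_coord x i 0 + t *\<^sub>R b) \<bullet> b)"
            by (intro continuous_intros continuous_on_compose2[OF D(1)]) auto
        qed
        let ?q = "\<lambda>t. (V t * v t + V t * v t) * p t + p' t * (v t * v t)"
        have ac: "ac_deriv (\<lambda>t. (v t * v t) * p t) ?q"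
          using ac_deriv_mult[OF ac_deriv_mult[OF v v] ac_p] unfolding V_def .
        have [measurable]: "v \<in> borel_measurable borel" "p \<in> borel_measurable borel" "p' \<in> borel_measurable borel" "V \<in> borel_measurable borel"
          using ac_deriv_continuous[OF v] ac_deriv_continuous[OF ac_p] ac_deriv_measurable[OF ac_p] ac_deriv_measurable[OF v]
          by (auto intro: borel_measurable_continuous_onI simp: V_def[abs_def])
        have z: "p t = 0" "p' t = 0" if "\<bar>t\<bar> > r" for t
        proof -
          have "\<bar>t\<bar> \<le> norm (subst_coord x i t)"
            using component_le_norm_cart[of "subst_coord x i t" i] by (simp add: subst_coord_nth)
          then have "subst_coord x i t \<notin> cball 0 r" using that by auto
          then show "p t = 0" "p' t = 0"
            using D(5,6)[of "subst_coord x i t"] by (simp_all add: p_def p'_def)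
        qed
        have Fm: "(\<lambda>t. F (subst_coord x i t)) \<in> borel_measurable borel"
          unfolding F_def by measurable
        have Ft: "F (subst_coord x i t) = (u (subst_coord x i t))\<^sup>2 * p' t + p t * (2 * u (subst_coord x i t) * V t)" for t
          by (simp add: F_def p_def p'_def V_def b inner_axis)
        have "(\<integral>t. F (subst_coord x i t) \<partial>lborel) = (\<integral>t. indicator {- (r + 1)..r + 1} t *\<^sub>R ?q t \<partial>lborel)"
        proof (rule integral_cong_AE)
          show "AE t in lborel. F (subst_coord x i t) = indicator {- (r + 1)..r + 1} t *\<^sub>R ?q t"
            using uv
          proof eventually_elim
            case (elim t)
            then show ?case using z[of t]
              by (cases "\<bar>t\<bar> > r") (auto simp: Ft power2_eq_square algebra_simps split: split_indicator)
          qed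
        qed (use Fm in \<open>simp_all\<close>)
        also have "\<dots> = 0"
          using ac_derivD(2)[OF ac, of "- (r + 1)" "r + 1"] z[of "r + 1"] z[of "- (r + 1)"] D(3)
          by (simp add: set_lebesgue_integral_def)
        finally show ?case .
      qed
      then have "(\<integral>x. F x \<partial>lborel) = 0"
        by (rule integral_lborel_zero_of_lines[OF iF])
      moreover have "(\<integral>x. F x \<partial>lborel) = (\<integral>x. ((u x)\<^sup>2 *\<^sub>R D x) \<bullet> b \<partial>lborel) + (\<integral>x. (\<phi> x *\<^sub>R ((2 * u x) *\<^sub>R g x)) \<bullet> b \<partial>lborel)"
        unfolding F_def by (intro Bochner_Integration.integral_add integrable_inner_left i1 i2)
      moreover have "(\<integral>x. ((u x)\<^sup>2 *\<^sub>R D x) \<bullet> b \<partial>lborel) = (\<integral>x. (u x)\<^sup>2 *\<^sub>R D x \<partial>lborel) \<bullet> b"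
        by (rule integral_inner_left) (rule i1)
      moreover have "(\<integral>x. (\<phi> x *\<^sub>R ((2 * u x) *\<^sub>R g x)) \<bullet> b \<partial>lborel) = (\<integral>x. \<phi> x *\<^sub>R ((2 * u x) *\<^sub>R g x) \<partial>lborel) \<bullet> b"
        by (rule integral_inner_left) (rule i2)
      ultimately show "(\<integral>x. (u x)\<^sup>2 *\<^sub>R D x \<partial>lborel) \<bullet> b = - (\<integral>x. \<phi> x *\<^sub>R ((2 * u x) *\<^sub>R g x) \<partial>lborel) \<bullet> b"
        unfolding inner_minus_left by linarith
    qed
  qed
  then show ?thesis unfolding is_weak_gradient_def using f G by blast
qed

lemma weak_gradient_unique:
  assumes "is_weak_gradient u g" "is_weak_gradient u g'"
  shows "AE x in lborel. g x = g' x"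
proof -
  have "AE x in lborel. g x \<bullet> b - g' x \<bullet> b = 0" for b
  proof (rule fundamental_lemma)
    have l: "locally_integrable (\<lambda>x. g x \<bullet> b)" "locally_integrable (\<lambda>x. g' x \<bullet> b)"
      using assms locally_integrable_inner unfolding is_weak_gradient_def by blast+
    then show "locally_integrable (\<lambda>x. g x \<bullet> b - g' x \<bullet> b)" by (rule locally_integrable_diff)
    fix \<phi> :: "'a \<Rightarrow> real" assume \<phi>: "test_function \<phi>"
    obtain D where D0: "\<And>x. GDERIV \<phi> x :> D x" by (rule test_function_has_gradient[OF \<phi>]) blast
    obtain B r where D: "continuous_on UNIV D" "continuous_on UNIV \<phi>" "r \<ge> 0" "B \<ge> 0"
      "\<And>x. \<bar>\<phi> x\<bar> \<le> B * indicator (cball 0 r) x" "\<And>x. norm (D x) \<le> B * indicator (cball 0 r) x"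
      by (rule test_function_gradient[OF \<phi> D0]) blast
    have [measurable]: "\<phi> \<in> borel_measurable borel" using D(2) by (rule borel_measurable_continuous_onI)
    have i: "integrable lborel (\<lambda>x. \<phi> x * (g x \<bullet> b))" "integrable lborel (\<lambda>x. \<phi> x * (g' x \<bullet> b))"
      using integrable_locally_times_compact[OF l(1) _ D(5)] integrable_locally_times_compact[OF l(2) _ D(5)] by simp_all
    have "(\<integral>x. \<phi> x * (g x \<bullet> b) \<partial>lborel) = (\<integral>x. \<phi> x * (g' x \<bullet> b) \<partial>lborel)"
      using weak_gradient_directional[OF assms(1) \<phi> D0, of b] weak_gradient_directional[OF assms(2) \<phi> D0, of b] by simp
    then show "(\<integral>x. \<phi> x * (g x \<bullet> b - g' x \<bullet> b) \<partial>lborel) = 0"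
      using i by (simp add: right_diff_distrib)
  qed
  then have "AE x in lborel. \<forall>b\<in>Basis. g x \<bullet> b - g' x \<bullet> b = 0"
    by (intro AE_finite_allI) auto
  then show ?thesis by eventually_elim (auto intro: euclidean_eqI)
qed

text \<open>The chosen weak gradient of \<open>u\<^sup>2\<close> equals \<open>2 u g\<close> almost everywhere by uniqueness. The quotients
are kept unsimplified because they vanish where \<open>u\<close> does, unlike \<open>4 g\<^sup>2\<close>.\<close>

lemma fisher_information_square:
  fixes u :: "real ^ 'n::finite \<Rightarrow> real"
  assumes w: "is_weak_gradient u g" and u2: "integrable gauss (\<lambda>x. (u x)\<^sup>2)" and g2: "integrable gauss (\<lambda>x. (norm (g x))\<^sup>2)"
  shows "integrable gauss (\<lambda>x. (2 * u x * g x $ i)\<^sup>2 / (u x)\<^sup>2)"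
    and "fisher_information (\<lambda>x. (u x)\<^sup>2) = (\<Sum>i\<in>UNIV. \<integral>x. (2 * u x * g x $ i)\<^sup>2 / (u x)\<^sup>2 \<partial>gauss)"
proof -
  have [measurable]: "u \<in> borel_measurable borel" "g \<in> borel_measurable borel"
    using w by (simp_all add: is_weak_gradient_def locally_integrable_def)
  have "(\<lambda>x. g x \<bullet> axis i 1) \<in> borel_measurable borel" for i :: 'n by measurable
  then have gi[measurable]: "(\<lambda>x. g x $ i) \<in> borel_measurable borel" for i
    by (simp add: inner_axis)
  show int: "integrable gauss (\<lambda>x. (2 * u x * g x $ i)\<^sup>2 / (u x)\<^sup>2)" for i
  proof (rule Bochner_Integration.integrable_bound)
    show "integrable gauss (\<lambda>x. 4 * (norm (g x))\<^sup>2)" using g2 by simp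
    show "AE x in gauss. norm ((2 * u x * g x $ i)\<^sup>2 / (u x)\<^sup>2) \<le> norm (4 * (norm (g x))\<^sup>2)"
    proof (rule AE_I2)
      fix x
      have "(g x $ i)\<^sup>2 \<le> (norm (g x))\<^sup>2"
        using component_le_norm_cart[of "g x" i] by (simp add: abs_le_square_iff[symmetric])
      then show "norm ((2 * u x * g x $ i)\<^sup>2 / (u x)\<^sup>2) \<le> norm (4 * (norm (g x))\<^sup>2)"
        using fisher_integrand_le[of "u x" "g x $ i"] by simp
    qed
  qed simp
  have sq: "is_weak_gradient (\<lambda>x. (u x)\<^sup>2) (\<lambda>x. (2 * u x) *\<^sub>R g x)"
    by (rule weak_gradient_square[OF assms])
  then have "\<exists>G. is_weak_gradient (\<lambda>x. (u x)\<^sup>2) G" by blast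
  then have G: "is_weak_gradient (\<lambda>x. (u x)\<^sup>2) (weak_gradient (\<lambda>x. (u x)\<^sup>2))"
    unfolding weak_gradient_def by (rule someI_ex)
  then have [measurable]: "weak_gradient (\<lambda>x. (u x)\<^sup>2) \<in> borel_measurable borel"
    by (simp add: is_weak_gradient_def locally_integrable_def)
  have "AE x in gauss. weak_gradient (\<lambda>x. (u x)\<^sup>2) x = (2 * u x) *\<^sub>R g x"
    unfolding AE_gauss_iff by (rule weak_gradient_unique[OF G sq])
  then have "fisher_information (\<lambda>x. (u x)\<^sup>2) = (\<integral>x. (norm ((2 * u x) *\<^sub>R g x))\<^sup>2 / (u x)\<^sup>2 \<partial>gauss)"
    unfolding fisher_information_def by (intro integral_cong_AE) (auto elim: eventually_mono)
  also have "\<dots> = (\<integral>x. (\<Sum>i\<in>UNIV. (2 * u x * g x $ i)\<^sup>2 / (u x)\<^sup>2) \<partial>gauss)"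
  proof (intro Bochner_Integration.integral_cong refl)
    fix x
    have "(norm ((2 * u x) *\<^sub>R g x))\<^sup>2 = (\<Sum>i\<in>UNIV. (2 * u x * g x $ i)\<^sup>2)"
      unfolding norm_vec_def L2_set_def by (simp add: sum_nonneg)
    then show "(norm ((2 * u x) *\<^sub>R g x))\<^sup>2 / (u x)\<^sup>2 = (\<Sum>i\<in>UNIV. (2 * u x * g x $ i)\<^sup>2 / (u x)\<^sup>2)"
      by (simp add: sum_divide_distrib)
  qed
  also have "\<dots> = (\<Sum>i\<in>UNIV. \<integral>x. (2 * u x * g x $ i)\<^sup>2 / (u x)\<^sup>2 \<partial>gauss)"
    using int by (intro Bochner_Integration.integral_sum) auto
  finally show "fisher_information (\<lambda>x. (u x)\<^sup>2) = (\<Sum>i\<in>UNIV. \<integral>x. (2 * u x * g x $ i)\<^sup>2 / (u x)\<^sup>2 \<partial>gauss)" .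
qed

text \<open>Conditional expectation under the Gaussian measure given all coordinates except the \<open>i\<close>-th.
Where the restriction to a line is not integrable the value is 0; for integrable \<open>f\<close> this concerns a
null set of lines.\<close>

definition coord_avg :: "'n \<Rightarrow> (real ^ 'n \<Rightarrow> real) \<Rightarrow> real ^ 'n \<Rightarrow> real" where
  "coord_avg i f x = (\<integral>t. f (subst_coord x i t) \<partial>gauss)"

lemma coord_avg_subst_coord [simp]: "coord_avg i f (subst_coord x i t) = coord_avg i f x"
  by (simp add: coord_avg_def)

lemma coord_avg_measurable [measurable]:
  fixes f :: "real ^ 'n::finite \<Rightarrow> real"
  assumes [measurable]: "f \<in> borel_measurable borel"
  shows "coord_avg i f \<in> borel_measurable borel"
proof -
  interpret g: prob_space "gauss :: real measure" by (rule prob_space_gauss)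
  have "(\<lambda>(x, t). f (subst_coord x i t)) \<in> borel_measurable (borel \<Otimes>\<^sub>M borel)" by measurable
  then have "(\<lambda>(x, t). f (subst_coord x i t)) \<in> borel_measurable (borel \<Otimes>\<^sub>M gauss)"
    by (subst measurable_cong_sets[OF sets_pair_measure_cong[OF refl sets_gauss] refl])
  from g.borel_measurable_lebesgue_integral[OF this] show ?thesis
    by (simp add: coord_avg_def[abs_def])
qed

lemma coord_avg_nonneg: "(\<And>x. 0 \<le> f x) \<Longrightarrow> 0 \<le> coord_avg i f x"
  by (simp add: coord_avg_def)

text \<open>The estimate on lines, integrated over all lines in direction \<open>i\<close>. The masses of the lines
have mean 1, which accounts for the term \<open>2 + M\<close>.\<close>

lemma coordinate_stability:
  fixes u :: "real ^ 'n::finite \<Rightarrow> real" and i :: 'n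
  defines "f \<equiv> \<lambda>x. (u x)\<^sup>2"
  assumes w: "is_weak_gradient u g" and f: "integrable gauss f" "(\<integral>x. f x \<partial>gauss) = 1"
    and g2: "integrable gauss (\<lambda>x. (norm (g x))\<^sup>2)"
    and M: "M \<ge> 0" "\<And>x. (\<integral>\<^sup>+t. ennreal (t\<^sup>2 * f (subst_coord x i t)) \<partial>gauss) \<le> ennreal M"
    and c: "\<And>x. has_bochner_integral gauss (\<lambda>t. t * f (subst_coord x i t)) 0"
    and \<eta>: "\<eta> > 0"
  shows "(\<integral>\<^sup>+x. ennreal (\<bar>f x - coord_avg i f x\<bar> + 100 / \<eta> ^ 3 * (coord_avg i f x * ent_fun (f x / coord_avg i f x))) \<partial>gauss)
    \<le> ennreal (100 * (\<eta> * (2 + M) + (\<integral>x. (2 * u x * g x $ i)\<^sup>2 / (u x)\<^sup>2 \<partial>gauss) / 2 / \<eta> ^ 3))"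
proof -
  interpret gn: prob_space "gauss :: (real ^ 'n) measure" by (rule prob_space_gauss)
  have [measurable]: "u \<in> borel_measurable borel" "g \<in> borel_measurable borel"
    using w by (simp_all add: is_weak_gradient_def locally_integrable_def)
  have fm[measurable]: "f \<in> borel_measurable borel" unfolding f_def by measurable
  have "(\<lambda>x. g x \<bullet> axis i 1) \<in> borel_measurable borel" by measurable
  then have gi[measurable]: "(\<lambda>x. g x $ i) \<in> borel_measurable borel" by (simp add: inner_axis)
  define I where "I x = (2 * u x * g x $ i)\<^sup>2 / (u x)\<^sup>2" for x
  have Im[measurable]: "I \<in> borel_measurable borel" unfolding I_def by measurable
  have I: "integrable gauss I"
    unfolding I_def[abs_def] using fisher_information_square(1)[OF w _ g2] f(1) by (simp add: f_def)
  define J where "J x = (\<integral>t. I (subst_coord x i t) \<partial>gauss)" for x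
  have J: "integrable gauss J" "(\<integral>x. J x \<partial>gauss) = (\<integral>x. I x \<partial>gauss)"
    unfolding J_def using integral_gauss_slices[OF I, of i] by simp_all
  have m: "integrable gauss (coord_avg i f)" "(\<integral>x. coord_avg i f x \<partial>gauss) = 1"
    unfolding coord_avg_def[abs_def] using integral_gauss_slices[OF f(1), of i] f(2) by simp_all
  have f0: "0 \<le> f x" for x by (simp add: f_def)
  let ?F = "\<lambda>x. ennreal (\<bar>f x - coord_avg i f x\<bar> + 100 / \<eta> ^ 3 * (coord_avg i f x * ent_fun (f x / coord_avg i f x)))"
  let ?R = "\<lambda>x. 100 * (\<eta> * (2 * coord_avg i f x + M) + J x / 2 / \<eta> ^ 3)"
  have "(\<integral>\<^sup>+x. ?F x \<partial>gauss) = (\<integral>\<^sup>+x. \<integral>\<^sup>+t. ?F (subst_coord x i t) \<partial>gauss \<partial>gauss)"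
    by (rule nn_integral_gauss_slices) (simp add: ent_fun_def)
  also have "\<dots> \<le> (\<integral>\<^sup>+x. ennreal (?R x) \<partial>gauss)"
  proof (rule nn_integral_mono_AE)
    show "AE x in gauss. (\<integral>\<^sup>+t. ?F (subst_coord x i t) \<partial>gauss) \<le> ennreal (?R x)"
      using weak_gradient_ac_on_lines[OF w g2, of i] integral_gauss_slices(1)[OF f(1), of i]
    proof eventually_elim
      case (elim x)
      from elim(1) obtain v where v': "ac_deriv v (\<lambda>t. g (subst_coord x i t) $ i) \<and> (AE t in lborel. u (subst_coord x i t) = v t)
          \<and> integrable gauss (\<lambda>t. (g (subst_coord x i t) $ i)\<^sup>2)" by (rule exE)
      note v = conjunct1[OF v'] and uv = conjunct1[OF conjunct2[OF v']] and V = conjunct2[OF conjunct2[OF v']]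
      define V where "V t = g (subst_coord x i t) $ i" for t
      have [measurable]: "v \<in> borel_measurable borel" "V \<in> borel_measurable borel"
        using ac_deriv_continuous[OF v] ac_deriv_measurable[OF v]
        by (auto intro: borel_measurable_continuous_onI simp: V_def[abs_def])
      have uv': "AE t in gauss. u (subst_coord x i t) = v t" using uv by (simp add: AE_gauss_iff)
      have fv: "AE t in gauss. f (subst_coord x i t) = (v t)\<^sup>2" using uv' by eventually_elim (simp add: f_def)
      have mv: "coord_avg i f x = (\<integral>t. (v t)\<^sup>2 \<partial>gauss)"
        unfolding coord_avg_def using fv by (intro integral_cong_AE) simp_all
      have Jv: "J x = (\<integral>t. (2 * v t * V t)\<^sup>2 / (v t)\<^sup>2 \<partial>gauss)"
        unfolding J_def using uv' by (intro integral_cong_AE) (auto simp: I_def V_def elim: eventually_mono)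
      have iv: "integrable gauss (\<lambda>t. (v t)\<^sup>2)"
        using elim(2) fv by (subst integrable_cong_AE[of _ _ "\<lambda>t. f (subst_coord x i t)"]) (auto elim: eventually_mono)
      have cv: "has_bochner_integral gauss (\<lambda>t. t * (v t)\<^sup>2) 0"
        using c[of x] fv by (subst has_bochner_integral_cong_AE[of _ _ "\<lambda>t. t * f (subst_coord x i t)"]) (auto elim: eventually_mono)
      have Mv: "(\<integral>\<^sup>+t. ennreal (t\<^sup>2 * (v t)\<^sup>2) \<partial>gauss) \<le> ennreal M"
        using M(2)[of x] fv by (subst nn_integral_cong_AE[of _ "\<lambda>t. ennreal (t\<^sup>2 * f (subst_coord x i t))"]) (auto elim: eventually_mono)
      have "(\<integral>\<^sup>+t. ?F (subst_coord x i t) \<partial>gauss) = (\<integral>\<^sup>+t. ennreal (\<bar>(v t)\<^sup>2 - coord_avg i f x\<bar> + 100 / \<eta> ^ 3 * (coord_avg i f x * ent_fun ((v t)\<^sup>2 / coord_avg i f x))) \<partial>gauss)"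
        using fv by (intro nn_integral_cong_AE) (auto elim: eventually_mono)
      also have "\<dots> \<le> ennreal (?R x)"
        unfolding mv Jv using lsi_stability_line[of v V M \<eta>] v iv cv Mv M(1) V \<eta>
        unfolding gauss_real V_def[symmetric] by simp
      finally show ?case .
    qed
  qed
  also have "\<dots> = ennreal (\<integral>x. ?R x \<partial>gauss)"
  proof (rule nn_integral_eq_integral)
    show "integrable gauss ?R" using m J by simp
    have "0 \<le> J x" for x unfolding J_def I_def by simp
    then show "AE x in gauss. 0 \<le> ?R x"
      using coord_avg_nonneg[OF f0, of i] \<eta> M(1) by (intro AE_I2) simp
  qed
  also have "(\<integral>x. ?R x \<partial>gauss) = 100 * (\<eta> * (2 + M) + (\<integral>x. I x \<partial>gauss) / 2 / \<eta> ^ 3)"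
    using m J gn.prob_space by simp
  finally show ?thesis by (simp add: I_def)
qed

section \<open>Tensorisation\<close>

lemma integral_coord_avg:
  fixes f :: "real ^ 'n::finite \<Rightarrow> real"
  assumes "integrable gauss f"
  shows "integrable gauss (coord_avg i f)" "(\<integral>x. coord_avg i f x \<partial>gauss) = (\<integral>x. f x \<partial>gauss)"
  using integral_gauss_slices[OF assms, of i] by (simp_all add: coord_avg_def[abs_def])

lemma integral_mult_coord_avg:
  fixes f s :: "real ^ 'n::finite \<Rightarrow> real"
  assumes "integrable gauss (\<lambda>x. f x * coord_avg i s x)"
  shows "(\<integral>x. f x * coord_avg i s x \<partial>gauss) = (\<integral>x. coord_avg i f x * coord_avg i s x \<partial>gauss)"
  by (subst integral_gauss_slices(3)[OF assms, of i]) (simp add: coord_avg_def)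

definition indep_of_coord :: "'n \<Rightarrow> (real ^ 'n \<Rightarrow> real) \<Rightarrow> bool" where
  "indep_of_coord i f \<longleftrightarrow> (\<forall>x t. f (subst_coord x i t) = f x)"

lemma indep_of_coord_coord_avg: "indep_of_coord i (coord_avg i f)"
  by (simp add: indep_of_coord_def)

lemma coord_avg_preserves_indep:
  assumes "indep_of_coord j f"
  shows "indep_of_coord j (coord_avg i f)"
proof (cases "i = j")
  case False
  have "coord_avg i f (subst_coord x j t) = coord_avg i f x" for x t
    using assms unfolding coord_avg_def indep_of_coord_def
    by (subst subst_coord_commute[OF False[symmetric]]) simp
  then show ?thesis by (simp add: indep_of_coord_def)
qed (simp add: indep_of_coord_coord_avg)

primrec avg_along :: "'n list \<Rightarrow> (real ^ 'n \<Rightarrow> real) \<Rightarrow> real ^ 'n \<Rightarrow> real" where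
  "avg_along [] f = f"
| "avg_along (i # L) f = avg_along L (coord_avg i f)"

lemma indep_of_coord_avg_along:
  "i \<in> set L \<or> indep_of_coord i f \<Longrightarrow> indep_of_coord i (avg_along L f)"
  by (induction L arbitrary: f) (auto intro: indep_of_coord_coord_avg coord_avg_preserves_indep)

text \<open>Any point is reached from any other by overwriting the coordinates one after another.\<close>

lemma constant_if_indep_of_all_coords:
  fixes f :: "real ^ 'n::finite \<Rightarrow> real"
  assumes "\<And>i. indep_of_coord i f"
  shows "f x = f y"
proof -
  have "f (\<chi> j. if j \<in> S then y $ j else x $ j) = f x" if "finite S" for S :: "'n set"
    using that
  proof (induction S rule: finite_induct)
    case (insert i S)
    have "(\<chi> j. if j \<in> insert i S then y $ j else x $ j) = subst_coord (\<chi> j. if j \<in> S then y $ j else x $ j) i (y $ i)"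
      by (auto simp: subst_coord_def vec_eq_iff)
    then show ?case using assms[of i] insert.IH by (simp add: indep_of_coord_def)
  qed simp
  from this[of UNIV] show ?thesis by simp
qed

lemma avg_along_all:
  fixes f :: "real ^ 'n::finite \<Rightarrow> real"
  assumes f: "integrable gauss f" and L: "set L = UNIV"
  shows "avg_along L f x = (\<integral>y. f y \<partial>gauss)"
proof -
  interpret prob_space "gauss :: (real ^ 'n) measure" by (rule prob_space_gauss)
  have "(\<integral>y. avg_along L f y \<partial>gauss) = (\<integral>y. f y \<partial>gauss)" for L
    using f by (induction L arbitrary: f) (simp_all add: integral_coord_avg)
  moreover have "avg_along L f y = avg_along L f x" for y
    by (rule constant_if_indep_of_all_coords) (simp add: indep_of_coord_avg_along L)
  then have "(\<integral>y. avg_along L f y \<partial>gauss) = (\<integral>y. avg_along L f x \<partial>(gauss :: (real ^ 'n) measure))"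
    by (intro Bochner_Integration.integral_cong) auto
  ultimately show ?thesis using prob_space by simp
qed

text \<open>By duality with \<open>sgn (f - 1)\<close> the averaging is moved from \<open>f\<close> to a bounded function \<open>s\<close>,
for which all averages exist everywhere. Averaging is self-adjoint, so replacing \<open>s\<close> by its average
costs the integral of \<open>(f - coord_avg i f) * s\<close>; when all coordinates are averaged, \<open>s\<close> has become
its mean.\<close>

lemma L1_tensorization:
  fixes f :: "real ^ 'n::finite \<Rightarrow> real"
  assumes f: "integrable gauss f" "(\<integral>x. f x \<partial>gauss) = 1"
  shows "(\<integral>x. \<bar>f x - 1\<bar> \<partial>gauss) \<le> (\<Sum>i\<in>UNIV. \<integral>x. \<bar>f x - coord_avg i f x\<bar> \<partial>gauss)"
proof -
  interpret prob_space "gauss :: (real ^ 'n) measure" by (rule prob_space_gauss)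
  interpret g: prob_space "gauss :: real measure" by (rule prob_space_gauss)
  have fm[measurable]: "f \<in> borel_measurable borel" using borel_measurable_integrable[OF f(1)] by simp
  have int: "integrable gauss (\<lambda>x. h x * s x)"
    if h: "integrable gauss h" and s: "s \<in> borel_measurable borel" "\<And>x. \<bar>s x\<bar> \<le> 1" for h s :: "real ^ 'n \<Rightarrow> real"
  proof (rule Bochner_Integration.integrable_bound[OF h])
    show "(\<lambda>x. h x * s x) \<in> borel_measurable gauss"
      using borel_measurable_integrable[OF h] s(1) by simp
    show "AE x in gauss. norm (h x * s x) \<le> norm (h x)"
      using s(2) by (intro AE_I2) (simp add: abs_mult mult_left_le)
  qed
  have step: "(\<integral>x. f x * s x \<partial>gauss) \<le> (\<integral>x. f x * avg_along L s x \<partial>gauss) + (\<Sum>i\<leftarrow>L. \<integral>x. \<bar>f x - coord_avg i f x\<bar> \<partial>gauss)"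
    if "s \<in> borel_measurable borel" "\<And>x. \<bar>s x\<bar> \<le> 1" for L and s :: "real ^ 'n \<Rightarrow> real"
    using that
  proof (induction L arbitrary: s)
    case (Cons i L)
    note s = Cons.prems
    have sl: "integrable gauss (\<lambda>t. s (subst_coord x i t))" for x
      using s by (intro g.integrable_const_bound[of _ 1]) auto
    have a1: "\<bar>coord_avg i s x\<bar> \<le> 1" for x
    proof -
      have "\<bar>coord_avg i s x\<bar> \<le> (\<integral>t. \<bar>s (subst_coord x i t)\<bar> \<partial>gauss)"
        unfolding coord_avg_def using integral_norm_bound[of gauss "\<lambda>t. s (subst_coord x i t)"] by simp
      also have "\<dots> \<le> (\<integral>t. 1 \<partial>(gauss :: real measure))"
        using s(2) sl by (intro integral_mono) auto
      finally show ?thesis using g.prob_space by simp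
    qed
    have m1: "coord_avg i s \<in> borel_measurable borel" using s(1) by (rule coord_avg_measurable)
    have "(\<integral>x. f x * coord_avg i s x \<partial>gauss) = (\<integral>x. coord_avg i f x * s x \<partial>gauss)"
      using integral_mult_coord_avg[OF int[OF f(1) m1 a1]]
        integral_mult_coord_avg[of s i f] int[OF integral_coord_avg(1)[OF f(1)] s]
      by (simp add: mult.commute)
    moreover have "(\<integral>x. (f x - coord_avg i f x) * s x \<partial>gauss) = (\<integral>x. f x * s x \<partial>gauss) - (\<integral>x. coord_avg i f x * s x \<partial>gauss)"
      unfolding left_diff_distrib
      by (intro Bochner_Integration.integral_diff int f(1) integral_coord_avg(1) s)
    ultimately have "(\<integral>x. f x * s x \<partial>gauss) - (\<integral>x. f x * coord_avg i s x \<partial>gauss) = (\<integral>x. (f x - coord_avg i f x) * s x \<partial>gauss)"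
      by simp
    also have "\<dots> \<le> (\<integral>x. \<bar>f x - coord_avg i f x\<bar> \<partial>gauss)"
    proof (rule integral_mono)
      show "integrable gauss (\<lambda>x. (f x - coord_avg i f x) * s x)"
        using f(1) integral_coord_avg(1)[OF f(1)] by (intro int s) auto
      show "integrable gauss (\<lambda>x. \<bar>f x - coord_avg i f x\<bar>)"
        using f(1) integral_coord_avg(1)[OF f(1)] by simp
      fix x
      have "(f x - coord_avg i f x) * s x \<le> \<bar>f x - coord_avg i f x\<bar> * \<bar>s x\<bar>" by (metis abs_ge_self abs_mult)
      also have "\<dots> \<le> \<bar>f x - coord_avg i f x\<bar>" using s(2)[of x] by (intro mult_left_le) auto
      finally show "(f x - coord_avg i f x) * s x \<le> \<bar>f x - coord_avg i f x\<bar>" .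
    qed
    finally show ?case using Cons.IH[OF m1 a1] by simp
  qed simp
  obtain L :: "'n list" where L: "set L = UNIV" "distinct L" using finite_distinct_list[OF finite] by blast
  define s where "s x = sgn (f x - 1)" for x
  have s: "s \<in> borel_measurable borel" "\<bar>s x\<bar> \<le> 1" for x
    unfolding s_def[abs_def] by (simp_all add: sgn_if)
  have si: "integrable gauss s" using int[OF _ s, of "\<lambda>x. 1"] by simp
  have "(\<integral>x. \<bar>f x - 1\<bar> \<partial>gauss) = (\<integral>x. f x * s x - s x \<partial>gauss)"
    by (intro Bochner_Integration.integral_cong) (auto simp: s_def sgn_if abs_if)
  also have "\<dots> = (\<integral>x. f x * s x \<partial>gauss) - (\<integral>x. s x \<partial>gauss)"
    using int[OF f(1) s] si by simp
  also have "(\<integral>x. f x * s x \<partial>gauss) \<le> (\<integral>x. f x * avg_along L s x \<partial>gauss) + (\<Sum>i\<leftarrow>L. \<integral>x. \<bar>f x - coord_avg i f x\<bar> \<partial>gauss)"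
    by (rule step[OF s])
  also have "(\<integral>x. f x * avg_along L s x \<partial>gauss) = (\<integral>x. s x \<partial>gauss)"
    using f by (simp add: avg_along_all[OF si L(1)])
  also have "(\<Sum>i\<leftarrow>L. \<integral>x. \<bar>f x - coord_avg i f x\<bar> \<partial>gauss) = (\<Sum>i\<in>UNIV. \<integral>x. \<bar>f x - coord_avg i f x\<bar> \<partial>gauss)"
    using L by (simp add: sum_list_distinct_conv_sum_set)
  finally show ?thesis by simp
qed

text \<open>The inequality \<open>ln z \<le> z - 1\<close> at \<open>z = m * (G / P) / a\<close>: Young's inequality for the pairing of \<open>a\<close>
with \<open>ln (G / P)\<close>. The hypotheses allow the ratios to be degenerate where \<open>a\<close> vanishes.\<close>

lemma entropy_young:
  fixes a m G P :: real
  assumes "a \<ge> 0" "m \<ge> 0" "G \<ge> 0" "P \<ge> 0" "a > 0 \<Longrightarrow> m > 0 \<and> G > 0 \<and> P > 0"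
  shows "a * ln G \<le> a * ln P + (m * ent_fun (a / m) + m * (G / P) - m)"
proof (cases "a = 0")
  case True
  then show ?thesis using assms by (simp add: ent_fun_def)
next
  case False
  then have pos: "a > 0" "m > 0" "G > 0" "P > 0" using assms by auto
  define z where "z = m * (G / P) / a"
  have z: "z > 0" using pos by (simp add: z_def)
  have "a * ln z \<le> a * (z - 1)" using pos z by (intro mult_left_mono ln_le_minus_one) auto
  moreover have "ln z = ln m + (ln G - ln P) - ln a" using pos by (simp add: z_def ln_mult ln_div)
  moreover have "a * (z - 1) = m * (G / P) - a" using pos by (simp add: z_def field_simps)
  moreover have "m * ent_fun (a / m) = a * (ln a - ln m) - a + m"
    using pos by (simp add: ent_fun_def ln_div field_simps)
  ultimately show ?thesis by (simp add: algebra_simps)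
qed

text \<open>On the set where the average vanishes, which is a union of lines, \<open>f\<close> has integral zero.\<close>

lemma coord_avg_positive:
  fixes f :: "real ^ 'n::finite \<Rightarrow> real"
  assumes f: "integrable gauss f" "\<And>x. 0 \<le> f x"
  shows "AE x in gauss. f x > 0 \<longrightarrow> coord_avg i f x > 0"
proof -
  have [measurable]: "f \<in> borel_measurable borel" using borel_measurable_integrable[OF f(1)] by simp
  define z where "z x = (if coord_avg i f x = 0 then f x else 0)" for x
  have [measurable]: "z \<in> borel_measurable borel" unfolding z_def by measurable
  have z: "integrable gauss z"
    by (rule Bochner_Integration.integrable_bound[OF f(1)]) (auto simp: z_def)
  have "(\<integral>t. z (subst_coord x i t) \<partial>gauss) = 0" for x
    by (cases "coord_avg i f x = 0") (simp_all add: z_def, simp add: coord_avg_def)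
  then have "(\<integral>x. z x \<partial>gauss) = 0" using integral_gauss_slices(3)[OF z, of i] by simp
  then have "AE x in gauss. z x = 0"
    using z f(2) by (subst (asm) integral_nonneg_eq_0_iff_AE) (auto simp: z_def)
  then show ?thesis
  proof eventually_elim
    case (elim x)
    then show ?case using coord_avg_nonneg[of f i x] f(2) by (auto simp: z_def split: if_splits)
  qed
qed

text \<open>Along each line in direction \<open>i\<close> the ratio \<open>g / coord_avg i g\<close> has mean 1, or is constantly 0, while
\<open>coord_avg i f\<close> is constant.\<close>

lemma entropy_step_remainder:
  fixes f g :: "real ^ 'n::finite \<Rightarrow> real"
  assumes f: "integrable gauss f" "\<And>x. 0 \<le> f x" and g: "integrable gauss g" "\<And>x. 0 \<le> g x"
  shows "integrable gauss (\<lambda>x. coord_avg i f x * (g x / coord_avg i g x))"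
    and "(\<integral>x. coord_avg i f x * (g x / coord_avg i g x) \<partial>gauss) \<le> (\<integral>x. f x \<partial>gauss)"
proof -
  have [measurable]: "f \<in> borel_measurable borel" "g \<in> borel_measurable borel"
    using borel_measurable_integrable[OF f(1)] borel_measurable_integrable[OF g(1)] by simp_all
  define r where "r x = coord_avg i f x * (g x / coord_avg i g x)" for x
  have [measurable]: "r \<in> borel_measurable borel" unfolding r_def by measurable
  have nn: "0 \<le> coord_avg i f x" "0 \<le> coord_avg i g x" for x using coord_avg_nonneg f(2) g(2) by auto
  have r0: "0 \<le> r x" for x using nn g(2) by (simp add: r_def)
  have "(\<integral>\<^sup>+x. ennreal (r x) \<partial>gauss) = (\<integral>\<^sup>+x. \<integral>\<^sup>+t. ennreal (r (subst_coord x i t)) \<partial>gauss \<partial>gauss)"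
    by (rule nn_integral_gauss_slices) measurable
  also have "\<dots> \<le> (\<integral>\<^sup>+x. ennreal (coord_avg i f x) \<partial>gauss)"
  proof (rule nn_integral_mono)
    fix x
    show "(\<integral>\<^sup>+t. ennreal (r (subst_coord x i t)) \<partial>gauss) \<le> ennreal (coord_avg i f x)"
    proof (cases "coord_avg i g x = 0")
      case True
      then show ?thesis by (simp add: r_def)
    next
      case False
      then have i: "integrable gauss (\<lambda>t. g (subst_coord x i t))"
        unfolding coord_avg_def using not_integrable_integral_eq by blast
      have "(\<integral>\<^sup>+t. ennreal (r (subst_coord x i t)) \<partial>gauss) = ennreal (\<integral>t. r (subst_coord x i t) \<partial>gauss)"
        by (intro nn_integral_eq_integral AE_I2 r0) (use i in \<open>simp add: r_def\<close>)
      also have "(\<integral>t. r (subst_coord x i t) \<partial>gauss) = coord_avg i f x * ((\<integral>t. g (subst_coord x i t) \<partial>gauss) / coord_avg i g x)"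
        by (simp add: r_def)
      also have "(\<integral>t. g (subst_coord x i t) \<partial>gauss) = coord_avg i g x" by (simp add: coord_avg_def)
      finally show ?thesis using False by simp
    qed
  qed
  also have "\<dots> = ennreal (\<integral>x. f x \<partial>gauss)"
    using integral_coord_avg[OF f(1), of i] nn by (subst nn_integral_eq_integral) auto
  finally have *: "(\<integral>\<^sup>+x. ennreal (r x) \<partial>gauss) \<le> ennreal (\<integral>x. f x \<partial>gauss)" .
  then have ir: "integrable gauss r"
    using r0 by (intro integrableI_nonneg) (auto simp: order_le_less_trans)
  then show "integrable gauss (\<lambda>x. coord_avg i f x * (g x / coord_avg i g x))" by (simp add: r_def[abs_def])
  have "(\<integral>x. r x \<partial>gauss) \<le> (\<integral>x. f x \<partial>gauss)"
    using ir r0 * f(2) by (intro nn_le_imp_integral_le) auto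
  then show "(\<integral>x. coord_avg i f x * (g x / coord_avg i g x) \<partial>gauss) \<le> (\<integral>x. f x \<partial>gauss)"
    by (simp add: r_def)
qed

text \<open>Averaging \<open>f\<close> over one coordinate after another ends with the constant 1, so \<open>ln f\<close> telescopes
into logarithms of the ratios of successive averages \<open>g\<close> and \<open>coord_avg i g\<close>. Young's inequality bounds
\<open>f * ln (g / coord_avg i g)\<close> by the entropy density of \<open>f\<close> along direction \<open>i\<close> plus a term whose
integral is at most zero. Arguing pointwise also yields that \<open>f * ln f\<close> is integrable.\<close>

lemma entropy_tensorization:
  fixes f :: "real ^ 'n::finite \<Rightarrow> real"
  assumes f: "integrable gauss f" "\<And>x. 0 \<le> f x" "(\<integral>x. f x \<partial>gauss) = 1"
    and A: "\<And>i. integrable gauss (\<lambda>x. coord_avg i f x * ent_fun (f x / coord_avg i f x))"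
  shows "(\<integral>x. f x * ln (f x) \<partial>gauss) \<le> (\<Sum>i\<in>UNIV. \<integral>x. coord_avg i f x * ent_fun (f x / coord_avg i f x) \<partial>gauss)"
proof -
  interpret prob_space "gauss :: (real ^ 'n) measure" by (rule prob_space_gauss)
  have fm[measurable]: "f \<in> borel_measurable borel" using borel_measurable_integrable[OF f(1)] by simp
  let ?A = "\<lambda>i x. coord_avg i f x * ent_fun (f x / coord_avg i f x)"
  have step: "\<exists>R. integrable gauss R \<and> (\<integral>x. R x \<partial>gauss) \<le> (\<Sum>i\<leftarrow>L. \<integral>x. ?A i x \<partial>gauss)
      \<and> (AE x in gauss. f x * ln (g x) \<le> f x * ln (avg_along L g x) + R x)"
    if "integrable gauss g" "\<And>x. 0 \<le> g x" "AE x in gauss. f x > 0 \<longrightarrow> g x > 0" for L g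
    using that
  proof (induction L arbitrary: g)
    case Nil
    show ?case by (intro exI[of _ "\<lambda>x. 0"]) simp
  next
    case (Cons i L)
    note g = Cons.prems
    have gi: "integrable gauss (coord_avg i g)" "\<And>x. 0 \<le> coord_avg i g x"
      using integral_coord_avg(1)[OF g(1)] coord_avg_nonneg g(2) by auto
    have gp: "AE x in gauss. f x > 0 \<longrightarrow> coord_avg i g x > 0"
      using g(3) coord_avg_positive[OF g(1,2), of i] by eventually_elim auto
    from Cons.IH[OF gi gp] obtain R where R: "integrable gauss R" "(\<integral>x. R x \<partial>gauss) \<le> (\<Sum>i\<leftarrow>L. \<integral>x. ?A i x \<partial>gauss)"
      "AE x in gauss. f x * ln (coord_avg i g x) \<le> f x * ln (avg_along L (coord_avg i g) x) + R x" by blast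
    let ?r = "\<lambda>x. coord_avg i f x * (g x / coord_avg i g x)"
    note r = entropy_step_remainder[OF f(1,2) g(1,2), of i]
    note m = integral_coord_avg[OF f(1), of i]
    let ?R = "\<lambda>x. R x + (?A i x + ?r x - coord_avg i f x)"
    have "AE x in gauss. f x * ln (g x) \<le> f x * ln (avg_along (i # L) g x) + ?R x"
      using R(3) g(3) gp coord_avg_positive[OF f(1,2), of i]
    proof eventually_elim
      case (elim x)
      have "f x * ln (g x) \<le> f x * ln (coord_avg i g x) + (?A i x + ?r x - coord_avg i f x)"
        by (rule entropy_young) (use elim f(2) g(2) gi(2) coord_avg_nonneg[of f i x] in auto)
      then show ?case using elim(1) by simp
    qed
    moreover have "integrable gauss ?R"
      by (intro Bochner_Integration.integrable_add Bochner_Integration.integrable_diff R(1) A r(1) m(1))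
    moreover have "(\<integral>x. ?R x \<partial>gauss) = (\<integral>x. R x \<partial>gauss) + ((\<integral>x. ?A i x \<partial>gauss) + (\<integral>x. ?r x \<partial>gauss) - (\<integral>x. coord_avg i f x \<partial>gauss))"
      by (simp only: Bochner_Integration.integral_add Bochner_Integration.integral_diff
          Bochner_Integration.integrable_add Bochner_Integration.integrable_diff R(1) A r(1) m(1))
    then have "(\<integral>x. ?R x \<partial>gauss) \<le> (\<Sum>i\<leftarrow>i # L. \<integral>x. ?A i x \<partial>gauss)"
      using R(2) r(2) m(2) by simp
    ultimately show ?case by blast
  qed
  obtain L :: "'n list" where L: "set L = UNIV" "distinct L" using finite_distinct_list[OF finite] by blast
  obtain R where R: "integrable gauss R" "(\<integral>x. R x \<partial>gauss) \<le> (\<Sum>i\<leftarrow>L. \<integral>x. ?A i x \<partial>gauss)"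
      "AE x in gauss. f x * ln (f x) \<le> f x * ln (avg_along L f x) + R x"
    using step[OF f(1,2), of L] by auto
  have le: "AE x in gauss. f x * ln (f x) \<le> R x"
    using R(3) by (simp add: avg_along_all[OF f(1) L(1)] f(3))
  have ge: "f x - 1 \<le> f x * ln (f x)" for x using ent_fun_nonneg[OF f(2), of x] by (simp add: ent_fun_def)
  have "integrable gauss (\<lambda>x. f x * ln (f x))"
  proof (rule Bochner_Integration.integrable_bound)
    show "integrable gauss (\<lambda>x. \<bar>R x\<bar> + \<bar>f x - 1\<bar>)" using R(1) f(1) by simp
    show "AE x in gauss. norm (f x * ln (f x)) \<le> norm (\<bar>R x\<bar> + \<bar>f x - 1\<bar>)"
      using le
    proof eventually_elim
      case (elim x)
      then show ?case using ge[of x] unfolding real_norm_def by linarith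
    qed
  qed simp
  then have "(\<integral>x. f x * ln (f x) \<partial>gauss) \<le> (\<integral>x. R x \<partial>gauss)"
    using R(1) le by (rule integral_mono_AE)
  also have "\<dots> \<le> (\<Sum>i\<leftarrow>L. \<integral>x. ?A i x \<partial>gauss)" by (rule R(2))
  also have "\<dots> = (\<Sum>i\<in>UNIV. \<integral>x. ?A i x \<partial>gauss)"
    using L by (simp add: sum_list_distinct_conv_sum_set)
  finally show ?thesis .
qed

lemma deficit_bound:
  fixes f :: "real ^ 'n::finite \<Rightarrow> real"
  assumes fm: "f \<in> borel_measurable borel" and f0: "\<And>x. 0 \<le> f x"
    and ps: "prob_space (density gauss (\<lambda>x. ennreal (f x)))" and sob: "sobolev_W12_gauss (\<lambda>x. sqrt (f x))"
    and M: "M \<ge> 0" "\<And>i x. (\<integral>\<^sup>+t. ennreal (t\<^sup>2 * f (subst_coord x i t)) \<partial>gauss) \<le> ennreal M"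
    and c: "\<And>i x. has_bochner_integral gauss (\<lambda>t. t * f (subst_coord x i t)) 0"
    and \<eta>: "\<eta> > 0"
  shows "(\<integral>x. \<bar>f x - 1\<bar> \<partial>gauss) \<le> 100 * (real CARD('n) * (2 + M) * \<eta> + lsi_deficit f / \<eta> ^ 3)"
proof -
  have [measurable]: "f \<in> borel_measurable borel" by fact
  define u where "u x = sqrt (f x)" for x
  have fu: "f = (\<lambda>x. (u x)\<^sup>2)" using f0 by (simp add: u_def)
  obtain g where g: "is_weak_gradient u g" "integrable gauss (\<lambda>x. (norm (g x))\<^sup>2)" and f1: "integrable gauss f"
    using sob f0 unfolding sobolev_W12_gauss_def u_def[abs_def] by auto
  have int1: "(\<integral>x. f x \<partial>gauss) = 1"
  proof -
    interpret prob_space "density gauss (\<lambda>x. ennreal (f x))" by fact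
    have "ennreal (\<integral>x. f x \<partial>gauss) = (\<integral>\<^sup>+x. ennreal (f x) \<partial>gauss)"
      using f1 f0 by (simp add: nn_integral_eq_integral)
    also have "\<dots> = 1" using emeasure_space_1 by (simp add: emeasure_density)
    finally show ?thesis by simp
  qed
  define I where "I i = (\<integral>x. (2 * u x * g x $ i)\<^sup>2 / (u x)\<^sup>2 \<partial>gauss)" for i
  let ?E = "\<lambda>i x. coord_avg i f x * ent_fun (f x / coord_avg i f x)"
  have m0: "0 \<le> coord_avg i f x" for i x by (rule coord_avg_nonneg[OF f0])
  have E0: "0 \<le> ?E i x" for i x using m0 f0 by (simp add: ent_fun_nonneg)
  have coord: "integrable gauss (?E i)"
    "(\<integral>x. \<bar>f x - coord_avg i f x\<bar> \<partial>gauss) + 100 / \<eta> ^ 3 * (\<integral>x. ?E i x \<partial>gauss) \<le> 100 * (\<eta> * (2 + M) + I i / 2 / \<eta> ^ 3)" for i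
  proof -
    have *: "(\<integral>\<^sup>+x. ennreal (\<bar>f x - coord_avg i f x\<bar> + 100 / \<eta> ^ 3 * ?E i x) \<partial>gauss) \<le> ennreal (100 * (\<eta> * (2 + M) + I i / 2 / \<eta> ^ 3))"
      using coordinate_stability[of u g M i \<eta>] g f1 int1 M c \<eta> unfolding fu I_def by simp
    have Em: "?E i \<in> borel_measurable borel" unfolding ent_fun_def by measurable
    have iF: "integrable gauss (\<lambda>x. \<bar>f x - coord_avg i f x\<bar> + 100 / \<eta> ^ 3 * ?E i x)"
      using * Em E0 \<eta> by (intro integrableI_nonneg) (auto simp: order_le_less_trans)
    have ia: "integrable gauss (\<lambda>x. \<bar>f x - coord_avg i f x\<bar>)"
      using f1 integral_coord_avg(1)[OF f1] by simp
    have "integrable gauss (\<lambda>x. \<eta> ^ 3 / 100 * ((\<bar>f x - coord_avg i f x\<bar> + 100 / \<eta> ^ 3 * ?E i x) - \<bar>f x - coord_avg i f x\<bar>))"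
      by (intro integrable_mult_right Bochner_Integration.integrable_diff iF ia)
    then show iE: "integrable gauss (?E i)" using \<eta> by simp
    have I0: "0 \<le> I i" unfolding I_def by simp
    have "(\<integral>x. \<bar>f x - coord_avg i f x\<bar> + 100 / \<eta> ^ 3 * ?E i x \<partial>gauss) \<le> 100 * (\<eta> * (2 + M) + I i / 2 / \<eta> ^ 3)"
      using iF * E0 \<eta> M(1) I0 by (intro nn_le_imp_integral_le) auto
    then show "(\<integral>x. \<bar>f x - coord_avg i f x\<bar> \<partial>gauss) + 100 / \<eta> ^ 3 * (\<integral>x. ?E i x \<partial>gauss) \<le> 100 * (\<eta> * (2 + M) + I i / 2 / \<eta> ^ 3)"
      using ia iE by simp
  qed
  have fisher: "fisher_information f = (\<Sum>i\<in>UNIV. I i)"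
    unfolding fu I_def using fisher_information_square(2)[OF g(1) _ g(2)] f1 by (simp add: fu)
  have ent: "relative_entropy f \<le> (\<Sum>i\<in>UNIV. \<integral>x. ?E i x \<partial>gauss)"
    unfolding relative_entropy_def by (rule entropy_tensorization[OF f1 f0 int1 coord(1)])
  have "(\<integral>x. \<bar>f x - 1\<bar> \<partial>gauss) \<le> (\<Sum>i\<in>UNIV. \<integral>x. \<bar>f x - coord_avg i f x\<bar> \<partial>gauss)"
    by (rule L1_tensorization[OF f1 int1])
  also have "\<dots> \<le> (\<Sum>i\<in>(UNIV :: 'n set). 100 * (\<eta> * (2 + M)) + 100 / \<eta> ^ 3 * (I i / 2 - (\<integral>x. ?E i x \<partial>gauss)))"
  proof (rule sum_mono)
    fix i
    show "(\<integral>x. \<bar>f x - coord_avg i f x\<bar> \<partial>gauss) \<le> 100 * (\<eta> * (2 + M)) + 100 / \<eta> ^ 3 * (I i / 2 - (\<integral>x. ?E i x \<partial>gauss))"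
      using coord(2)[of i] by (simp add: right_diff_distrib distrib_left)
  qed
  also have "\<dots> = 100 * (real CARD('n) * (2 + M) * \<eta>) + 100 / \<eta> ^ 3 * (fisher_information f / 2 - (\<Sum>i\<in>UNIV. \<integral>x. ?E i x \<partial>gauss))"
    by (simp only: fisher sum.distrib sum_distrib_left[symmetric] sum_subtractf sum_divide_distrib[symmetric]) (simp add: algebra_simps)
  also have "\<dots> \<le> 100 * (real CARD('n) * (2 + M) * \<eta>) + 100 / \<eta> ^ 3 * lsi_deficit f"
    using ent \<eta> unfolding lsi_deficit_def by (intro add_left_mono mult_left_mono) auto
  finally show ?thesis by (simp add: distrib_left)
qed

text \<open>For positive \<open>d\<close> the choice \<open>\<eta> = d powr (1/4)\<close> balances the two terms. Otherwise the limit
\<open>\<eta> \<rightarrow> 0\<close> forces \<open>L\<close> to vanish.\<close>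

lemma optimise_parameter:
  fixes b d L :: real
  assumes b: "b > 0" and le: "\<And>\<eta>. \<eta> > 0 \<Longrightarrow> L \<le> 100 * (b * \<eta> + d / \<eta> ^ 3)" and L: "L \<ge> 0"
  shows "L \<le> 100 * (b + 1) * d powr (1/4)"
proof -
  have lim: "((\<lambda>\<eta>::real. 100 * (b * \<eta>)) \<longlongrightarrow> 100 * (b * 0)) (at_right 0)" by (intro tendsto_intros)
  consider "d > 0" | "d \<le> 0" by linarith
  then show ?thesis
  proof cases
    case 1
    define \<eta> where "\<eta> = d powr (1/4)"
    have \<eta>: "\<eta> > 0" using 1 by (simp add: \<eta>_def)
    have "\<eta> ^ 4 = d" using 1 by (simp add: \<eta>_def powr_power)
    then have "d / \<eta> ^ 3 = \<eta>" using \<eta> by (simp add: field_simps power4_eq_xxxx power3_eq_cube)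
    then show ?thesis using le[OF \<eta>] by (simp add: \<eta>_def algebra_simps)
  next
    case 2
    have "\<forall>\<^sub>F \<eta> in at_right 0. L \<le> 100 * (b * \<eta>)"
      using eventually_at_right_less[of 0]
    proof eventually_elim
      case (elim \<eta>)
      have "d / \<eta> ^ 3 \<le> 0" using elim 2 by (simp add: divide_nonpos_pos)
      then show ?case using le[OF elim] by simp
    qed
    then have "L \<le> 100 * (b * 0)" by (intro tendsto_lowerbound[OF lim]) auto
    moreover have "0 \<le> 100 * (b + 1) * d powr (1/4)" using b by simp
    ultimately show ?thesis by simp
  qed
qed

theorem corollary1p3:
  fixes M :: real
  assumes "M \<ge> 1"
  shows "\<exists>C>0. \<forall>f :: real ^ 'n \<Rightarrow> real.
     f \<in> borel_measurable borel \<longrightarrow>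
     (\<forall>x. 0 \<le> f x) \<longrightarrow>
     prob_space (density gauss (\<lambda>x. ennreal (f x))) \<longrightarrow>
     sobolev_W12_gauss (\<lambda>x. sqrt (f x)) \<longrightarrow>
     (\<forall>i x. (\<integral>\<^sup>+t. ennreal (t\<^sup>2 * f (subst_coord x i t)) \<partial>gauss) \<le> ennreal M) \<longrightarrow>
     (\<forall>i x. has_bochner_integral gauss (\<lambda>t. t * f (subst_coord x i t)) 0) \<longrightarrow>
     (\<integral>x. \<bar>f x - 1\<bar> \<partial>gauss) \<le> C * lsi_deficit f powr (1/4)"
proof (intro exI conjI allI impI)
  let ?b = "real CARD('n) * (2 + M)"
  have b: "?b > 0" using assms by simp
  show "100 * (?b + 1) > 0" using b by simp
  fix f :: "real ^ 'n \<Rightarrow> real"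
  assume f: "f \<in> borel_measurable borel" "\<forall>x. 0 \<le> f x" "prob_space (density gauss (\<lambda>x. ennreal (f x)))"
    "sobolev_W12_gauss (\<lambda>x. sqrt (f x))"
    "\<forall>i x. (\<integral>\<^sup>+t. ennreal (t\<^sup>2 * f (subst_coord x i t)) \<partial>gauss) \<le> ennreal M"
    "\<forall>i x. has_bochner_integral gauss (\<lambda>t. t * f (subst_coord x i t)) 0"
  show "(\<integral>x. \<bar>f x - 1\<bar> \<partial>gauss) \<le> 100 * (?b + 1) * lsi_deficit f powr (1/4)"
  proof (rule optimise_parameter)
    show "(\<integral>x. \<bar>f x - 1\<bar> \<partial>gauss) \<le> 100 * (?b * \<eta> + lsi_deficit f / \<eta> ^ 3)" if "\<eta> > 0" for \<eta>
      using f assms that by (intro deficit_bound) auto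
  qed (use b in auto)
qed

end
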